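(* Every graph $G$ in ${\cal H}_4$ is $3$-colorable; that is, every finite simple graph $G$ that has girth $8$ and has no even hole of length at least $10$ admits a map $c:V(G)\to\{1,2,3\}$ with $c(u)\neq c(v)$ whenever $uv\in E(G)$.
   Context: All graphs are finite, simple and undirected. The girth of a graph is the minimum length of a cycle in it. A hole in a graph is an induced cycle of length at least $4$; it is even if its length is even. For an integer $\ell\ge 2$, ${\cal H}_\ell$ denotes the family of graphs that have girth (exactly) $2\ell$ and have no even hole of length at least $2\ell+2$. *)

theory Defs
  imports "Graph_Theory.Digraph_Component" "HOL-Library.Extended_Nat"
begin

text \<open>
  A finite simple undirected graph is a \<^locale>\<open>pair_graph\<close>: a finite, loop-free, symmetric
  digraph without parallel arcs, in which an edge $uv$ is the pair of arcs $(u,v)$, $(v,u)$.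

  The library's notion of a cycle is a non-empty closed arc walk without repeated vertices. In a
  symmetric digraph this also admits the walk $u, v, u$ along a single edge; the bound on the length
  removes exactly these degenerate cycles.
\<close>

definition graph_cycle :: "'a pair_pre_digraph \<Rightarrow> ('a \<times> 'a) awalk \<Rightarrow> bool" where
  "graph_cycle G p \<longleftrightarrow> pre_digraph.cycle (with_proj G) p \<and> 3 \<le> length p"

text \<open>The girth of a forest is \<open>\<infinity>\<close>.\<close>

definition girth :: "'a pair_pre_digraph \<Rightarrow> enat" where
  "girth G = (INF p \<in> {p. graph_cycle G p}. enat (length p))"

definition cycle_subgraph :: "('a \<times> 'a) awalk \<Rightarrow> 'a pair_pre_digraph" where
  "cycle_subgraph p = \<lparr> pverts = fst ` set p, parcs = set p \<union> (set p)\<inverse> \<rparr>"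

definition hole :: "'a pair_pre_digraph \<Rightarrow> ('a \<times> 'a) awalk \<Rightarrow> bool" where
  "hole G p \<longleftrightarrow> graph_cycle G p \<and> 4 \<le> length p
     \<and> induced_subgraph (with_proj (cycle_subgraph p)) (with_proj G)"

definition even_hole :: "'a pair_pre_digraph \<Rightarrow> ('a \<times> 'a) awalk \<Rightarrow> bool" where
  "even_hole G p \<longleftrightarrow> hole G p \<and> even (length p)"

definition family_H :: "nat \<Rightarrow> 'a pair_pre_digraph set" where
  "family_H l = {G. pair_graph G \<and> girth G = enat (2 * l)
     \<and> \<not> (\<exists>p. even_hole G p \<and> 2 * l + 2 \<le> length p)}"

definition colorable :: "nat \<Rightarrow> 'a pair_pre_digraph \<Rightarrow> bool" where
  "colorable k G \<longleftrightarrow> (\<exists>c :: 'a \<Rightarrow> nat.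
     (\<forall>v \<in> pverts G. c v \<in> {1..k}) \<and> (\<forall>(u, v) \<in> parcs G. c u \<noteq> c v))"

lemma girth_eq_iff:
  "girth G = enat n \<longleftrightarrow>
     (\<exists>p. graph_cycle G p \<and> length p = n) \<and> (\<forall>p. graph_cycle G p \<longrightarrow> n \<le> length p)"
proof
  assume g: "girth G = enat n"
  let ?S = "(\<lambda>p. enat (length p)) ` {p. graph_cycle G p}"
  have "?S \<noteq> {}"
    using g unfolding girth_def Inf_enat_def by (auto split: if_splits)
  then have "Inf ?S \<in> ?S"
    unfolding Inf_enat_def by (auto intro: LeastI)
  moreover have "n \<le> length p" if "graph_cycle G p" for p
  proof -
    have "girth G \<le> enat (length p)"
      unfolding girth_def using that by (intro INF_lower) simp
    then show ?thesis using g by simp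
  qed
  ultimately show "(\<exists>p. graph_cycle G p \<and> length p = n)
      \<and> (\<forall>p. graph_cycle G p \<longrightarrow> n \<le> length p)"
    using g unfolding girth_def by auto
next
  assume "(\<exists>p. graph_cycle G p \<and> length p = n) \<and> (\<forall>p. graph_cycle G p \<longrightarrow> n \<le> length p)"
  then show "girth G = enat n"
    unfolding girth_def by (intro antisym) (auto intro: INF_lower2 INF_greatest)
qed

lemma (in pair_graph) hole_iff_chordless:
  "hole G p \<longleftrightarrow> graph_cycle G p \<and> 4 \<le> length p
     \<and> (\<forall>u \<in> fst ` set p. \<forall>v \<in> fst ` set p.
          (u, v) \<in> parcs G \<longrightarrow> (u, v) \<in> set p \<or> (v, u) \<in> set p)"
proof (cases "graph_cycle G p")
  case True
  then obtain u where u: "awalk u p u" and ne: "p \<noteq> []"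
    by (auto simp: graph_cycle_def cycle_def)
  have sub: "set p \<subseteq> parcs G"
    using u by (simp add: awalk_def)
  have snd_eq: "insert x (snd ` set q) = insert y (fst ` set q)" if "pcas x q y" for x y and q :: "('a \<times> 'a) list"
    using that by (induction x q y rule: pcas.induct) auto
  have last: "y \<in> snd ` set q" if "pcas x q y" "q \<noteq> []" for x y and q :: "('a \<times> 'a) list"
    using that by (induction x q y rule: pcas.induct) (auto, metis pcas.simps(1))
  have first: "x \<in> fst ` set q" if "pcas x q y" "q \<noteq> []" for x y and q :: "('a \<times> 'a) list"
    using that by (cases q) auto
  have c: "pcas u p u" using u by (simp add: awalk_def)
  have verts: "snd ` set p = fst ` set p"
    using snd_eq[OF c] last[OF c ne] first[OF c ne] by (simp add: insert_absorb)
  have snd_in: "b \<in> fst ` set p" if "(a, b) \<in> set p" for a b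
    using that verts by (metis image_eqI snd_conv)
  have fst_in: "a \<in> fst ` set p" if "(a, b) \<in> set p" for a b
    using that by (metis image_eqI fst_conv)
  have sym: "(b, a) \<in> parcs G" if "(a, b) \<in> parcs G" for a b
    using that pair_sym_arcs by (auto simp: symmetric_def dest: symD)
  have V: "fst ` set p \<subseteq> pverts G"
    using sub arc_fst_in_verts by blast
  have A: "set p \<union> (set p)\<inverse> \<subseteq> parcs G"
    using sub sym by auto
  have wf: "wf_digraph (with_proj (cycle_subgraph p))"
    by unfold_locales (auto simp: cycle_subgraph_def intro: fst_in snd_in)
  have "subgraph (with_proj (cycle_subgraph p)) (with_proj G)"
    using V A wf wf_digraph_axioms
    by (auto simp: subgraph_def compatible_def cycle_subgraph_def)
  then have "induced_subgraph (with_proj (cycle_subgraph p)) (with_proj G) \<longleftrightarrow>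
      set p \<union> (set p)\<inverse> = {e \<in> parcs G. fst e \<in> fst ` set p \<and> snd e \<in> fst ` set p}"
    by (simp add: induced_subgraph_def cycle_subgraph_def)
  also have "\<dots> \<longleftrightarrow> {e \<in> parcs G. fst e \<in> fst ` set p \<and> snd e \<in> fst ` set p}
      \<subseteq> set p \<union> (set p)\<inverse>"
    using A fst_in snd_in by (auto 0 3)
  also have "\<dots> \<longleftrightarrow> (\<forall>u \<in> fst ` set p. \<forall>v \<in> fst ` set p.
          (u, v) \<in> parcs G \<longrightarrow> (u, v) \<in> set p \<or> (v, u) \<in> set p)"
    unfolding subset_iff split_paired_All by (simp add: Ball_def) blast
  finally show ?thesis
    using True by (simp add: hole_def)
next
  case False
  then show ?thesis by (simp add: hole_def)
qed

end

theory Submission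
  imports Defs "Graph_Theory.Vertex_Walk"
begin

text \<open>
  Let \<open>G\<close> have girth \<open>8\<close> and no even hole of length at least \<open>10\<close>. Then every cycle has length
  at least \<open>8\<close> and every even induced cycle has length exactly \<open>8\<close>. Both properties pass to induced
  subgraphs, so it is enough to find a vertex of degree at most two in every non-empty induced
  subgraph (\<open>degree_le_two\<close>): a greedy colouring with three colours follows.

  Suppose that \<open>G[W]\<close> has minimum degree at least three, and let \<open>C\<close> be a shortest cycle of it. Its
  length is \<open>8\<close> or odd, it is induced, a vertex outside has at most one neighbour on it, and the
  neighbours of \<open>C\<close> are pairwise non-adjacent. The vertices at distance at least two from \<open>C\<close> form a
  \<^emph>\<open>pocket\<close>: a non-empty set \<open>D\<close> outside the closed neighbourhood of \<open>C\<close> whose vertices have all their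
  neighbours in \<open>D\<close> or next to \<open>C\<close>, and at least three of them. Among all pockets, for all \<open>W\<close> and
  \<open>C\<close>, take one with the fewest vertices. Minimality says: if \<open>C'\<close> is a shortest cycle of a subgraph
  around \<open>D\<close> and \<open>C'\<close> meets \<open>D\<close>, then every component left after deleting the closed neighbourhood of
  \<open>C'\<close> reaches a vertex outside \<open>D\<close> (\<open>outer_touch\<close>), because otherwise it would be a smaller pocket. As
  the part outside \<open>D\<close> is simple, this usually makes everything around \<open>C'\<close> connected.

  Connectedness around a shortest cycle contradicts parity. An \<^emph>\<open>ear\<close> of \<open>C\<close> is an induced path outside
  \<open>C\<close> that is joined to \<open>C\<close> only by its ends, at \<open>c\<close> and \<open>d\<close>; with the two arcs of \<open>C\<close> it bounds two
  cycles. If \<open>C\<close> is odd, one of them is even and too long, unless \<open>c\<close> and \<open>d\<close> are adjacent. If \<open>C\<close> has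
  length \<open>8\<close>, the arcs have the same parity, which determines the parity of the ear. There are only two
  exceptions: ears with six vertices between adjacent vertices of \<open>C\<close>, and ears with three vertices
  between opposite ones. On the other hand, any three vertices of a connected set can be joined pairwise
  by three induced paths with an odd total number of vertices (\<open>three_paths_odd\<close>). So a connected set
  outside \<open>C\<close> with exactly three attachments to \<open>C\<close> contains an exceptional ear
  (\<open>tripod_exceptional_ear\<close>), and there is no such set for three positions such as \<open>0, 2, 5\<close>, which are
  pairwise neither adjacent nor opposite on a cycle of length \<open>8\<close> (\<open>no_separated_tripod\<close>).

  This is applied three times. An exceptional ear through the minimal pocket would give a second cycle
  of length \<open>8\<close> that meets \<open>D\<close>, and the connected set around that cycle leads to a contradiction
  (\<open>no_six_ear\<close>, \<open>no_three_ear\<close>). Without exceptional ears, \<open>D\<close> is attached to \<open>C\<close> at no more than two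
  vertices, so of \<open>C\<close> only an arc \<open>Q\<close> with at most five vertices matters (\<open>handle_exists\<close>). Finally let
  \<open>C'\<close> be a shortest cycle of the subgraph formed by \<open>D\<close>, its neighbours and \<open>Q\<close>. The part of \<open>Q\<close>
  outside \<open>C'\<close> is a path \<open>M\<close> that connects everything around \<open>C'\<close>, and only the ends of \<open>M\<close> can be
  adjacent to \<open>C'\<close>. If at most one end is, positions \<open>0, 2, 5\<close> give a contradiction (\<open>one_terminal\<close>); if
  both are, \<open>M\<close> is an ear of \<open>C'\<close>, and a third attachment in the middle of an arc of \<open>C'\<close> gives one
  (\<open>two_terminals\<close>).
\<close>

lemma third_element:
  assumes "3 \<le> card S" shows "\<exists>c\<in>S. c \<noteq> a \<and> c \<noteq> b"
proof (rule ccontr)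
  assume "\<not> ?thesis"
  then have "S \<subseteq> {a, b}" by blast
  then have "card S \<le> card {a, b}" by (intro card_mono) auto
  then show False using assms card_insert_le_m1[of 2 "{b}" a] by (auto simp: card_insert_if split: if_splits)
qed

section \<open>Induced paths and cycles as vertex lists\<close>

locale sgraph =
  fixes E :: "'a \<Rightarrow> 'a \<Rightarrow> bool"
  assumes sym: "E x y \<Longrightarrow> E y x" and irr: "\<not> E x x"
begin

lemma symE: "E x y \<longleftrightarrow> E y x" using sym by blast

text \<open>
  The empty list counts as an induced path, so that the property passes to all sublists of
  consecutive entries.
\<close>

fun ind_path :: "'a list \<Rightarrow> bool" where
  "ind_path [] \<longleftrightarrow> True"
| "ind_path (x # Q) \<longleftrightarrow> ind_path Q \<and> x \<notin> set Q \<and> (\<forall>y\<in>set Q. E x y \<longleftrightarrow> y = hd Q)"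

definition vcycle :: "'a list \<Rightarrow> bool" where
  "vcycle cs \<longleftrightarrow> 3 \<le> length cs \<and> distinct cs \<and> successively E cs \<and> E (last cs) (hd cs)"

definition ind_cycle :: "'a list \<Rightarrow> bool" where
  "ind_cycle cs \<longleftrightarrow> 4 \<le> length cs \<and> ind_path (tl cs) \<and> hd cs \<notin> set (tl cs) \<and>
     (\<forall>y\<in>set (tl cs). E (hd cs) y \<longleftrightarrow> y = hd (tl cs) \<or> y = last cs)"

text \<open>
  Induced paths and cycles are glued from pieces throughout; the edges between two pieces decide
  whether the result is induced.
\<close>

lemma ind_path_append:
  "ind_path (P @ Q) \<longleftrightarrow> ind_path P \<and> ind_path Q \<and> set P \<inter> set Q = {} \<and>
     (\<forall>x\<in>set P. \<forall>y\<in>set Q. E x y \<longleftrightarrow> x = last P \<and> y = hd Q)"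
proof (induction P)
  case (Cons a P)
  show ?case
  proof (cases "P = []")
    case True
    then show ?thesis by auto
  next
    case False
    then have m: "last P \<in> set P" "hd (P @ Q) = hd P" "hd P \<in> set P" "last (a # P) = last P" by auto
    define A B p q p' where d: "A = set P" "B = set Q" "p = hd P" "q = hd Q" "p' = last P"
    have m': "p' \<in> A" "p \<in> A" using m by (simp_all add: d)
    have key: "((A \<inter> B = {} \<and> (\<forall>x\<in>A. \<forall>y\<in>B. E x y \<longleftrightarrow> x = p' \<and> y = q)) \<and> a \<notin> A \<union> B \<and>
        (\<forall>y\<in>A \<union> B. E a y \<longleftrightarrow> y = p)) \<longleftrightarrow>
      (a \<notin> A \<and> (\<forall>y\<in>A. E a y \<longleftrightarrow> y = p) \<and> insert a A \<inter> B = {} \<and>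
        (\<forall>x\<in>insert a A. \<forall>y\<in>B. E x y \<longleftrightarrow> x = p' \<and> y = q))" (is "?l \<longleftrightarrow> ?r")
    proof
      assume l: ?l
      then have "p \<notin> B" "a \<noteq> p'" using m' by auto
      then show ?r using l by simp blast
    next
      assume r: ?r
      then have "p \<notin> B" "a \<noteq> p'" using m' by auto
      then show ?l using r by simp blast
    qed
    show ?thesis unfolding append_Cons ind_path.simps Cons.IH list.set set_append m d[symmetric] using key by argo
  qed
qed auto

lemma ind_path_rev: "ind_path P \<Longrightarrow> ind_path (rev P)"
proof (induction P)
  case (Cons x P)
  have "x \<notin> set P" "ind_path (rev P)" using Cons by auto
  moreover have "(\<forall>y\<in>set P. E y x \<longleftrightarrow> y = last (rev P))" using Cons.prems symE by (simp add: last_rev)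
  ultimately show ?case by (simp add: ind_path_append)
qed simp

lemma ind_path_distinct: "ind_path P \<Longrightarrow> distinct P"
  by (induction P) auto

lemma ind_path_successively: "ind_path P \<Longrightarrow> successively E P"
proof (induction P)
  case (Cons x P)
  then show ?case by (cases P) (auto simp: successively_Cons)
qed simp

lemma ind_path_splitD: "ind_path (P @ Q) \<Longrightarrow> ind_path P \<and> ind_path Q"
  by (simp add: ind_path_append)

lemma ind_path_snoc_split: "ind_path (P1 @ a # P2) \<Longrightarrow> ind_path (P1 @ [a]) \<and> ind_path (a # P2)"
  using ind_path_splitD[of "P1 @ [a]" P2] ind_path_splitD[of P1 "a # P2"] by simp

lemma ind_cycle_append:
  assumes "P \<noteq> []" "Q \<noteq> []"
  shows "ind_cycle (P @ Q) \<longleftrightarrow> 4 \<le> length P + length Q \<and> ind_path P \<and> ind_path Q \<and> set P \<inter> set Q = {} \<and>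
     (\<forall>x\<in>set P. \<forall>y\<in>set Q. E x y \<longleftrightarrow> x = last P \<and> y = hd Q \<or> x = hd P \<and> y = last Q)"
proof (cases P)
  case (Cons x P')
  show ?thesis
  proof (cases "P' = []")
    case True
    then show ?thesis using assms Cons by (auto simp: ind_cycle_def)
  next
    case False
    have m: "last P' \<in> set P'" "hd P' \<in> set P'" "last Q \<in> set Q" "hd Q \<in> set Q" using False assms by auto
    have s: "hd (P' @ Q) = hd P'" "last (x # P' @ Q) = last Q" "last (x # P') = last P'"
      using False assms by auto
    have L: "ind_cycle (P @ Q) \<longleftrightarrow> 4 \<le> length P + length Q \<and> (ind_path P' \<and> ind_path Q \<and> set P' \<inter> set Q = {} \<and>
      (\<forall>u\<in>set P'. \<forall>y\<in>set Q. E u y \<longleftrightarrow> u = last P' \<and> y = hd Q)) \<and> x \<notin> set P' \<and> x \<notin> set Q \<and>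
      (\<forall>y\<in>set P'. E x y \<longleftrightarrow> y = hd P' \<or> y = last Q) \<and> (\<forall>y\<in>set Q. E x y \<longleftrightarrow> y = hd P' \<or> y = last Q)"
      unfolding ind_cycle_def Cons append_Cons list.sel s by (simp only: ind_path_append s ball_Un set_append) auto
    have R: "ind_path P \<longleftrightarrow> ind_path P' \<and> x \<notin> set P' \<and> (\<forall>y\<in>set P'. E x y \<longleftrightarrow> y = hd P')"
      by (simp add: Cons)
    define A B p q p' q' where d: "A = set P'" "B = set Q" "p = hd P'" "q = hd Q" "p' = last P'" "q' = last Q"
    have m': "p \<in> A" "q \<in> B" "p' \<in> A" "q' \<in> B" using m by (simp_all add: d)
    have key: "(A \<inter> B = {} \<and> (\<forall>u\<in>A. \<forall>y\<in>B. E u y \<longleftrightarrow> u = p' \<and> y = q) \<and> x \<notin> A \<and> x \<notin> B \<and>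
      (\<forall>y\<in>A. E x y \<longleftrightarrow> y = p \<or> y = q') \<and> (\<forall>y\<in>B. E x y \<longleftrightarrow> y = p \<or> y = q'))
      \<longleftrightarrow> (x \<notin> A \<and> (\<forall>y\<in>A. E x y \<longleftrightarrow> y = p) \<and> insert x A \<inter> B = {} \<and>
      (\<forall>u\<in>insert x A. \<forall>y\<in>B. E u y \<longleftrightarrow> u = p' \<and> y = q \<or> u = x \<and> y = q'))" (is "?l = ?r")
    proof
      assume l: ?l
      then have "p \<notin> B" "q' \<notin> A" "\<And>u. u \<in> A \<Longrightarrow> u \<noteq> x" "p' \<noteq> x" using m' by auto
      then show ?r using l by simp blast
    next
      assume r: ?r
      then have "p \<notin> B" "q' \<notin> A" "\<And>u. u \<in> A \<Longrightarrow> u \<noteq> x" "p' \<noteq> x" using m' by auto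
      then show ?l using r by simp metis
    qed
    show ?thesis unfolding L R using key unfolding d[symmetric] Cons list.sel list.set s by argo
  qed
qed (use assms in auto)

lemma ind_cycle_appendI:
  assumes "P \<noteq> []" "Q \<noteq> []" "4 \<le> length P + length Q" "ind_path P" "ind_path Q" "set P \<inter> set Q = {}"
    "\<And>x y. x \<in> set P \<Longrightarrow> y \<in> set Q \<Longrightarrow> E x y \<longleftrightarrow> x = last P \<and> y = hd Q \<or> x = hd P \<and> y = last Q"
  shows "ind_cycle (P @ Q)"
  using assms by (simp add: ind_cycle_append)

lemma ind_cycle_swap:
  assumes "ind_cycle (P @ Q)" shows "ind_cycle (Q @ P)"
proof (cases "P = [] \<or> Q = []")
  case False
  then have *: "P \<noteq> []" "Q \<noteq> []" by auto
  show ?thesis using assms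
    unfolding ind_cycle_append[OF *] ind_cycle_append[OF *(2,1)]
    by (simp add: Int_commute add.commute) (metis symE)
qed (use assms in auto)

lemma ind_cycle_vcycle: 
  assumes "ind_cycle cs" shows "vcycle cs"
proof -
  obtain x Q where cs: "cs = x # Q" using assms by (cases cs) (auto simp: ind_cycle_def)
  have Q: "ind_path Q" "Q \<noteq> []" "x \<notin> set Q" "E x (hd Q)" "E x (last Q)" "4 \<le> length cs"
    using assms hd_in_set[of Q] last_in_set[of Q] by (auto simp: ind_cycle_def cs split: if_splits)
  show ?thesis
    using Q ind_path_distinct[OF Q(1)] ind_path_successively[OF Q(1)] sym[OF Q(5)]
    by (simp add: vcycle_def cs successively_Cons)
qed

lemma vcycle_swap:
  assumes "vcycle (P @ Q)" shows "vcycle (Q @ P)"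
proof (cases "P = [] \<or> Q = []")
  case False
  then show ?thesis using assms by (auto simp: vcycle_def successively_append_iff)
qed (use assms in auto)

lemma vcycle_arc:
  assumes "vcycle (c # X @ d # Y)"
  shows "distinct (c # X @ [d])" "successively E (c # X @ [d])"
proof -
  have "distinct ((c # X @ [d]) @ Y)" "successively E ((c # X @ [d]) @ Y)"
    using assms by (auto simp: vcycle_def)
  then show "distinct (c # X @ [d])" "successively E (c # X @ [d])"
    unfolding successively_append_iff distinct_append by blast+
qed

lemma vcycle_chord:
  assumes "vcycle (c # X @ d # Y)" "E c d" "X \<noteq> []"
  shows "vcycle (c # X @ [d])"
proof -
  have "Suc 0 \<le> length X" using assms(3) by (cases X) auto
  then show ?thesis using vcycle_arc[OF assms(1)] sym[OF assms(2)] by (simp add: vcycle_def)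
qed

lemma vcycle_Cons:
  assumes "distinct L" "successively E L" "v \<notin> set L" "E v (hd L)" "E (last L) v" "2 \<le> length L"
  shows "vcycle (v # L)"
proof -
  have "L \<noteq> []" using assms(6) by auto
  then show ?thesis using assms by (simp add: vcycle_def successively_Cons)
qed

lemma ind_path_if_chordless:
  assumes "distinct Q" "successively E Q"
    "\<forall>P1 a P2 b P3. Q = P1 @ a # P2 @ b # P3 \<longrightarrow> E a b \<longrightarrow> P2 = []"
  shows "ind_path Q"
  using assms
proof (induction Q)
  case (Cons x Q)
  have c: "P2 = []" if "x # Q = P1 @ a # P2 @ b # P3" "E a b" for P1 a P2 b P3
    using Cons.prems(3) that by blast
  have s: "successively E Q" "Q \<noteq> [] \<Longrightarrow> E x (hd Q)" "distinct Q" "x \<notin> set Q"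
    using Cons.prems(1,2) by (auto simp: successively_Cons)
  have "P2 = []" if "Q = P1 @ a # P2 @ b # P3" "E a b" for P1 a P2 b P3
    by (rule c[of "x # P1" a P2 b P3]) (use that in simp_all)
  then have "ind_path Q" using Cons.IH s by blast
  moreover have "E x y \<longleftrightarrow> y = hd Q" if y: "y \<in> set Q" for y
  proof
    assume xy: "E x y"
    obtain P2 P3 where Q: "Q = P2 @ y # P3" using split_list[OF y] by blast
    have "P2 = []" by (rule c[of "[]" x P2 y P3]) (use Q xy in simp_all)
    then show "y = hd Q" using Q by simp
  next
    assume "y = hd Q"
    moreover have "Q \<noteq> []" using y by auto
    ultimately show "E x y" using s by simp
  qed
  ultimately show ?case using s by simp
qed simp

lemma vcycle_two_nb:
  assumes "vcycle ds" "v \<in> set ds" shows "\<exists>a\<in>set ds. \<exists>b\<in>set ds. a \<noteq> b \<and> E v a \<and> E v b"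
proof -
  obtain A B where ds: "ds = A @ v # B" using split_list[OF assms(2)] by blast
  have c: "vcycle (v # B @ A)" using vcycle_swap[of A "v # B"] assms(1) ds by simp
  then have ne: "B @ A \<noteq> []" "length (B @ A) \<ge> 2" by (auto simp: vcycle_def)
  have e: "E v (hd (B @ A))" "E v (last (B @ A))" 
    using c ne sym[of "last (B @ A)" v] unfolding vcycle_def successively_Cons by (auto split: if_splits)
  have "distinct (B @ A)" using c by (auto simp: vcycle_def)
  then have "hd (B @ A) \<noteq> last (B @ A)" using ne by (cases "B @ A") auto
  moreover have "hd (B @ A) \<in> set ds" "last (B @ A) \<in> set ds" using ne hd_in_set[of "B @ A"] last_in_set[of "B @ A"] ds by auto
  ultimately show ?thesis using e by blast
qed

text \<open>
  The first vertex of the path that lies in \<open>S\<close> has at most its successor as a neighbour in \<open>S\<close>. Hence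
  a path contains no cycle.
\<close>

lemma ind_path_leaf:
  "ind_path Q \<Longrightarrow> S \<subseteq> set Q \<Longrightarrow> S \<noteq> {} \<Longrightarrow> \<exists>x\<in>S. \<forall>a\<in>S. \<forall>b\<in>S. E x a \<longrightarrow> E x b \<longrightarrow> a = b"
proof (induction Q)
  case (Cons q Q)
  show ?case
  proof (cases "q \<in> S")
    case True
    have "a = hd Q" if "a \<in> S" "E q a" for a
      using Cons.prems(1,2) that irr[of q] by auto
    then show ?thesis using True by blast
  next
    case False
    then show ?thesis using Cons by (auto simp: subset_insert)
  qed
qed simp

lemma ind_path_acyclic:
  assumes "ind_path Q" "vcycle ds" "set ds \<subseteq> set Q" shows False
proof -
  have "set ds \<noteq> {}" using assms(2) by (auto simp: vcycle_def)
  then obtain x where "x \<in> set ds" "\<forall>a\<in>set ds. \<forall>b\<in>set ds. E x a \<longrightarrow> E x b \<longrightarrow> a = b"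
    using ind_path_leaf[OF assms(1,3)] by blast
  then show False using vcycle_two_nb[OF assms(2)] by blast
qed

text \<open>
  All neighbours in \<open>D\<close> of the first vertex of a longest path in \<open>D\<close> lie on that path, and one of them is not
  the second vertex.
\<close>

lemma vcycle_exists:
  assumes "finite D" "D \<noteq> {}" "\<And>v. v \<in> D \<Longrightarrow> \<exists>a\<in>D. \<exists>b\<in>D. a \<noteq> b \<and> E v a \<and> E v b"
  shows "\<exists>cs. vcycle cs \<and> set cs \<subseteq> D"
proof -
  obtain v where "v \<in> D" using assms(2) by blast
  let ?Pr = "\<lambda>P. P \<noteq> [] \<and> distinct P \<and> successively E P \<and> set P \<subseteq> D"
  have b: "length P \<le> card D" if "?Pr P" for P
    using that assms(1) by (metis card_mono distinct_card)
  obtain P where P: "?Pr P" "\<And>Q. ?Pr Q \<Longrightarrow> length Q \<le> length P"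
    using ex_has_greatest_nat[of ?Pr "[v]" length "card D"] b \<open>v \<in> D\<close> by fastforce
  obtain x Q where xQ: "P = x # Q" using P(1) by (cases P) auto
  have inQ: "y \<in> set Q" if "y \<in> D" "E x y" for y
  proof (rule ccontr)
    assume "y \<notin> set Q"
    then have "?Pr (y # P)" using that P(1) irr sym[OF that(2)] by (auto simp: xQ successively_Cons)
    then show False using P(2)[of "y # P"] by simp
  qed
  have "x \<in> D" using P(1) xQ by simp
  then obtain a b where ab: "a \<in> D" "b \<in> D" "a \<noteq> b" "E x a" "E x b" using assms(3) by blast
  then obtain y where y: "y \<in> D" "E x y" "y \<noteq> hd Q" by metis
  then obtain Q1 Q2 where Q: "Q = Q1 @ y # Q2" using inQ split_list by fastforce
  then have "Q1 \<noteq> []" using y(3) by auto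
  have "distinct ((x # Q1 @ [y]) @ Q2)" "successively E ((x # Q1 @ [y]) @ Q2)" using P(1) xQ Q by auto
  then have "distinct (x # Q1 @ [y])" "successively E (x # Q1 @ [y])"
    unfolding successively_append_iff distinct_append by blast+
  moreover have "3 \<le> length (x # Q1 @ [y])" using \<open>Q1 \<noteq> []\<close> by (cases Q1) auto
  ultimately have "vcycle (x # Q1 @ [y])" using sym[OF y(2)] by (simp add: vcycle_def)
  then show ?thesis using P(1) by (intro exI[of _ "x # Q1 @ [y]"]) (auto simp: xQ Q)
qed

section \<open>Connected vertex sets\<close>

definition reach :: "'a set \<Rightarrow> 'a \<Rightarrow> 'a \<Rightarrow> bool" where
  "reach T = (\<lambda>u v. E u v \<and> u \<in> T \<and> v \<in> T)\<^sup>*\<^sup>*"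

definition conn_set :: "'a set \<Rightarrow> bool" where
  "conn_set T \<longleftrightarrow> (\<forall>x\<in>T. \<forall>y\<in>T. reach T x y)"

lemma reach_refl[simp]: "reach T x x" by (simp add: reach_def)

lemma reach_trans: "reach T x y \<Longrightarrow> reach T y z \<Longrightarrow> reach T x z"
  unfolding reach_def by (rule rtranclp_trans)

lemma reach_sym: "reach T x y \<Longrightarrow> reach T y x"
proof -
  have "symp ((\<lambda>u v. E u v \<and> u \<in> T \<and> v \<in> T)\<^sup>*\<^sup>*)"
    by (rule symp_rtranclp) (auto simp: symp_def intro: sym)
  then show "reach T x y \<Longrightarrow> reach T y x" by (auto simp: reach_def dest: sympD)
qed

lemma reach_step: "E x y \<Longrightarrow> x \<in> T \<Longrightarrow> y \<in> T \<Longrightarrow> reach T x y"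
  unfolding reach_def by (rule r_into_rtranclp) simp

lemma reach_mono: "reach T x y \<Longrightarrow> T \<subseteq> T' \<Longrightarrow> reach T' x y"
  unfolding reach_def by (erule rtranclp_mono[THEN predicate2D, rotated]) auto

lemma reach_in: "reach T x y \<Longrightarrow> x \<in> T \<Longrightarrow> y \<in> T"
  unfolding reach_def by (induction rule: rtranclp_induct) auto

lemma conn_set_rootI: "(\<And>x. x \<in> T \<Longrightarrow> reach T r x) \<Longrightarrow> conn_set T"
  unfolding conn_set_def using reach_sym reach_trans by blast

text \<open>
  By induction along the walk: an induced path to \<open>y\<close> is cut at its first neighbour of the next vertex
  \<open>z\<close> before \<open>z\<close> is appended.
\<close>

lemma reach_ind_path:
  assumes "reach T x y" "x \<in> T"
  shows "\<exists>P. ind_path P \<and> P \<noteq> [] \<and> set P \<subseteq> T \<and> hd P = x \<and> last P = y"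
  using assms(1) unfolding reach_def
proof (induction rule: rtranclp_induct)
  case base
  then show ?case using assms(2) by (intro exI[of _ "[x]"]) auto
next
  case (step y z)
  then obtain P where P: "ind_path P" "P \<noteq> []" "set P \<subseteq> T" "hd P = x" "last P = y" by blast
  show ?case
  proof (cases "z \<in> set P")
    case True
    then obtain P1 P2 where "P = P1 @ z # P2" by (meson split_list)
    then show ?thesis using P
      by (intro exI[of _ "P1 @ [z]"]) (auto simp: ind_path_append hd_append)
  next
    case False
    have "\<exists>p\<in>set P. E p z" using P(2,5) step(2) by auto
    then obtain P1 p P2 where s: "P = P1 @ p # P2" "E p z" "\<forall>q\<in>set P1. \<not> E q z"
      using split_list_first_prop[of P "\<lambda>p. E p z"] by blast
    then show ?thesis using P False step(2)
      by (intro exI[of _ "P1 @ [p, z]"]) (auto simp: ind_path_append hd_append)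
  qed
qed

lemma conn_set_ind_path:
  "conn_set T \<Longrightarrow> x \<in> T \<Longrightarrow> y \<in> T \<Longrightarrow> \<exists>P. ind_path P \<and> P \<noteq> [] \<and> set P \<subseteq> T \<and> hd P = x \<and> last P = y"
  using reach_ind_path unfolding conn_set_def by blast

lemma reach_closed:
  assumes "reach T v u" "v \<in> T"
  shows "reach {x. reach T v x} v u"
  using assms(1) unfolding reach_def[of T]
proof (induction rule: rtranclp_induct)
  case (step y z)
  then have "reach T v y" "reach T v z" by (auto simp: reach_def intro: rtranclp.rtrancl_into_rtrancl)
  then show ?case using step reach_trans reach_step[of y z "{x. reach T v x}"] unfolding reach_def[of T] by blast
qed simp

lemma conn_set_component: "v \<in> T \<Longrightarrow> conn_set {x. reach T v x}"
  using reach_closed by (intro conn_set_rootI[of _ v]) auto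

lemma reach_along_ind_path: "ind_path P \<Longrightarrow> P \<noteq> [] \<Longrightarrow> x \<in> set P \<Longrightarrow> reach (set P) (hd P) x"
proof (induction P)
  case (Cons a P)
  show ?case
  proof (cases "x = a")
    case False
    then have x: "x \<in> set P" "P \<noteq> []" using Cons.prems by auto
    then have "reach (set P) (hd P) x" using Cons by simp
    then have "reach (set (a # P)) (hd P) x" by (rule reach_mono) auto
    moreover have "reach (set (a # P)) a (hd P)" using Cons.prems x by (intro reach_step) auto
    ultimately show ?thesis using reach_trans by simp
  qed simp
qed simp

lemma conn_set_ind_path_set: "ind_path P \<Longrightarrow> conn_set (set P)"
  using reach_along_ind_path[of P] by (cases "P = []") (auto simp: conn_set_def[of "{}"] intro!: conn_set_rootI[of "set P" "hd P"])

lemma isolated_reach: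
  assumes "reach T u z" "\<And>w. w \<in> T \<Longrightarrow> \<not> E u w"
  shows "z = u"
  using assms(1) unfolding reach_def by (rule converse_rtranclpE) (use assms(2) in blast)+

lemma conn_set_attach:
  assumes "conn_set D" "D \<noteq> {}" "\<And>n. n \<in> A \<Longrightarrow> \<exists>v\<in>D. E n v"
  shows "conn_set (D \<union> A)"
proof -
  obtain r where r: "r \<in> D" using assms(2) by blast
  have 1: "reach (D \<union> A) r x" if "x \<in> D" for x
    using assms(1) r that reach_mono[of D r x "D \<union> A"] unfolding conn_set_def by blast
  have 2: "reach (D \<union> A) r x" if x: "x \<in> A" for x
  proof -
    obtain v where v: "v \<in> D" "E x v" using assms(3)[OF x] by blast
    show ?thesis by (rule reach_trans[OF 1[OF v(1)] reach_step[OF sym[OF v(2)]]]) (use v x in auto)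
  qed
  show ?thesis using 1 2 by (intro conn_set_rootI[of _ r]) blast
qed

definition joins :: "'a set \<Rightarrow> 'a list \<Rightarrow> 'a \<Rightarrow> 'a \<Rightarrow> bool" where
  "joins T P a b \<longleftrightarrow> ind_path P \<and> P \<noteq> [] \<and> set P \<subseteq> T \<and> hd P = a \<and> last P = b"

lemma joins_rev: "joins T P a b \<Longrightarrow> joins T (rev P) b a"
  by (auto simp: joins_def ind_path_rev hd_rev last_rev)

lemma joins_split: "joins T (P1 @ x # P2) a b \<Longrightarrow> joins T (P1 @ [x]) a x \<and> joins T (x # P2) x b"
  using ind_path_snoc_split[of P1 x P2] by (auto simp: joins_def hd_append)

lemma joins_append: "joins T P a b \<Longrightarrow> joins T Q c d \<Longrightarrow> ind_path (P @ Q) \<Longrightarrow> joins T (P @ Q) a d"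
  unfolding joins_def by simp

lemma joinsD: "joins T P a b \<Longrightarrow> ind_path P \<and> P \<noteq> [] \<and> set P \<subseteq> T \<and> hd P = a \<and> last P = b"
  by (simp add: joins_def)

lemma joins_mem: "joins T P a b \<Longrightarrow> x \<in> set P \<Longrightarrow> \<exists>P1 P2. P = P1 @ x # P2 \<and> joins T (P1 @ [x]) a x \<and> joins T (x # P2) x b
   \<and> x \<notin> set P1 \<and> x \<notin> set P2 \<and> (b \<in> set P1 \<longrightarrow> b = x) \<and> (a \<in> set P2 \<longrightarrow> a = x)"
proof -
  assume j: "joins T P a b" and x: "x \<in> set P"
  obtain P1 P2 where P: "P = P1 @ x # P2" using split_list[OF x] by blast
  have "distinct P" using j ind_path_distinct by (auto simp: joins_def)
  then have d: "x \<notin> set P1" "x \<notin> set P2" "set P1 \<inter> set P2 = {}" by (auto simp: P)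
  have ab: "hd (P1 @ x # P2) = a" "last (P1 @ x # P2) = b" using j P by (auto simp: joins_def)
  have "a \<in> set P2 \<longrightarrow> a = x" using d ab by (cases P1) auto
  moreover have "b \<in> set P1 \<longrightarrow> b = x" using d ab by (cases P2 rule: rev_cases) auto
  ultimately have "x \<notin> set P1" "x \<notin> set P2" "(b \<in> set P1 \<longrightarrow> b = x)" "(a \<in> set P2 \<longrightarrow> a = x)"
    using d by blast+
  then show ?thesis using joins_split[of T P1 x P2 a b] j P by blast
qed

lemma conn_set_joins: "conn_set T \<Longrightarrow> a \<in> T \<Longrightarrow> b \<in> T \<Longrightarrow> \<exists>P. joins T P a b"
  using conn_set_ind_path unfolding joins_def by blast

section \<open>Shortest cycles and ears\<close>

definition shortest_cycle :: "'a set \<Rightarrow> 'a list \<Rightarrow> bool" where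
  "shortest_cycle W cs \<longleftrightarrow> vcycle cs \<and> set cs \<subseteq> W \<and> (\<forall>ds. vcycle ds \<longrightarrow> set ds \<subseteq> W \<longrightarrow> length cs \<le> length ds)"

lemma shortest_cycle_le: "shortest_cycle W cs \<Longrightarrow> vcycle ds \<Longrightarrow> set ds \<subseteq> W \<Longrightarrow> length cs \<le> length ds"
  by (simp add: shortest_cycle_def)

lemma shortest_cycle_same_length:
  "shortest_cycle W cs \<Longrightarrow> vcycle ds \<Longrightarrow> set ds \<subseteq> W \<Longrightarrow> length ds = length cs \<Longrightarrow> shortest_cycle W ds"
  by (simp add: shortest_cycle_def)

lemma shortest_cycle_mono: "shortest_cycle W cs \<Longrightarrow> set cs \<subseteq> W' \<Longrightarrow> W' \<subseteq> W \<Longrightarrow> shortest_cycle W' cs"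
  by (auto simp: shortest_cycle_def)

lemma shortest_cycle_swap: "shortest_cycle W (P @ Q) \<Longrightarrow> shortest_cycle W (Q @ P)"
  using vcycle_swap[of P Q] by (auto simp: shortest_cycle_def add.commute)

lemma shortest_cycle_rot: "shortest_cycle W (c # X @ d # Y) \<Longrightarrow> shortest_cycle W (d # Y @ c # X)"
  using shortest_cycle_swap[of W "c # X" "d # Y"] by simp

lemma shortest_cycle_exists:
  assumes "vcycle ds" "set ds \<subseteq> W"
  shows "\<exists>cs. shortest_cycle W cs"
  using ex_has_least_nat[of "\<lambda>cs. vcycle cs \<and> set cs \<subseteq> W" ds length] assms unfolding shortest_cycle_def by blast

lemma shortest_cycle_split:
  assumes "shortest_cycle W cs" "c \<in> set cs" "d \<in> set cs" "c \<noteq> d"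
  obtains X Y where "shortest_cycle W (c # X @ d # Y)" "set (c # X @ d # Y) = set cs"
    "length (c # X @ d # Y) = length cs"
proof -
  obtain A B where cs: "cs = A @ c # B" using split_list[OF assms(2)] by blast
  have s: "shortest_cycle W (c # B @ A)" using shortest_cycle_swap[of W A "c # B"] assms(1) cs by simp
  have "d \<in> set (B @ A)" using assms(3,4) cs by auto
  then obtain X Y where "B @ A = X @ d # Y" using split_list by fastforce
  moreover from this have "set B \<union> set A = set (X @ d # Y)" "length B + length A = length (X @ d # Y)"
    by (metis set_append, metis length_append)
  ultimately show ?thesis using s cs by (intro that[of X Y]) auto
qed

text \<open>
  A single vertex adjacent to both \<open>c\<close> and \<open>d\<close> is not an ear; around a shortest cycle there are no such
  vertices.
\<close>

definition ear :: "'a list \<Rightarrow> 'a list \<Rightarrow> 'a \<Rightarrow> 'a \<Rightarrow> bool" where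
  "ear cs P c d \<longleftrightarrow> ind_path P \<and> 2 \<le> length P \<and> set P \<inter> set cs = {} \<and>
     (\<forall>p\<in>set P. \<forall>y\<in>set cs. E p y \<longleftrightarrow> p = hd P \<and> y = c \<or> p = last P \<and> y = d)"

lemma ear_rev: "ear cs P c d \<Longrightarrow> ear cs (rev P) d c"
  unfolding ear_def by (auto simp: ind_path_rev hd_rev last_rev)

lemma ear_cong: "ear cs P c d \<Longrightarrow> set cs = set ds \<Longrightarrow> ear ds P c d"
  unfolding ear_def by simp

lemma ear_hole:
  assumes "ind_cycle (c # X @ d # Y)" "Y \<noteq> []" "ear (c # X @ d # Y) P c d"
  shows "ind_cycle (c # X @ d # rev P)"
proof -
  have P: "P \<noteq> []" using assms(3) by (auto simp: ear_def)
  have a: "ind_path (c # X @ [d])" "c \<noteq> d"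
    using assms(1,2) ind_cycle_append[of "c # X @ [d]" Y] by auto
  have "ind_cycle ((c # X @ [d]) @ rev P)"
  proof (rule ind_cycle_appendI)
    show "ind_path (rev P)" "4 \<le> length (c # X @ [d]) + length (rev P)" "set (c # X @ [d]) \<inter> set (rev P) = {}"
      using assms(3) by (auto simp: ear_def ind_path_rev)
    show "E x y \<longleftrightarrow> x = last (c # X @ [d]) \<and> y = hd (rev P) \<or> x = hd (c # X @ [d]) \<and> y = last (rev P)"
      if "x \<in> set (c # X @ [d])" "y \<in> set (rev P)" for x y
    proof -
      have "E y x \<longleftrightarrow> y = hd P \<and> x = c \<or> y = last P \<and> x = d" using assms(3) that unfolding ear_def by auto
      then show ?thesis using symE[of x y] P by (simp add: hd_rev last_rev) blast
    qed
  qed (use P a in auto)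
  then show ?thesis by simp
qed

end

locale girth8 = sgraph +
  assumes girth: "vcycle cs \<Longrightarrow> 8 \<le> length cs"
    and ehole: "ind_cycle cs \<Longrightarrow> even (length cs) \<Longrightarrow> length cs < 10"
begin

lemma no_triangle: "E a b \<Longrightarrow> E b c \<Longrightarrow> E c a \<Longrightarrow> False"
  using girth[of "[a,b,c]"] irr by (auto simp: vcycle_def)

lemma even_hole_length_8:
  assumes "ind_cycle cs" "even (length cs)" shows "length cs = 8"
proof -
  have "8 \<le> length cs" "length cs < 10" using assms ehole girth[OF ind_cycle_vcycle] by auto
  moreover have "length cs \<noteq> 9" using assms(2) by auto
  ultimately show ?thesis by linarith
qed

text \<open>
A chord would cut off a shorter cycle.
\<close>

lemma shortest_cycle_induced:
  assumes "shortest_cycle W cs" shows "ind_cycle cs"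
proof -
  have ch: "X = [] \<or> Y = []" if "shortest_cycle W (c # X @ d # Y)" "E c d" for c X d Y
  proof (rule ccontr)
    assume n: "\<not> (X = [] \<or> Y = [])"
    then have "vcycle (c # X @ [d])" using vcycle_chord that by (auto simp: shortest_cycle_def)
    moreover have "set (c # X @ [d]) \<subseteq> W" using that(1) by (auto simp: shortest_cycle_def)
    ultimately have "length (c # X @ d # Y) \<le> length (c # X @ [d])" using that(1) shortest_cycle_le by blast
    then show False using n by auto
  qed
  have c: "vcycle cs" "8 \<le> length cs" using assms girth by (auto simp: shortest_cycle_def)
  then obtain x Q where cs: "cs = x # Q" by (cases cs) auto
  have Q: "distinct Q" "successively E Q" "x \<notin> set Q" "Q \<noteq> []" "E x (hd Q)" "E x (last Q)"
    using c sym[of "last Q" x] by (auto simp: cs vcycle_def successively_Cons split: if_splits)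
  have "ind_path Q"
  proof (rule ind_path_if_chordless[OF Q(1,2)], intro allI impI)
    fix P1 a P2 b P3
    assume "Q = P1 @ a # P2 @ b # P3" "E a b"
    then show "P2 = []" using ch[of a P2 b "P3 @ x # P1"] shortest_cycle_swap[of W "x # P1" "a # P2 @ b # P3"] assms
      by (simp add: cs)
  qed
  moreover have "E x y \<longleftrightarrow> y = hd Q \<or> y = last Q" if y: "y \<in> set Q" for y
  proof
    assume "E x y"
    moreover obtain P2 P3 where "Q = P2 @ y # P3" using split_list[OF y] by blast
    ultimately show "y = hd Q \<or> y = last Q" using ch[of x P2 y P3] assms cs by auto
  qed (use Q in auto)
  ultimately show ?thesis using c Q cs by (simp add: ind_cycle_def)
qed

lemma shortest_cycle_length:
  assumes "shortest_cycle W cs" shows "8 \<le> length cs" "even (length cs) \<Longrightarrow> length cs = 8"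
  using shortest_cycle_induced[OF assms] even_hole_length_8 girth[OF ind_cycle_vcycle] by auto

text \<open>
  Two neighbours of \<open>v\<close> on a cycle of length \<open>g\<close> give two cycles through \<open>v\<close> of total length \<open>g + 4\<close>, and
  \<open>g + 4 < 2 * g\<close>.
\<close>

lemma shortest_cycle_unique_nb:
  assumes "shortest_cycle W cs" "v \<in> W" "v \<notin> set cs" "c \<in> set cs" "d \<in> set cs" "E v c" "E v d"
  shows "c = d"
proof (rule ccontr)
  assume "c \<noteq> d"
  then obtain X Y where s: "shortest_cycle W (c # X @ d # Y)" "set (c # X @ d # Y) = set cs"
    "length (c # X @ d # Y) = length cs" using shortest_cycle_split assms by metis
  have len: "length Y \<le> 1" if "shortest_cycle W (c # X @ d # Y)" "set (c # X @ d # Y) = set cs" "E v c" "E v d" for c X d Y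
  proof -
    have "v \<notin> set (c # X @ d # Y)" using assms(3) that by blast
    then have "vcycle (v # (c # X @ [d]))"
      using vcycle_Cons[OF vcycle_arc[of c X d Y], of v] that(1,3) sym[OF that(4)] unfolding shortest_cycle_def by simp
    moreover have "set (v # c # X @ [d]) \<subseteq> W" using that assms(2) by (auto simp: shortest_cycle_def)
    ultimately have "length (c # X @ d # Y) \<le> length (v # c # X @ [d])" using that(1) unfolding shortest_cycle_def by blast
    then show ?thesis by simp
  qed
  have "length Y \<le> 1" using len s assms by blast
  moreover have "length X \<le> 1" using len[OF shortest_cycle_rot[OF s(1)]] s assms by auto
  ultimately show False using shortest_cycle_length(1)[OF s(1)] by simp
qed

text \<open>
  An edge \<open>u v\<close> gives two cycles of total length \<open>g + 6\<close> if the neighbours on the cycle differ, and a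
  triangle if they coincide.
\<close>

lemma shortest_cycle_nb_stable:
  assumes "shortest_cycle W cs" "u \<in> W" "u \<notin> set cs" "v \<in> W" "v \<notin> set cs" "c \<in> set cs" "d \<in> set cs" "E u c" "E v d"
  shows "\<not> E u v"
proof
  assume uv: "E u v"
  show False
  proof (cases "c = d")
    case True
    then show ?thesis using no_triangle[of u v c] uv assms sym by blast
  next
    case False
    then obtain X Y where s: "shortest_cycle W (c # X @ d # Y)" "set (c # X @ d # Y) = set cs"
      "length (c # X @ d # Y) = length cs" using shortest_cycle_split assms by metis
    have len: "length Y \<le> 2" if "shortest_cycle W (c # X @ d # Y)" "set (c # X @ d # Y) = set cs" 
      "u \<in> W" "u \<notin> set cs" "v \<in> W" "v \<notin> set cs" "E u c" "E v d" "E u v" for c X d Y u v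
    proof -
      have "u \<notin> set (c # X @ d # Y)" "v \<notin> set (c # X @ d # Y)" "u \<noteq> v" using that irr by blast+
      moreover have "distinct ((c # X @ [d]) @ [v])" "successively E ((c # X @ [d]) @ [v])"
        using vcycle_arc[of c X d Y] that(1) sym[OF that(8)] \<open>v \<notin> set (c # X @ d # Y)\<close>
        unfolding shortest_cycle_def successively_append_iff by (simp_all, metis)
      ultimately have "vcycle (u # ((c # X @ [d]) @ [v]))"
        using that sym[OF that(9)] by (intro vcycle_Cons) auto
      then have "vcycle (u # c # X @ [d, v])" by simp
      moreover have "set (u # c # X @ [d, v]) \<subseteq> W" using that by (auto simp: shortest_cycle_def)
      ultimately have "length (c # X @ d # Y) \<le> length (u # c # X @ [d, v])" using that(1) unfolding shortest_cycle_def by blast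
      then show ?thesis by simp
    qed
    have "length Y \<le> 2" using len s assms uv by blast
    moreover have "length X \<le> 2" using len[OF shortest_cycle_rot[OF s(1)]] s assms sym[OF uv] by auto
    ultimately show False using shortest_cycle_length(1)[OF s(1)] by simp
  qed
qed

lemma shortest_cycle_nonadj:
  assumes "shortest_cycle W (c # X @ d # Y)" "X \<noteq> []" "Y \<noteq> []" shows "\<not> E c d"
proof -
  have ic: "ind_cycle (c # X @ d # Y)" and dc: "distinct (c # X @ d # Y)"
    using shortest_cycle_induced[OF assms(1)] assms(1) by (auto simp: shortest_cycle_def vcycle_def)
  have "E c d \<longleftrightarrow> d = hd (X @ d # Y) \<or> d = last (c # X @ d # Y)" using ic unfolding ind_cycle_def by simp
  moreover have "d \<noteq> hd (X @ d # Y)" "d \<noteq> last (c # X @ d # Y)" using dc assms(2,3) by auto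
  ultimately show ?thesis by blast
qed

text \<open>
  The two arcs have the same parity. If the ear has it too, it closes up to an even cycle with either
  arc; this cycle is induced if the other arc has an inner vertex, and then it has length \<open>8\<close>.
\<close>

lemma ear_parity:
  assumes "shortest_cycle W (c # X @ d # Y)" "length X + length Y = 6" "ear (c # X @ d # Y) P c d"
    "even (length P + length X)"
  shows "(X = [] \<or> Y = []) \<and> length P = 6 \<or> length X = 3 \<and> length Y = 3 \<and> length P = 3"
proof -
  have ic: "ind_cycle (c # X @ d # Y)" using shortest_cycle_induced assms by blast
  have 1: "length P + length X = 6" if "Y \<noteq> []"
    using even_hole_length_8[OF ear_hole[OF ic that assms(3)]] assms(4) by simp
  have 2: "length P + length Y = 6" if "X \<noteq> []"
  proof -
    have "ear (d # Y @ c # X) (rev P) d c" using ear_rev[OF assms(3)] by (rule ear_cong) auto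
    then have "ind_cycle (d # Y @ c # rev (rev P))"
      using ear_hole[of d Y c X "rev P"] shortest_cycle_induced[OF shortest_cycle_rot[OF assms(1)]] that by blast
    moreover have "even (length P + length Y)" using assms(2,4) by presburger
    ultimately show ?thesis using even_hole_length_8[of "d # Y @ c # rev (rev P)"] by simp
  qed
  show ?thesis
  proof (cases "X = [] \<or> Y = []")
    case True
    then have "length P = 6" using 1 2 assms(2) by (cases "X = []"; cases "Y = []") auto
    then show ?thesis using True by blast
  next
    case False
    then have "length X = 3 \<and> length Y = 3 \<and> length P = 3" using 1 2 assms(2) by simp
    then show ?thesis by blast
  qed
qed

text \<open>
  One of the two cycles through the ear is even. As it is not shorter than a shortest cycle, which has
  odd length at least \<open>9\<close>, it is too long.
\<close>

lemma ear_odd: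
  assumes "shortest_cycle W (c # X @ d # Y)" "odd (length X + length Y)" "ear (c # X @ d # Y) P c d"
    "set P \<subseteq> W" "X \<noteq> []" "Y \<noteq> []"
  shows False
proof -
  have ic: "ind_cycle (c # X @ d # Y)" using shortest_cycle_induced assms by blast
  have W: "set (c # X @ d # Y) \<subseteq> W" using assms by (simp add: shortest_cycle_def)
  have "ear (d # Y @ c # X) (rev P) d c" using ear_rev[OF assms(3)] by (rule ear_cong) auto
  then have 2: "ind_cycle (d # Y @ c # P)"
    using ear_hole[of d Y c X "rev P"] shortest_cycle_induced[OF shortest_cycle_rot[OF assms(1)]] assms by simp
  have 1: "ind_cycle (c # X @ d # rev P)" using ear_hole[OF ic] assms by blast
  have l: "length (c # X @ d # Y) \<noteq> 8"
  proof
    assume "length (c # X @ d # Y) = 8"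
    then have "length X + length Y = 6" by simp
    then have "odd (6::nat)" using assms(2) by metis
    then show False by simp
  qed
  have "8 \<le> length (c # X @ d # Y)" using shortest_cycle_length[OF assms(1)] by blast
  moreover have "length (c # X @ d # Y) \<le> length (c # X @ d # rev P)"
    using shortest_cycle_le[OF assms(1) ind_cycle_vcycle[OF 1]] W assms(4) by auto
  moreover have "length (c # X @ d # Y) \<le> length (d # Y @ c # P)"
    using shortest_cycle_le[OF assms(1) ind_cycle_vcycle[OF 2]] W assms(4) by auto
  ultimately have "odd (length (c # X @ d # rev P))" "odd (length (d # Y @ c # P))"
    using even_hole_length_8[OF 1] even_hole_length_8[OF 2] l by fastforce+
  then show False using assms(2) by (simp; presburger)
qed

text \<open>
  An ear with as many vertices as one of its arcs replaces that arc. This is how the exceptional ears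
  lead to new shortest cycles.
\<close>

lemma shortest_cycle_replace_arc:
  assumes "shortest_cycle W (c0 # X @ c4 # Y)" "ear (c0 # X @ c4 # Y) P c0 c4" "length P = length X" "set P \<subseteq> W"
  shows "shortest_cycle W (c0 # P @ c4 # Y)"
proof -
  have PC: "ind_path P" "P \<noteq> []" "set P \<inter> set (c0 # X @ c4 # Y) = {}" using assms(2) unfolding ear_def by auto
  have e: "E (hd P) c0" "E (last P) c4" using assms(2) PC(2) unfolding ear_def by auto
  have sC: "successively E ((c4 # Y) @ c0 # X)" "distinct ((c4 # Y) @ c0 # X)"
    using shortest_cycle_swap[of W "c0 # X" "c4 # Y"] assms(1) unfolding shortest_cycle_def vcycle_def by auto
  have "vcycle ((c4 # Y) @ (c0 # P))"
    unfolding vcycle_def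
  proof (intro conjI)
    show "distinct ((c4 # Y) @ c0 # P)" using sC PC ind_path_distinct by auto
    show "successively E ((c4 # Y) @ c0 # P)"
      using sC(1) ind_path_successively[OF PC(1)] sym[OF e(1)] unfolding successively_append_iff successively_Cons by auto
  qed (use e PC in \<open>auto simp: Suc_le_eq\<close>)
  from vcycle_swap[OF this] have "vcycle (c0 # P @ c4 # Y)" by simp
  moreover have "set (c0 # P @ c4 # Y) \<subseteq> W" using assms(1,4) by (auto simp: shortest_cycle_def)
  ultimately show ?thesis using shortest_cycle_same_length[OF assms(1)] assms(3) by simp
qed

section \<open>Three attachments of a connected set\<close>

text \<open>
  If an induced path \<open>P\<close> from \<open>b\<close> to \<open>c\<close> passes through \<open>a\<close>, cut it there. Otherwise let \<open>U\<close> be an induced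
  path from \<open>a\<close> whose last vertex \<open>r\<close> is its only vertex with neighbours on \<open>P\<close>, and let \<open>p\<close> and \<open>q\<close> be the
  first and the last of these. The paths from \<open>a\<close> follow \<open>U\<close> and then \<open>P\<close> in either direction. If
  \<open>p = q\<close>, the third path is \<open>P\<close>; if not, it takes the shortcut from \<open>p\<close> over \<open>r\<close> to \<open>q\<close>, which is
  induced because there are no triangles. In all cases every vertex is on two of the paths or on none,
  apart from one vertex that is on all three: \<open>a\<close>, \<open>p\<close> and \<open>r\<close>, respectively.
\<close>

lemma three_paths_odd:
  assumes "conn_set T" "a \<in> T" "b \<in> T" "c \<in> T"
  shows "\<exists>P Q R. joins T P a b \<and> joins T Q b c \<and> joins T R c a \<and> odd (length P + length Q + length R)"
proof -
  obtain P where P: "joins T P b c" using conn_set_joins assms by blast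
  show ?thesis
  proof (cases "a \<in> set P")
    case True
    then obtain P1 P2 where s: "P = P1 @ a # P2" by (meson split_list)
    then have "joins T (rev (P1 @ [a])) a b" "joins T (rev (a # P2)) c a"
      using joins_split[of T P1 a P2 b c] joins_rev P by blast+
    moreover have "odd (length (rev (P1 @ [a])) + length P + length (rev (a # P2)))" by (simp add: s) argo
    ultimately show ?thesis using P by blast
  next
    case False
    obtain R where R: "joins T R a b" using conn_set_joins assms by blast
    have "b \<in> set R" "b \<in> set P" using R P last_in_set[of R] hd_in_set[of P] unfolding joins_def by metis+
    then have "\<exists>r\<in>set R. r \<in> set P" by blast
    then obtain R1 z R2 where z: "R = R1 @ z # R2" "z \<in> set P" "\<forall>r\<in>set R1. r \<notin> set P"
      using split_list_first_prop[of R "\<lambda>r. r \<in> set P"] by blast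
    have "R1 \<noteq> []" using z False R by (auto simp: joins_def)
    have "ind_path R" using R by (simp add: joins_def)
    then have "E (last R1) z" using \<open>R1 \<noteq> []\<close> z(1) by (simp add: ind_path_append)
    then have "\<exists>r\<in>set R1. \<exists>p\<in>set P. E r p" using z(2) \<open>R1 \<noteq> []\<close> by auto
    then obtain S r S' where r: "R1 = S @ r # S'" "\<exists>p\<in>set P. E r p" "\<forall>s\<in>set S. \<not> (\<exists>p\<in>set P. E s p)"
      using split_list_first_prop[of R1 "\<lambda>r. \<exists>p\<in>set P. E r p"] by blast
    define U where "U = S @ [r]"
    have R': "R = S @ r # (S' @ z # R2)" using z(1) r(1) by simp
    have "joins T R a b" by fact
    then have U: "joins T U a r" using joins_split[of T S r "S' @ z # R2" a b] R' unfolding U_def by simp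
    have Udis: "set U \<inter> set P = {}" using z(3) r(1) U_def by auto
    have UP: "E u p \<longleftrightarrow> u = r \<and> E r p" if "u \<in> set U" "p \<in> set P" for u p
      using that r(3) U_def by auto
    obtain P1 p M where p: "P = P1 @ p # M" "E r p" "\<forall>q\<in>set P1. \<not> E r q"
      using split_list_first_prop[of P "E r"] r(2) by blast
    have ip: "ind_path P" using P by (simp add: joins_def)
    have 1: "joins T (P1 @ [p]) b p" using joins_split P p(1) by blast
    have lU: "last U = r" "U \<noteq> []" by (simp_all add: U_def)
    have pP: "set (P1 @ [p]) \<subseteq> set P" using p(1) by auto
    have "ind_path (U @ rev (P1 @ [p]))"
      unfolding ind_path_append[of U]
    proof (intro conjI ballI)
      show "ind_path U" "ind_path (rev (P1 @ [p]))" using joinsD[OF U] joinsD[OF 1] ind_path_rev by blast+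
      show "set U \<inter> set (rev (P1 @ [p])) = {}" using Udis pP by auto
      show "E x y \<longleftrightarrow> x = last U \<and> y = hd (rev (P1 @ [p]))" if "x \<in> set U" "y \<in> set (rev (P1 @ [p]))" for x y
        using UP[of x y] that pP p lU by auto
    qed
    then have A: "joins T (U @ rev (P1 @ [p])) a b"
      using joins_append[OF U joins_rev[OF 1]] by simp
    have C: "joins T (rev (U @ q # P2)) c a"
      if q: "joins T (q # P2) q c" "set (q # P2) \<subseteq> set P" "E r q" "\<forall>x\<in>set P2. \<not> E r x" for q P2
    proof -
      have "ind_path (U @ q # P2)"
        unfolding ind_path_append[of U]
      proof (intro conjI ballI)
        show "ind_path U" "ind_path (q # P2)" using joinsD[OF U] joinsD[OF q(1)] by blast+
        show "set U \<inter> set (q # P2) = {}" using Udis q(2) by auto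
        show "E x y \<longleftrightarrow> x = last U \<and> y = hd (q # P2)" if "x \<in> set U" "y \<in> set (q # P2)" for x y
          using UP[of x y] that q lU by auto
      qed
      then have "joins T (U @ q # P2) a c" using joins_append[OF U q(1)] by simp
      then show ?thesis by (rule joins_rev)
    qed
    show ?thesis
    proof (cases "\<exists>x\<in>set M. E r x")
      case False
      then have "joins T (rev (U @ p # M)) c a" using joins_split[of T P1 p M b c] P p by (intro C) auto
      moreover have "odd (length (U @ rev (P1 @ [p])) + length P + length (rev (U @ p # M)))" by (simp add: p(1)) argo
      ultimately show ?thesis using A P by blast
    next
      case True
      then obtain N q P2 where q: "M = N @ q # P2" "E r q" "\<forall>x\<in>set P2. \<not> E r x"
        using split_list_last_prop[of M "E r"] by blast
      have 2: "joins T (q # P2) q c" using joins_split[of T "P1 @ p # N" q P2 b c] P p(1) q(1) by simp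
      have C': "joins T (rev (U @ q # P2)) c a" using 2 p(1) q by (intro C) auto
      have nE: "\<not> E p q" using no_triangle[of r p q] p q sym by blast
      have ip': "ind_path ((P1 @ [p]) @ N @ q # P2)" using ip p(1) q(1) by simp
      have no: "\<not> E x y" if "x \<in> set (P1 @ [p])" "y \<in> set (q # P2)" for x y
      proof
        assume "E x y"
        then have xy: "x = p" "y = hd (N @ q # P2)" using ip' that unfolding ind_path_append[of "P1 @ [p]"] by auto
        show False
        proof (cases "N = []")
          case True
          then show ?thesis using xy nE \<open>E x y\<close> by simp
        next
          case False
          then have "y \<in> set N" using xy by simp
          then show False using ip' that(2) unfolding ind_path_append[of "P1 @ [p]"] ind_path_append[of N] by auto
        qed
      qed
      have dis: "set (P1 @ [p]) \<inter> set (q # P2) = {}" "ind_path (q # P2)" "ind_path (P1 @ [p])"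
        using ip' unfolding ind_path_append[of "P1 @ [p]"] ind_path_append[of N] by auto
      have rP: "r \<notin> set P" using Udis by (auto simp: U_def)
      have "ind_path (r # q # P2)" using dis rP p(1) q by auto
      then have "ind_path ((P1 @ [p]) @ r # q # P2)"
        unfolding ind_path_append[of "P1 @ [p]"] using dis(1,3) no rP p q sym
        by (intro conjI ballI) (auto dest: sym)
      moreover have "r \<in> T" using joinsD[OF U] by (auto simp: U_def)
      ultimately have "joins T ((P1 @ [p]) @ r # q # P2) b c" using joinsD[OF 1] joinsD[OF 2] 
        unfolding joins_def by (cases P1) auto
      moreover have "odd (length (U @ rev (P1 @ [p])) + length ((P1 @ [p]) @ r # q # P2) + length (rev (U @ q # P2)))" by simp argo
      ultimately show ?thesis using A C' by blast
    qed
  qed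
qed

text \<open>
  The two kinds of ears whose parity is not forced, for an arc of a cycle of length \<open>8\<close> with the list \<open>X\<close>
  of inner vertices: six vertices between adjacent vertices of the cycle, and three vertices between
  opposite ones.
\<close>

definition exceptional :: "'a list \<Rightarrow> 'a list \<Rightarrow> bool" where
  "exceptional P X \<longleftrightarrow> X = [] \<and> length P = 6 \<or> length X = 3 \<and> length P = 3"

text \<open>
  The set \<open>T\<close> is attached to the cycle by exactly three of its vertices; \<open>X\<close>, \<open>Y\<close> and \<open>Z\<close> are the arcs
  between the three feet.
\<close>

definition tripod :: "'a set \<Rightarrow> 'a list \<Rightarrow> 'a \<Rightarrow> 'a list \<Rightarrow> 'a \<Rightarrow> 'a list \<Rightarrow> 'a \<Rightarrow> 'a list \<Rightarrow> 'a set \<Rightarrow> 'a \<Rightarrow> 'a \<Rightarrow> 'a \<Rightarrow> bool" where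
  "tripod W cs c1 X c2 Y c3 Z T n1 n2 n3 \<longleftrightarrow> cs = c1 # X @ c2 # Y @ c3 # Z \<and> shortest_cycle W cs \<and>
    T \<subseteq> W \<and> T \<inter> set cs = {} \<and> n1 \<in> T \<and> n2 \<in> T \<and> n3 \<in> T \<and> E n1 c1 \<and> E n2 c2 \<and> E n3 c3 \<and>
    (\<forall>t\<in>T. \<forall>y\<in>set cs. E t y \<longrightarrow> t = n1 \<or> t = n2 \<or> t = n3)"

lemma tripod_rot: "tripod W cs c1 X c2 Y c3 Z T n1 n2 n3 \<Longrightarrow> \<exists>ds. length ds = length cs \<and> tripod W ds c2 Y c3 Z c1 X T n2 n3 n1"
  using shortest_cycle_swap[of W "c1 # X" "c2 # Y @ c3 # Z"] unfolding tripod_def by (intro exI[of _ "c2 # Y @ c3 # Z @ c1 # X"]) auto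

lemma tripod_edge:
  assumes "tripod W cs c1 X c2 Y c3 Z T n1 n2 n3" "t \<in> T" "y \<in> set cs"
  shows "E t y \<longleftrightarrow> t = n1 \<and> y = c1 \<or> t = n2 \<and> y = c2 \<or> t = n3 \<and> y = c3"
proof -
  have u: "x = y" if "v \<in> T" "x \<in> set cs" "y \<in> set cs" "E v x" "E v y" for v x y
    using shortest_cycle_unique_nb[of W cs v x y] assms(1) that unfolding tripod_def by blast
  have "c1 \<in> set cs" "c2 \<in> set cs" "c3 \<in> set cs" using assms(1) unfolding tripod_def by auto
  then show ?thesis using u assms unfolding tripod_def by metis
qed

lemma tripod_distinct:
  assumes "tripod W cs c1 X c2 Y c3 Z T n1 n2 n3"
  shows "n1 \<noteq> n2" "n2 \<noteq> n3" "n3 \<noteq> n1" "c1 \<noteq> c2" "c2 \<noteq> c3" "c3 \<noteq> c1"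
proof -
  have "distinct cs" using assms by (auto simp: tripod_def shortest_cycle_def vcycle_def)
  then have c: "c1 \<noteq> c2" "c2 \<noteq> c3" "c3 \<noteq> c1" using assms by (auto simp: tripod_def)
  then show "c1 \<noteq> c2" "c2 \<noteq> c3" "c3 \<noteq> c1" .
  have m: "c1 \<in> set cs" "c2 \<in> set cs" "c3 \<in> set cs" using assms unfolding tripod_def by auto
  have T: "n1 \<in> T" "n2 \<in> T" "n3 \<in> T" "E n1 c1" "E n2 c2" "E n3 c3" using assms by (auto simp: tripod_def)
  have u: "x = y" if "v \<in> T" "x \<in> set cs" "y \<in> set cs" "E v x" "E v y" for v x y
    using shortest_cycle_unique_nb[of W cs v x y] assms(1) that unfolding tripod_def by blast
  show "n1 \<noteq> n2" "n2 \<noteq> n3" "n3 \<noteq> n1" using u[of n1 c1 c2] u[of n2 c2 c3] u[of n3 c3 c1] T c m by metis+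
qed

lemma tripod_ear:
  assumes "tripod W cs c1 X c2 Y c3 Z T n1 n2 n3" "joins T P n1 n2" "n3 \<notin> set P"
  shows "ear cs P c1 c2"
proof -
  have d: "n1 \<noteq> n2" using tripod_distinct[OF assms(1)] by blast
  have "2 \<le> length P" using assms(2) d unfolding joins_def
    by (cases P; cases "tl P") auto
  moreover have "E p y \<longleftrightarrow> p = hd P \<and> y = c1 \<or> p = last P \<and> y = c2" if "p \<in> set P" "y \<in> set cs" for p y
    using tripod_edge[OF assms(1), of p y] that assms(2,3) unfolding joins_def by auto
  ultimately show ?thesis using assms(1,2) unfolding ear_def joins_def tripod_def by blast
qed

lemma tripod_parity_avoiding:
  assumes "tripod W cs c1 X c2 Y c3 Z T n1 n2 n3" "joins T P n1 n2" "n3 \<notin> set P" "length cs = 8" "\<not> exceptional P X"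
  shows "odd (length P + length X)" "7 \<le> length P + length X"
proof -
  have cs: "cs = c1 # X @ c2 # (Y @ c3 # Z)" and s: "shortest_cycle W cs" using assms(1) unfolding tripod_def by auto
  have ear: "ear (c1 # X @ c2 # (Y @ c3 # Z)) P c1 c2" using tripod_ear[OF assms(1-3)] cs by simp
  have l: "length X + length (Y @ c3 # Z) = 6" using cs assms(4) by simp
  show o: "odd (length P + length X)"
    using ear_parity[of W c1 X c2 "Y @ c3 # Z" P] s ear l assms(5) unfolding cs exceptional_def by auto
  have "ind_cycle (c1 # X @ c2 # rev P)" using ear_hole[of c1 X c2 "Y @ c3 # Z" P] ear shortest_cycle_induced s cs by auto
  from girth[OF ind_cycle_vcycle[OF this]] have "6 \<le> length P + length X" by simp
  then show "7 \<le> length P + length X" using o by (cases "length P + length X = 6") auto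
qed

text \<open>
  A path that avoids the third attachment is an ear. A path through the third attachment consists of
  two ears; their parities and the arc that avoids the third foot would give an induced cycle of even
  length at least \<open>10\<close>.
\<close>

lemma tripod_parity:
  assumes "tripod W cs c1 X c2 Y c3 Z T n1 n2 n3" "length cs = 8" "joins T P n1 n2"
    "\<And>P. joins T P n1 n2 \<Longrightarrow> n3 \<notin> set P \<Longrightarrow> \<not> exceptional P X"
    "\<And>P. joins T P n2 n3 \<Longrightarrow> n1 \<notin> set P \<Longrightarrow> \<not> exceptional P Y"
    "\<And>P. joins T P n3 n1 \<Longrightarrow> n2 \<notin> set P \<Longrightarrow> \<not> exceptional P Z"
  shows "odd (length P + length X)"
proof (cases "n3 \<in> set P")
  case False
  then show ?thesis using tripod_parity_avoiding[OF assms(1,3) _ assms(2)] assms(3,4) by blast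
next
  case True
  have d: "n1 \<noteq> n2" "n2 \<noteq> n3" "n3 \<noteq> n1" using tripod_distinct[OF assms(1)] by auto
  obtain P1 P2 where P: "P = P1 @ n3 # P2" "joins T (P1 @ [n3]) n1 n3" "joins T (n3 # P2) n3 n2"
    "n2 \<notin> set P1" "n1 \<notin> set P2"
    using joins_mem[OF assms(3) True] d by blast
  obtain ds where ds: "tripod W ds c2 Y c3 Z c1 X T n2 n3 n1" "length ds = 8" using tripod_rot[OF assms(1)] assms(2) by auto
  obtain es where es: "tripod W es c3 Z c1 X c2 Y T n3 n1 n2" "length es = 8" using tripod_rot[OF ds(1)] ds(2) by auto
  note j1 = joins_rev[OF P(2)] and j2 = joins_rev[OF P(3)]
  have 1: "odd (length (P1 @ [n3]) + length Z)" "7 \<le> length (P1 @ [n3]) + length Z"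
    using tripod_parity_avoiding[OF es(1) j1 _ es(2)] assms(6)[OF j1] P(4) d by auto
  have 2: "odd (length (n3 # P2) + length Y)" "7 \<le> length (n3 # P2) + length Y"
    using tripod_parity_avoiding[OF ds(1) j2 _ ds(2)] assms(5)[OF j2] P(5) d by auto
  have l: "length X + length Y + length Z = 5" using assms(1,2) unfolding tripod_def by simp
  have cs: "cs = (c1 # X @ [c2]) @ (Y @ c3 # Z)" using assms(1) by (simp add: tripod_def)
  have ipX: "ind_path (c1 # X @ [c2])" using shortest_cycle_induced[of W cs] assms(1) ind_cycle_append[of "c1 # X @ [c2]" "Y @ c3 # Z"] cs
    unfolding tripod_def by auto
  have PT: "set P \<subseteq> T" "ind_path P" "P \<noteq> []" "hd P = n1" "last P = n2" using assms(3) by (auto simp: joins_def)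
  have e: "E x p \<longleftrightarrow> x = c2 \<and> p = n2 \<or> x = c1 \<and> p = n1" if "x \<in> set (c1 # X @ [c2])" "p \<in> set P" for x p
  proof -
    have "distinct cs" using assms(1) by (auto simp: tripod_def shortest_cycle_def vcycle_def)
    then have "x \<noteq> c3" "x \<in> set cs" using that(1) cs by auto
    then show ?thesis using tripod_edge[OF assms(1), of p x] that PT(1) symE[of x p] by auto
  qed
  have disj: "set (c1 # X @ [c2]) \<inter> set (rev P) = {}" using assms(1) PT(1) cs unfolding tripod_def by auto
  have "ind_cycle ((c1 # X @ [c2]) @ rev P)"
  proof (rule ind_cycle_appendI)
    show "4 \<le> length (c1 # X @ [c2]) + length (rev P)" using P(1) by (cases P1; cases P2) (use PT d P(1) in auto)
    show "E x y \<longleftrightarrow> x = last (c1 # X @ [c2]) \<and> y = hd (rev P) \<or> x = hd (c1 # X @ [c2]) \<and> y = last (rev P)"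
      if "x \<in> set (c1 # X @ [c2])" "y \<in> set (rev P)" for x y
      using e[of x y] that PT by (simp add: hd_rev last_rev)
  qed (use ipX PT ind_path_rev[OF PT(2)] disj in auto)
  \<comment> \<open>if the claim fails, this cycle is even, and by the lengths of the two ears it has at least 10 vertices\<close>
  from even_hole_length_8[OF this] have "odd (length X + length P) \<or> length X + length P = 6" by auto
  moreover have "length P = length P1 + length P2 + 1" using P(1) by simp
  ultimately show ?thesis using 1 2 l by (auto simp: add.commute)
qed

text \<open>
  Without exceptional ears, each of the three paths has the parity opposite to that of its arc. As the
  arcs have five vertices in total, the paths have an even total, against \<open>three_paths_odd\<close>.
\<close>

lemma tripod_exceptional_ear:
  assumes "tripod W cs c1 X c2 Y c3 Z T n1 n2 n3" "length cs = 8" "conn_set T"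
  shows "\<exists>P. joins T P n1 n2 \<and> n3 \<notin> set P \<and> exceptional P X \<or> joins T P n2 n3 \<and> n1 \<notin> set P \<and> exceptional P Y \<or>
    joins T P n3 n1 \<and> n2 \<notin> set P \<and> exceptional P Z"
proof (rule ccontr)
  assume n: "\<not> ?thesis"
  obtain ds where ds: "tripod W ds c2 Y c3 Z c1 X T n2 n3 n1" "length ds = 8" using tripod_rot[OF assms(1)] assms(2) by auto
  obtain es where es: "tripod W es c3 Z c1 X c2 Y T n3 n1 n2" "length es = 8" using tripod_rot[OF ds(1)] ds(2) by auto
  obtain P Q R where P: "joins T P n1 n2" "joins T Q n2 n3" "joins T R n3 n1" "odd (length P + length Q + length R)"
    using three_paths_odd[OF assms(3), of n1 n2 n3] assms(1) unfolding tripod_def by blast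
  have "odd (length P + length X)" using tripod_parity[OF assms(1,2) P(1)] n by blast
  moreover have "odd (length Q + length Y)" using tripod_parity[OF ds P(2)] n by blast
  moreover have "odd (length R + length Z)" using tripod_parity[OF es P(3)] n by blast
  moreover have "length X + length Y + length Z = 5" using assms(1,2) unfolding tripod_def by simp
  ultimately show False using P(4) by presburger
qed

text \<open>
  On a cycle of length \<open>8\<close> the hypotheses on \<open>X\<close>, \<open>Y\<close>, \<open>Z\<close> say that the three feet are pairwise neither
  adjacent nor opposite.
\<close>

lemma no_separated_tripod:
  assumes "tripod W cs c1 X c2 Y c3 Z T n1 n2 n3" "conn_set T" "X \<noteq> []" "Y \<noteq> []" "Z \<noteq> []"
    "even (length cs) \<Longrightarrow> length X \<noteq> 3 \<and> length Y \<noteq> 3 \<and> length Z \<noteq> 3"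
  shows False
proof (cases "even (length cs)")
  case True
  then have "length cs = 8" using shortest_cycle_length[of W cs] assms(1) unfolding tripod_def by blast
  then show False using tripod_exceptional_ear[OF assms(1) _ assms(2)] assms True unfolding exceptional_def by blast
next
  case False
  have d: "n1 \<noteq> n2" "n2 \<noteq> n3" "n3 \<noteq> n1" using tripod_distinct[OF assms(1)] by auto
  obtain P where P: "joins T P n1 n2" using conn_set_joins assms unfolding tripod_def by meson
  have key: False if "tripod W cs c1 X c2 Y c3 Z T n1 n2 n3" "joins T P n1 n2" "n3 \<notin> set P" "odd (length cs)" "X \<noteq> []" for cs c1 X c2 Y c3 Z n1 n2 n3 P
    using ear_odd[of W c1 X c2 "Y @ c3 # Z" P] tripod_ear[OF that(1-3)] that unfolding tripod_def joins_def by auto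
  show False
  proof (cases "n3 \<in> set P")
    case False
    then show ?thesis using key[OF assms(1) P False] \<open>odd (length cs)\<close> assms by simp
  next
    case True
    obtain P1 P2 where P: "P = P1 @ n3 # P2" "joins T (P1 @ [n3]) n1 n3" "n2 \<notin> set P1"
      using joins_mem[OF P True] d by blast
    obtain ds where ds: "tripod W ds c2 Y c3 Z c1 X T n2 n3 n1" "length ds = length cs" using tripod_rot[OF assms(1)] by auto
    obtain es where es: "tripod W es c3 Z c1 X c2 Y T n3 n1 n2" "length es = length cs" using tripod_rot[OF ds(1)] ds(2) by auto
    then show False using key[OF es(1) joins_rev[OF P(2)]] P(3) d \<open>odd (length cs)\<close> assms(5) by simp
  qed
qed

section \<open>Minimal pockets\<close>

definition closed_nb :: "'a list \<Rightarrow> 'a set" where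
  "closed_nb cs = {v. v \<in> set cs \<or> (\<exists>c\<in>set cs. E v c)}"

lemma closed_nb_cong: "set cs = set ds \<Longrightarrow> closed_nb cs = closed_nb ds"
  by (simp add: closed_nb_def)

text \<open>
  Only the neighbours of \<open>D\<close> in \<open>W\<close> are controlled, so deleting vertices that are neither on the cycle nor in
  or next to \<open>D\<close> leaves a pocket.
\<close>

definition pocket :: "'a set \<Rightarrow> 'a list \<Rightarrow> 'a set \<Rightarrow> bool" where
  "pocket W cs D \<longleftrightarrow> finite W \<and> shortest_cycle W cs \<and> D \<noteq> {} \<and> D \<subseteq> W - closed_nb cs \<and>
     (\<forall>v\<in>D. \<forall>u\<in>W. E v u \<longrightarrow> u \<in> D \<or> u \<in> closed_nb cs) \<and> (\<forall>v\<in>D. 3 \<le> card {u\<in>W. E v u})"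

text \<open>
  Besides minimality, \<open>W\<close> is reduced to the cycle, the pocket and the neighbours of the pocket.
\<close>

definition min_pocket :: "'a set \<Rightarrow> 'a list \<Rightarrow> 'a set \<Rightarrow> bool" where
  "min_pocket W cs D \<longleftrightarrow> pocket W cs D \<and> conn_set D \<and> (\<forall>u\<in>W. u \<in> set cs \<or> u \<in> D \<or> (\<exists>v\<in>D. E u v)) \<and>
     (\<forall>W' cs' D'. pocket W' cs' D' \<longrightarrow> card D \<le> card D')"

text \<open>
  A smallest pocket is connected, because a component of it is again a pocket.
\<close>

lemma min_pocket_exists:
  assumes "pocket W cs D" shows "\<exists>W cs D. min_pocket W cs D"
proof -
  obtain W0 cs0 D0 where b: "pocket W0 cs0 D0" and m: "\<And>W' cs' D'. pocket W' cs' D' \<Longrightarrow> card D0 \<le> card D'"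
    using ex_has_least_nat[of "\<lambda>(W, cs, D). pocket W cs D" "(W, cs, D)" "\<lambda>(W, cs, D). card D"] assms by auto
  have fin: "finite D0" using b finite_subset unfolding pocket_def by blast
  \<comment> \<open>a non-empty union of components of the smallest pocket is a pocket, hence everything\<close>
  have part: "Z = D0" if Z: "Z \<subseteq> D0" "Z \<noteq> {}" "\<And>v u. v \<in> Z \<Longrightarrow> u \<in> D0 \<Longrightarrow> E v u \<Longrightarrow> u \<in> Z" for Z
  proof -
    have "pocket W0 cs0 Z" using b Z unfolding pocket_def by blast
    then have "card D0 \<le> card Z" by (rule m)
    then show ?thesis using Z fin by (simp add: card_seteq)
  qed
  have cD: "conn_set D0"
  proof -
    obtain v where v: "v \<in> D0" using b by (auto simp: pocket_def)
    let ?Z = "{u. reach D0 v u}"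
    have "?Z = D0"
    proof (rule part)
      show "?Z \<subseteq> D0" using reach_in v by blast
      show "?Z \<noteq> {}" using reach_refl by blast
      show "u \<in> ?Z" if "w \<in> ?Z" "u \<in> D0" "E w u" for w u
        using that reach_in[OF _ v] reach_trans reach_step by blast
    qed
    then show ?thesis by (intro conn_set_rootI[of D0 v]) blast
  qed
  define W1 where "W1 = {u\<in>W0. u \<in> set cs0 \<or> u \<in> D0 \<or> (\<exists>v\<in>D0. E u v)}"
  have nb: "{u\<in>W1. E v u} = {u\<in>W0. E v u}" if "v \<in> D0" for v
    using that sym unfolding W1_def by blast
  have s: "shortest_cycle W1 cs0"
    using b shortest_cycle_mono[of W0 cs0 W1] unfolding pocket_def W1_def shortest_cycle_def by blast
  have "pocket W1 cs0 D0"
    unfolding pocket_def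
  proof (intro conjI ballI impI)
    show "finite W1" using b unfolding pocket_def W1_def by simp
    show "D0 \<subseteq> W1 - closed_nb cs0" using b unfolding pocket_def W1_def by blast
    show "3 \<le> card {u\<in>W1. E v u}" if "v \<in> D0" for v using nb[OF that] b that unfolding pocket_def by simp
  qed (use b s W1_def in \<open>auto simp: pocket_def\<close>)
  then have "min_pocket W1 cs0 D0" using cD m unfolding min_pocket_def W1_def by auto
  then show ?thesis by blast
qed

lemma min_pocketD:
  assumes "min_pocket W cs D"
  shows "shortest_cycle W cs" "D \<subseteq> W" "conn_set D" "D \<noteq> {}" "finite W" "set cs \<subseteq> W" "set cs \<inter> D = {}"
    "\<And>d c. d \<in> D \<Longrightarrow> c \<in> set cs \<Longrightarrow> \<not> E d c"
    "\<And>u. u \<in> W - D - set cs \<Longrightarrow> \<exists>v\<in>D. E u v"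
    "\<And>u. u \<in> W - D - set cs \<Longrightarrow> \<exists>c\<in>set cs. E u c"
proof -
  have b: "pocket W cs D" "conn_set D" and n: "\<forall>u\<in>W. u \<in> set cs \<or> u \<in> D \<or> (\<exists>v\<in>D. E u v)"
    using assms unfolding min_pocket_def by blast+
  have b': "D \<subseteq> W - closed_nb cs" "\<forall>v\<in>D. \<forall>u\<in>W. E v u \<longrightarrow> u \<in> D \<or> u \<in> closed_nb cs"
    using b(1) unfolding pocket_def by blast+
  show s: "shortest_cycle W cs" "D \<subseteq> W" "conn_set D" "D \<noteq> {}" "finite W" "set cs \<inter> D = {}"
    using b unfolding pocket_def closed_nb_def by blast+
  show "set cs \<subseteq> W" using s by (simp add: shortest_cycle_def)
  show "\<not> E d c" if "d \<in> D" "c \<in> set cs" for d c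
    using b' that unfolding closed_nb_def by blast
  show 1: "\<exists>v\<in>D. E u v" if "u \<in> W - D - set cs" for u
    using n that by blast
  show "\<exists>c\<in>set cs. E u c" if u: "u \<in> W - D - set cs" for u
  proof -
    obtain v where v: "v \<in> D" "E u v" using 1[OF u] by blast
    then have "u \<in> D \<or> u \<in> closed_nb cs" using b'(2) u sym[OF v(2)] v(1) by blast
    then show ?thesis using u by (auto simp: closed_nb_def)
  qed
qed

lemma min_pocket_cong: "min_pocket W cs D \<Longrightarrow> shortest_cycle W ds \<Longrightarrow> set ds = set cs \<Longrightarrow> min_pocket W ds D"
proof -
  assume m: "min_pocket W cs D" "shortest_cycle W ds" "set ds = set cs"
  then have "pocket W ds D" using closed_nb_cong[of ds cs] by (simp add: min_pocket_def pocket_def)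
  then show ?thesis using m unfolding min_pocket_def by simp
qed

lemma nb_outside_closed_nb:
  assumes "shortest_cycle W cs" "a \<in> W" "a \<notin> set cs" "c \<in> set cs" "E a c" "3 \<le> card {u\<in>W. E a u}"
  shows "\<exists>b\<in>W - closed_nb cs. E a b"
proof -
  obtain b where b: "b \<in> W" "E a b" "b \<noteq> c" using third_element[OF assms(6), of c c] by blast
  have "b \<notin> set cs" using shortest_cycle_unique_nb[OF assms(1,2,3) assms(4) _ assms(5) b(2)] b(3) by blast
  moreover have "\<not> E b d" if "d \<in> set cs" for d
    using shortest_cycle_nb_stable[OF assms(1,2,3) b(1) calculation assms(4) that assms(5)] b(2) by blast
  ultimately show ?thesis using b by (auto simp: closed_nb_def)
qed

lemma nb_off_shortest_cycle:
  assumes "shortest_cycle W cs" "v \<in> set cs" "3 \<le> card {u\<in>W. E v u}"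
  shows "\<exists>a\<in>W. a \<notin> set cs \<and> E v a"
proof -
  obtain A B where cs: "cs = A @ v # B" using split_list[OF assms(2)] by blast
  have "ind_cycle (v # B @ A)" using shortest_cycle_induced[OF shortest_cycle_swap[of W A "v # B"]] assms(1) cs by simp
  then have e: "\<forall>y\<in>set (B @ A). E v y \<longleftrightarrow> y = hd (B @ A) \<or> y = last (v # B @ A)" by (simp add: ind_cycle_def)
  obtain a where a: "a \<in> W" "E v a" "a \<noteq> hd (B @ A)" "a \<noteq> last (v # B @ A)" using third_element[OF assms(3)] by blast
  then have "a \<notin> set (B @ A)" "a \<noteq> v" using e irr by blast+
  then show ?thesis using a cs by auto
qed

text \<open>
  The cycle \<open>ds\<close> is shortest in a part \<open>W'\<close> of \<open>W\<close> in which the vertices of the pocket keep all their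
  neighbours, and it runs through the pocket.
\<close>

definition probe :: "'a set \<Rightarrow> 'a list \<Rightarrow> 'a set \<Rightarrow> 'a set \<Rightarrow> 'a list \<Rightarrow> bool" where
  "probe W cs D W' ds \<longleftrightarrow> min_pocket W cs D \<and> W' \<subseteq> W \<and> D \<subseteq> W' \<and> (\<forall>u\<in>W. \<forall>v\<in>D. E u v \<longrightarrow> u \<in> W') \<and>
     shortest_cycle W' ds \<and> set ds \<inter> D \<noteq> {}"

lemma probe_self: "min_pocket W cs D \<Longrightarrow> shortest_cycle W ds \<Longrightarrow> v \<in> D \<Longrightarrow> v \<in> set ds \<Longrightarrow> probe W cs D W ds"
  using min_pocketD(2)[of W cs D] unfolding probe_def by blast

lemma probe_degree:
  assumes "probe W cs D W' ds" "v \<in> D" shows "3 \<le> card {u\<in>W'. E v u}"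
proof -
  have "{u\<in>W'. E v u} = {u\<in>W. E v u}" using assms sym unfolding probe_def by blast
  then show ?thesis using assms unfolding probe_def min_pocket_def pocket_def by simp
qed

text \<open>
  A component inside \<open>D\<close> of what is left after deleting the closed neighbourhood of \<open>ds\<close> would be a pocket
  for \<open>ds\<close>, and smaller than \<open>D\<close> since it misses the vertices of \<open>ds\<close>.
\<close>

lemma outer_touch:
  assumes "probe W cs D W' ds" "z \<in> W' - closed_nb ds"
  shows "\<exists>u\<in>W' - closed_nb ds - D. reach (W' - closed_nb ds) z u"
proof (rule ccontr)
  assume n: "\<not> ?thesis"
  let ?Z = "{u. reach (W' - closed_nb ds) z u}"
  have Z: "?Z \<subseteq> W' - closed_nb ds" using reach_in assms(2) by blast
  then have ZD: "?Z \<subseteq> D" using n by blast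
  have mb: "min_pocket W cs D" "W' \<subseteq> W" using assms(1) by (auto simp: probe_def)
  have fin: "finite W" using mb by (auto simp: min_pocket_def pocket_def)
  have "pocket W' ds ?Z"
    unfolding pocket_def
  proof (intro conjI ballI impI)
    show "finite W'" by (rule finite_subset[OF mb(2) fin])
    show "?Z \<noteq> {}" using reach_refl by blast
    show "u \<in> ?Z \<or> u \<in> closed_nb ds" if "v \<in> ?Z" "u \<in> W'" "E v u" for v u
      using that Z reach_trans reach_step by blast
    show "3 \<le> card {u\<in>W'. E v u}" if "v \<in> ?Z" for v using probe_degree[OF assms(1)] that ZD by blast
  qed (use assms Z in \<open>auto simp: probe_def\<close>)
  then have "card D \<le> card ?Z" using mb unfolding min_pocket_def by blast
  moreover have "?Z \<subset> D" using ZD Z assms(1) unfolding probe_def closed_nb_def by blast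
  moreover have "D \<subseteq> W" using mb(1) by (auto simp: min_pocket_def pocket_def)
  then have "finite D" using fin finite_subset by blast
  ultimately show False using psubset_card_mono[of D ?Z] by linarith
qed

text \<open>
  The set \<open>S\<close> is a connected piece off the cycle which, together with \<open>outer_touch\<close>, makes everything
  around \<open>ds\<close> connected. The last condition provides the third neighbour of a vertex of \<open>D\<close> on \<open>ds\<close> with a
  way to \<open>S\<close> if that neighbour is not in \<open>D\<close>.
\<close>

definition anchor :: "'a set \<Rightarrow> 'a list \<Rightarrow> 'a set \<Rightarrow> 'a set \<Rightarrow> 'a list \<Rightarrow> 'a set \<Rightarrow> bool" where
  "anchor W cs D W' ds S \<longleftrightarrow> probe W cs D W' ds \<and> S \<subseteq> W' - set ds - D \<and> conn_set S \<and> S \<noteq> {} \<and>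
     (\<forall>u\<in>W' - D - closed_nb ds. u \<in> S \<or> (\<exists>s\<in>S. E u s)) \<and>
     (\<forall>d\<in>D \<inter> set ds. \<forall>u\<in>W' - D - set ds. E d u \<longrightarrow> u \<notin> S \<and> (\<exists>s\<in>S. E u s))"

text \<open>
  A neighbour of \<open>d\<close> off the cycle from which the walk can be continued away from the cycle or into \<open>S\<close>.
\<close>

definition spoke :: "'a set \<Rightarrow> 'a list \<Rightarrow> 'a set \<Rightarrow> 'a \<Rightarrow> 'a \<Rightarrow> bool" where
  "spoke W' ds S d a \<longleftrightarrow> a \<in> W' \<and> a \<notin> set ds \<and> a \<notin> S \<and> E a d \<and> (\<exists>t\<in>(W' - closed_nb ds) \<union> S. E a t)"

lemma anchor_spoke:
  assumes "anchor W cs D W' ds S" "d \<in> D" "d \<in> set ds"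
  shows "\<exists>a. spoke W' ds S d a"
proof -
  have s: "probe W cs D W' ds" "shortest_cycle W' ds" using assms(1) by (auto simp: anchor_def probe_def)
  obtain a where a: "a \<in> W'" "a \<notin> set ds" "E d a" using nb_off_shortest_cycle[OF s(2) assms(3) probe_degree[OF s(1) assms(2)]] by blast
  show ?thesis
  proof (cases "a \<in> D")
    case True
    have "\<exists>b\<in>W' - closed_nb ds. E a b"
      using nb_outside_closed_nb[OF s(2) a(1,2) assms(3) sym[OF a(3)] probe_degree[OF s(1) True]] .
    moreover have "a \<notin> S" using assms(1) True unfolding anchor_def by blast
    ultimately have "spoke W' ds S d a" using a sym[OF a(3)] unfolding spoke_def by blast
    then show ?thesis by blast
  next
    case False
    have "\<forall>d\<in>D \<inter> set ds. \<forall>u\<in>W' - D - set ds. E d u \<longrightarrow> u \<notin> S \<and> (\<exists>s\<in>S. E u s)"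
      using assms(1) by (simp add: anchor_def)
    then have "a \<notin> S \<and> (\<exists>s\<in>S. E a s)" using a False assms(2,3) by blast
    then have "spoke W' ds S d a" using a sym[OF a(3)] unfolding spoke_def by blast
    then show ?thesis by blast
  qed
qed

lemma anchor_conn_set:
  assumes "anchor W cs D W' ds S" "\<forall>a\<in>A. \<exists>d. spoke W' ds S d a"
  shows "conn_set ((W' - closed_nb ds) \<union> S \<union> A)"
proof -
  define T where "T = (W' - closed_nb ds) \<union> S \<union> A"
  have cS: "conn_set S" "S \<noteq> {}" and s: "probe W cs D W' ds"
    and nbS: "\<And>u. u \<in> W' - D - closed_nb ds \<Longrightarrow> u \<in> S \<or> (\<exists>s\<in>S. E u s)"
    using assms(1) by (simp_all add: anchor_def)
  have ST: "S \<subseteq> T" and WT: "W' - closed_nb ds \<subseteq> T" and AT: "A \<subseteq> T" by (auto simp: T_def)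
  obtain r where r: "r \<in> S" using cS by blast
  have S: "reach T r s" if "s \<in> S" for s
    using cS(1) r that ST reach_mono[of S r s T] by (simp add: conn_set_def)
  have nb: "reach T r y" if "reach T r x" "x \<in> T" "y \<in> T" "E x y" for x y
    using reach_trans[OF that(1) reach_step[OF that(4,2,3)]] .
  have W: "reach T r z" if z: "z \<in> W' - closed_nb ds" for z
  proof -
    obtain u where u: "u \<in> W' - closed_nb ds - D" "reach (W' - closed_nb ds) z u" using outer_touch[OF s z] by blast
    then have uT: "u \<in> T" using WT by blast
    have "u \<in> S \<or> (\<exists>s\<in>S. E u s)" using nbS[of u] u(1) by blast
    then have "reach T r u"
    proof
      assume "\<exists>s\<in>S. E u s"
      then obtain s where "s \<in> S" "E u s" by blast
      have "s \<in> T" using \<open>s \<in> S\<close> ST by blast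
      then show ?thesis by (rule nb[OF S[OF \<open>s \<in> S\<close>] _ uT sym[OF \<open>E u s\<close>]])
    qed (rule S)
    moreover have "reach T u z" using reach_mono[OF reach_sym[OF u(2)] WT] .
    ultimately show ?thesis by (rule reach_trans)
  qed
  have A: "reach T r a" if a: "a \<in> A" for a
  proof -
    obtain d where "spoke W' ds S d a" using bspec[OF assms(2) a] by blast
    then have "\<exists>t\<in>(W' - closed_nb ds) \<union> S. E a t" unfolding spoke_def by (elim conjE)
    then obtain t where t0: "t \<in> (W' - closed_nb ds) \<union> S" and t: "E a t" by (rule bexE)
    have t1: "t \<in> W' - closed_nb ds \<or> t \<in> S" using t0 by simp
    have "reach T r t" using S[of t] W[of t] t1 by blast
    moreover have "t \<in> T" using t1 ST WT by blast
    moreover have "a \<in> T" using a AT by blast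
    ultimately show ?thesis by (rule nb[OF _ _ _ sym[OF t]])
  qed
  have "reach T r x" if x: "x \<in> T" for x
  proof -
    have "x \<in> W' - closed_nb ds \<or> x \<in> S \<or> x \<in> A" using x unfolding T_def by blast
    then show ?thesis using S[of x] W[of x] A[of x] by blast
  qed
  then have "conn_set T" by (rule conn_set_rootI)
  then show ?thesis by (simp only: T_def)
qed

lemma anchorI:
  assumes "probe W cs D W' ds" "K \<subseteq> W'" "K \<inter> D = {}" "\<And>d k. d \<in> D \<Longrightarrow> k \<in> K \<Longrightarrow> \<not> E d k"
    "\<And>u. u \<in> W' - D - K \<Longrightarrow> \<exists>c\<in>K. E u c" "conn_set (K - set ds)" "K - set ds \<noteq> {}"
  shows "anchor W cs D W' ds (K - set ds)"
  unfolding anchor_def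
proof (intro conjI ballI impI)
  show "K - set ds \<subseteq> W' - set ds - D" using assms(2,3) by blast
  show "u \<in> K - set ds \<or> (\<exists>s\<in>K - set ds. E u s)" if u: "u \<in> W' - D - closed_nb ds" for u
  proof (cases "u \<in> K")
    case True
    then show ?thesis using u by (auto simp: closed_nb_def)
  next
    case False
    then obtain c where "c \<in> K" "E u c" using assms(5)[of u] u by blast
    then show ?thesis using u by (auto simp: closed_nb_def)
  qed
  fix d u assume d: "d \<in> D \<inter> set ds" and u: "u \<in> W' - D - set ds" and du: "E d u"
  have uK: "u \<notin> K" using assms(4)[of d u] d du by blast
  then show "u \<notin> K - set ds" by blast
  obtain c where c: "c \<in> K" "E u c" using assms(5)[of u] u uK by blast
  have "c \<notin> set ds"
  proof
    assume "c \<in> set ds"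
    moreover have "shortest_cycle W' ds" using assms(1) by (simp add: probe_def)
    ultimately have "c = d" using shortest_cycle_unique_nb[of W' ds u c d] u d c sym[OF du] by blast
    then show False using c assms(3) d by blast
  qed
  then show "\<exists>s\<in>K - set ds. E u s" using c by blast
qed (use assms in auto)

lemma anchor_cong:
  assumes "anchor W cs D W' ds S" "shortest_cycle W' es" "set es = set ds"
  shows "anchor W cs D W' es S"
  using assms closed_nb_cong[OF assms(3)] unfolding anchor_def probe_def by simp

section \<open>No exceptional ears through a minimal pocket\<close>

text \<open>
  In what follows, the boundary of a pocket consists of the vertices of \<open>W\<close> that are neither in \<open>D\<close> nor on
  the cycle; each of them has one neighbour on the cycle, its foot.
\<close>

lemma boundary_foot_unique:
  assumes "min_pocket W cs D" "n \<in> W" "n \<notin> set cs" "c \<in> set cs" "E n c" "y \<in> set cs"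
  shows "E n y \<longleftrightarrow> y = c"
  using shortest_cycle_unique_nb[of W cs n c y] min_pocketD(1)[OF assms(1)] assms by blast

lemma ear_mid:
  assumes "min_pocket W cs D" "ear cs P c d" "set P \<subseteq> W" "p \<in> set P" "p \<noteq> hd P" "p \<noteq> last P"
  shows "p \<in> D"
proof (rule ccontr)
  assume "p \<notin> D"
  then have "p \<in> W - D - set cs" using assms unfolding ear_def by blast
  then obtain e where "e \<in> set cs" "E p e" using min_pocketD(10)[OF assms(1)] by blast
  then show False using assms unfolding ear_def by blast
qed

lemma ear_ends:
  assumes "min_pocket W cs D" "ear cs P c d" "set P \<subseteq> W" "c \<in> set cs" "d \<in> set cs"
  shows "E (hd P) c" "E (last P) d" "hd P \<in> W - D - set cs" "last P \<in> W - D - set cs"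
proof -
  have "P \<noteq> []" using assms(2) unfolding ear_def by auto
  then have h: "hd P \<in> set P" "last P \<in> set P" by auto
  show e: "E (hd P) c" "E (last P) d" using assms h unfolding ear_def by blast+
  show "hd P \<in> W - D - set cs" "last P \<in> W - D - set cs"
    using h assms e min_pocketD(8)[OF assms(1)] unfolding ear_def by blast+
qed

text \<open>
  The path \<open>L\<close> runs from \<open>q\<close> to \<open>p\<close>. By the hypotheses on reachability, \<open>a\<close> can get to \<open>L\<close> only at \<open>p\<close> and \<open>b\<close> only
  at \<open>q\<close>, so induced routes from \<open>a\<close> to \<open>p\<close> and from \<open>b\<close> to \<open>q\<close> have no edges between them and none to the
  rest of \<open>L\<close>. With \<open>L\<close> and a path \<open>V\<close> between the other neighbours of \<open>a\<close> and \<open>b\<close> they form an induced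
  cycle.
\<close>

lemma crossed_routes_hole:
  assumes L: "ind_path L" "L = q # M @ [p]" "set L \<subseteq> T"
    and ab: "a \<in> T" "b \<in> T" "a \<notin> set L" "b \<notin> set L"
    and r: "reach (T - {q}) p a" "\<not> reach (T - {p}) q a" "reach (T - {p}) q b" "\<not> reach (T - {q}) p b"
    and V: "ind_path V" "V \<noteq> []" "set V \<inter> T = {}"
      "\<And>t v. t \<in> T \<Longrightarrow> v \<in> set V \<Longrightarrow> E v t \<longleftrightarrow> t = a \<and> v = hd V \<or> t = b \<and> v = last V"
  shows "\<exists>R1 R4. joins T (R1 @ [p]) a p \<and> joins T (R4 @ [q]) b q \<and> set R1 \<inter> insert b (set L) = {} \<and>
    set R4 \<inter> insert a (set L) = {} \<and> ind_cycle (V @ (R4 @ L @ rev R1))"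
proof -
  have pq: "p \<noteq> q" "p \<in> T" "q \<in> T" using L by auto
  define Up Uq where U: "Up = {x. reach (T - {q}) p x}" "Uq = {x. reach (T - {p}) q x}"
  have Usub: "Up \<subseteq> T - {q}" "Uq \<subseteq> T - {p}" using reach_in pq unfolding U by blast+
  have step: "y \<in> Up" if "x \<in> Up" "E x y" "y \<in> T - {q}" for x y
  proof -
    have "x \<in> T - {q}" "reach (T - {q}) p x" using that Usub by (auto simp: U)
    then show ?thesis using reach_trans[OF _ reach_step[OF that(2)]] that(3) by (simp add: U)
  qed
  have stepq: "y \<in> Uq" if "x \<in> Uq" "E x y" "y \<in> T - {p}" for x y
  proof -
    have "x \<in> T - {p}" "reach (T - {p}) q x" using that Usub by (auto simp: U)
    then show ?thesis using reach_trans[OF _ reach_step[OF that(2)]] that(3) by (simp add: U)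
  qed
  have Ldist: "distinct L" using L(1) ind_path_distinct by blast
  have Lp: "set (M @ [p]) \<subseteq> Up"
  proof
    fix x assume x: "x \<in> set (M @ [p])"
    have ip: "ind_path (rev (M @ [p]))" using ind_path_rev[of "M @ [p]"] L by simp
    have "reach (set (rev (M @ [p]))) (hd (rev (M @ [p]))) x" using reach_along_ind_path[OF ip] x by simp
    moreover have "set (rev (M @ [p])) \<subseteq> T - {q}" "hd (rev (M @ [p])) = p" using L Ldist by auto
    ultimately have "reach (T - {q}) p x" using reach_mono by metis
    then show "x \<in> Up" by (simp add: U)
  qed
  have Lq: "set (q # M) \<subseteq> Uq"
  proof
    fix x assume x: "x \<in> set (q # M)"
    have ip: "ind_path (q # M)" using L ind_path_append[of "q # M" "[p]"] by simp
    have "reach (set (q # M)) (hd (q # M)) x" using reach_along_ind_path[OF ip] x by simp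
    moreover have "set (q # M) \<subseteq> T - {p}" "hd (q # M) = q" using L Ldist by auto
    ultimately have "reach (T - {p}) q x" using reach_mono by metis
    then show "x \<in> Uq" by (simp add: U)
  qed
  have aU: "a \<in> Up" "a \<notin> Uq" "b \<in> Uq" "b \<notin> Up" using r by (auto simp: U)
  have route: "\<exists>R. joins (T - {q'}) (R @ [p']) a' p' \<and> set R \<inter> Uq' = {} \<and> R \<noteq> [] \<and> p' \<notin> set R"
    if h: "reach (T - {q'}) p' a'" "p' \<in> T - {q'}" "a' \<in> T" "a' \<noteq> p'" "a' \<notin> Uq'"
      "\<forall>x y. x \<in> Uq' \<longrightarrow> E x y \<longrightarrow> y \<in> T - {p'} \<longrightarrow> y \<in> Uq'" for q' p' a' Uq'
  proof -
    have "a' \<in> T - {q'}" using reach_in[OF h(1,2)] .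
    then obtain P where P: "ind_path P" "P \<noteq> []" "set P \<subseteq> T - {q'}" "hd P = a'" "last P = p'"
      using reach_ind_path[OF reach_sym[OF h(1)]] by blast
    then obtain R where R: "P = R @ [p']" by (metis append_butlast_last_id)
    then have "R \<noteq> []" using P h(4) by auto
    have "p' \<notin> set R" using ind_path_distinct[OF P(1)] R by auto
    have ipR: "ind_path R" using P R by (simp add: ind_path_append)
    have "x \<notin> Uq'" if x: "x \<in> set R" for x
    proof
      assume xU: "x \<in> Uq'"
      obtain R1 R2 where R12: "R = R1 @ x # R2" using split_list[OF x] by blast
      have "ind_path (rev (R1 @ [x]))" using ind_path_snoc_split[of R1 x R2] ipR R12 ind_path_rev by blast
      then have "reach (set (rev (R1 @ [x]))) x a'"
        using reach_along_ind_path[of "rev (R1 @ [x])" a'] P(4) R R12 by (cases R1) auto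
      moreover have "set (rev (R1 @ [x])) \<subseteq> T - {p'}" using R12 R P(3) \<open>p' \<notin> set R\<close> by auto
      ultimately have "reach (T - {p'}) x a'" by (rule reach_mono)
      then have "a' \<in> Uq'" unfolding reach_def
      proof (induction rule: rtranclp_induct)
        case (step y z)
        then show ?case using h(6) by blast
      qed (rule xU)
      then show False using \<open>a' \<notin> Uq'\<close> by blast
    qed
    then have "set R \<inter> Uq' = {}" by blast
    moreover have "joins (T - {q'}) (R @ [p']) a' p'" using P R by (simp add: joins_def)
    ultimately show ?thesis using \<open>R \<noteq> []\<close> \<open>p' \<notin> set R\<close> by blast
  qed
  obtain R1 where R1: "joins (T - {q}) (R1 @ [p]) a p" "set R1 \<inter> Uq = {}" "R1 \<noteq> []" "p \<notin> set R1"
  proof -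
    have "a \<noteq> p" using ab L(2) by auto
    moreover have "\<forall>x y. x \<in> Uq \<longrightarrow> E x y \<longrightarrow> y \<in> T - {p} \<longrightarrow> y \<in> Uq" using stepq by blast
    moreover have "p \<in> T - {q}" using pq by blast
    ultimately show ?thesis using route[of q p a Uq] r(1) ab(1) aU(2) that by blast
  qed
  obtain R4 where R4: "joins (T - {p}) (R4 @ [q]) b q" "set R4 \<inter> Up = {}" "R4 \<noteq> []" "q \<notin> set R4"
  proof -
    have "b \<noteq> q" using ab L(2) by auto
    moreover have "\<forall>x y. x \<in> Up \<longrightarrow> E x y \<longrightarrow> y \<in> T - {q} \<longrightarrow> y \<in> Up" using step by blast
    moreover have "q \<in> T - {p}" using pq by blast
    ultimately show ?thesis using route[of p q b Up] r(3) ab(2) aU(4) that by blast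
  qed
  have R1T: "set R1 \<subseteq> T - {p, q}" using R1 by (auto simp: joins_def)
  have R4T: "set R4 \<subseteq> T - {p, q}" using R4 by (auto simp: joins_def)
  have e1: "\<not> E x y" if "x \<in> set R1" "y \<in> Uq" for x y
    using stepq[of y x] that R1(2) R1T sym by blast
  have e4: "\<not> E x y" if "x \<in> set R4" "y \<in> Up" for x y
    using step[of y x] that R4(2) R4T sym by blast
  have R4U: "set R4 \<subseteq> Uq"
  proof
    fix x assume x: "x \<in> set R4"
    have ip: "ind_path (rev (R4 @ [q]))" using ind_path_rev[of "R4 @ [q]"] joinsD[OF R4(1)] by blast
    have "reach (set (rev (R4 @ [q]))) q x" using reach_along_ind_path[OF ip] x by simp
    moreover have "set (rev (R4 @ [q])) \<subseteq> T - {p}" using R4T pq by auto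
    ultimately show "x \<in> Uq" unfolding U using reach_mono by blast
  qed
  have d1: "set R1 \<inter> set L = {}" using R1(2,4) Lq L(2) by auto
  have d4: "set R4 \<inter> set L = {}" using R4(2,4) Lp L(2) by auto
  have ips: "ind_path (R1 @ [p])" "ind_path (R4 @ [q])" using R1 R4 by (auto simp: joins_def)
  have "ind_path (L @ rev R1)"
    unfolding ind_path_append[of L]
  proof (intro conjI ballI)
    show "ind_path (rev R1)" using ips ind_path_rev by (simp add: ind_path_append)
    show "set L \<inter> set (rev R1) = {}" using d1 by auto
    fix x y assume x: "x \<in> set L" and y: "y \<in> set (rev R1)"
    have hl: "last L = p" "hd (rev R1) = last R1" using L(2) R1(3) by (auto simp: hd_rev)
    show "E x y \<longleftrightarrow> x = last L \<and> y = hd (rev R1)"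
    proof (cases "x = p")
      case True
      have "E y p \<longleftrightarrow> y = last R1" using ips(1) y by (simp add: ind_path_append)
      then show ?thesis using True hl symE[of x y] by simp
    next
      case False
      then have "x \<in> Uq" using x L(2) Lq by auto
      then show ?thesis using e1[of y x] y symE[of x y] False hl by auto
    qed
  qed (rule L)
  moreover have "ind_path R4" using ips by (simp add: ind_path_append)
  moreover have "set R4 \<inter> set R1 = {}" using R4U R1(2) by blast
  moreover have "E x y \<longleftrightarrow> x = last R4 \<and> y = hd (L @ rev R1)" if x: "x \<in> set R4" and y: "y \<in> set (L @ rev R1)" for x y
  proof -
    have hl: "hd (L @ rev R1) = q" using L(2) by simp
    show ?thesis
    proof (cases "y = q")
      case True
      have "E x q \<longleftrightarrow> x = last R4" using ips(2) x by (simp add: ind_path_append)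
      then show ?thesis using True hl by simp
    next
      case False
      have "\<not> E x y"
      proof (cases "y \<in> set R1")
        case True
        then show ?thesis using e1[of y x] R4U x sym by blast
      next
        case f: False
        then have "y \<in> Up" using y False L(2) Lp by auto
        then show ?thesis using e4 x by blast
      qed
      then show ?thesis using False hl by simp
    qed
  qed
  ultimately have ip: "ind_path (R4 @ (L @ rev R1))"
    unfolding ind_path_append[of R4] using d4 by auto
  have hdR: "hd R1 = a" "hd R4 = b" using R1 R4 by (auto simp: joins_def)
  have sT: "set (R4 @ (L @ rev R1)) \<subseteq> T" using R1T R4T L(3) by auto
  have "ind_cycle (V @ (R4 @ (L @ rev R1)))"
  proof (rule ind_cycle_appendI)
    show "4 \<le> length V + length (R4 @ L @ rev R1)" using L(2) R1(3) V(2)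
      by (cases R1; cases V) auto
    show "set V \<inter> set (R4 @ L @ rev R1) = {}" using sT V(3) by blast
    fix v t assume "v \<in> set V" "t \<in> set (R4 @ L @ rev R1)"
    then have "E v t \<longleftrightarrow> t = a \<and> v = hd V \<or> t = b \<and> v = last V" using V(4)[of t v] sT by blast
    moreover have "hd (R4 @ L @ rev R1) = b" "last (R4 @ L @ rev R1) = a" using hdR R1(3) R4(3) by (auto simp: last_rev)
    ultimately show "E v t \<longleftrightarrow> v = last V \<and> t = hd (R4 @ L @ rev R1) \<or> v = hd V \<and> t = last (R4 @ L @ rev R1)" by auto
  qed (use V R4 ip in auto)
  moreover have "b \<notin> set R1" using R1(2) aU by blast
  moreover have "a \<notin> set R4" using R4U aU by blast
  moreover have "joins T (R1 @ [p]) a p" "joins T (R4 @ [q]) b q" using R1 R4 unfolding joins_def by auto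
  ultimately show ?thesis using d1 d4 by (intro exI[of _ R1] exI[of _ R4]) simp
qed

text \<open>
  The ear \<open>P\<close> and the edge \<open>o0 o1\<close> form a second cycle of length \<open>8\<close>. By \<open>outer_touch\<close>, the rest \<open>Y\<close> of the
  first cycle makes everything around it connected, and \<open>Y\<close> is attached to it only by its ends \<open>o2\<close> (at
  \<open>o1\<close>) and \<open>o7\<close> (at \<open>o0\<close>). Let \<open>a1\<close> and \<open>a4\<close> be the third neighbours of \<open>v1\<close> and \<open>v4\<close>. Both \<open>o1, v1, v4\<close>
  and \<open>o0, v1, v4\<close> are triples of positions that cannot be attached to one connected set, so \<open>a1\<close> and
  \<open>a4\<close> are not both connected to \<open>o2\<close> without \<open>o7\<close>, nor both to \<open>o7\<close> without \<open>o2\<close>. Therefore one of them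
  leads only to \<open>o2\<close> and the other only to \<open>o7\<close>, and the two routes, \<open>Y\<close> and \<open>v1, v2, v3, v4\<close> form an even
  hole that is too long.
\<close>

lemma no_six_ear:
  assumes mb: "min_pocket W (o0 # o1 # Y) D" and lY: "length Y = 6" and er: "ear (o0 # o1 # Y) P o0 o1"
    and lP: "length P = 6" and PW: "set P \<subseteq> W"
  shows False
proof -
  let ?C = "o0 # o1 # Y"
  note f = min_pocketD[OF mb]
  obtain o2 o3 o4 o5 o6 o7 where Y: "Y = [o2,o3,o4,o5,o6,o7]"
    using lY by (auto simp: length_Suc_conv eval_nat_numeral)
  obtain n0 v1 v2 v3 v4 n1 where P: "P = [n0,v1,v2,v3,v4,n1]"
    using lP by (auto simp: length_Suc_conv eval_nat_numeral)
  have dC: "distinct ?C" and iC: "ind_cycle ?C" using shortest_cycle_induced[OF f(1)] f(1) by (auto simp: shortest_cycle_def vcycle_def)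
  have dP: "distinct P" and iP: "ind_path P" using er ind_path_distinct by (auto simp: ear_def)
  have PC: "set P \<inter> set ?C = {}" using er by (simp add: ear_def)
  have n0: "E n0 o0" "n0 \<in> W - D - set ?C" and n1: "E n1 o1" "n1 \<in> W - D - set ?C"
    using ear_ends[OF mb er PW] P by auto
  have vD: "v1 \<in> D" "v2 \<in> D" "v3 \<in> D" "v4 \<in> D"
    using ear_mid[OF mb er PW] dP P by auto
  have Eo: "E o0 o1" using f(1) by (auto simp: shortest_cycle_def vcycle_def)
  \<comment> \<open>the second cycle of length \<open>8\<close>\<close>
  define ds where "ds = [o0,n0,v1,v2,v3,v4,n1,o1]"
  have "vcycle ds" using dC dP PC ind_path_successively[OF iP] sym[OF n0(1)] n1(1) sym[OF Eo]
    unfolding ds_def vcycle_def P by auto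
  moreover have dsW: "set ds \<subseteq> W" using PW f(6) unfolding ds_def P by auto
  moreover have "length ds = length ?C" using lY by (simp add: ds_def)
  ultimately have sds: "shortest_cycle W ds" using shortest_cycle_same_length f(1) by blast
  have sub: "probe W ?C D W ds" using probe_self[OF mb sds vD(1)] by (simp add: ds_def)
  have Yd: "set ?C - set ds = set Y" using dC PC unfolding ds_def P Y by auto
  have iY: "ind_path Y" using iC ind_cycle_append[of "[o0,o1]" Y] Y by auto
  have an: "anchor W ?C D W ds (set Y)"
    using anchorI[OF sub f(6) f(7) f(8) f(10)] conn_set_ind_path_set[OF iY] Yd Y by auto
  obtain a1 a4 where a1: "spoke W ds (set Y) v1 a1" and a4: "spoke W ds (set Y) v4 a4"
    using anchor_spoke[OF an vD(1)] anchor_spoke[OF an vD(4)] by (auto simp: ds_def)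
  define T where "T = (W - closed_nb ds) \<union> set Y \<union> {a1, a4}"
  have cT: "conn_set T" unfolding T_def using anchor_conn_set[OF an, of "{a1, a4}"] a1 a4 by blast
  have aW: "a1 \<in> W" "a1 \<notin> set ds" "a1 \<notin> set Y" "E a1 v1" "a4 \<in> W" "a4 \<notin> set ds" "a4 \<notin> set Y" "E a4 v4"
    using a1 a4 by (auto simp: spoke_def)
  have YW: "set Y \<subseteq> W" "set Y \<inter> set ds = {}" using f(6) Yd by auto
  have TW: "T \<subseteq> W" "T \<inter> set ds = {}" using aW YW unfolding T_def closed_nb_def by auto
  have uq: "y = z" if "t \<in> T" "y \<in> set ds" "z \<in> set ds" "E t y" "E t z" for t y z
    using shortest_cycle_unique_nb[OF sds _ _ that(2,3,4,5)] that(1) TW by blast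
  have inds: "o0 \<in> set ds" "o1 \<in> set ds" "v1 \<in> set ds" "v4 \<in> set ds" by (auto simp: ds_def)
  have v14: "v1 \<noteq> v4" using dP P by auto
  have a14: "a1 \<noteq> a4" using uq[of a1 v1 v4] aW inds v14 by (auto simp: T_def)
  have Yo: "E t o1 \<longleftrightarrow> t = o2" "E t o0 \<longleftrightarrow> t = o7" if "t \<in> set Y" for t
  proof -
    have "E o0 t \<longleftrightarrow> t = o1 \<or> t = o7" "t \<noteq> o1" using iC that dC unfolding ind_cycle_def Y by auto
    then show "E t o0 \<longleftrightarrow> t = o7" using symE[of t o0] by blast
    have "ind_path (o1 # Y)" using iC unfolding ind_cycle_def list.sel by blast
    then have "\<forall>t\<in>set Y. E o1 t \<longleftrightarrow> t = hd Y" unfolding ind_path.simps(2) by blast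
    moreover have "hd Y = o2" by (simp add: Y)
    ultimately have "E o1 t \<longleftrightarrow> t = o2" using that by blast
    then show "E t o1 \<longleftrightarrow> t = o2" using symE[of t o1] by blast
  qed
  have o27: "o2 \<in> set Y" "o7 \<in> set Y" "o2 \<noteq> o7" using dC by (auto simp: Y)
  have tedge: "E t y \<longleftrightarrow> t = a1 \<and> y = v1 \<or> t = a4 \<and> y = v4 \<or> t = o2 \<and> y = o1 \<or> t = o7 \<and> y = o0"
    if t: "t \<in> T" and y: "y \<in> set ds" for t y
  proof
    assume e: "E t y"
    then have "t \<in> set Y \<or> t = a1 \<or> t = a4" using t y unfolding T_def closed_nb_def by blast
    then show "t = a1 \<and> y = v1 \<or> t = a4 \<and> y = v4 \<or> t = o2 \<and> y = o1 \<or> t = o7 \<and> y = o0"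
    proof (elim disjE)
      assume tY: "t \<in> set Y"
      then have tC: "t \<in> set ?C" "t \<noteq> o0" "t \<noteq> o1" using dC by auto
      have "y \<notin> D" using f(8) tC e sym by blast
      moreover have "y \<noteq> n0" "y \<noteq> n1"
        using boundary_foot_unique[OF mb, of n0 o0 t] boundary_foot_unique[OF mb, of n1 o1 t] n0 n1 tC e sym by auto
      ultimately have "y = o0 \<or> y = o1" using y vD unfolding ds_def by auto
      then show ?thesis using Yo[OF tY] e by blast
    qed (use uq[OF t y] e aW inds in blast)+
  next
    show "t = a1 \<and> y = v1 \<or> t = a4 \<and> y = v4 \<or> t = o2 \<and> y = o1 \<or> t = o7 \<and> y = o0 \<Longrightarrow> E t y"
      using aW Yo o27 by blast
  qed
  have sr: "shortest_cycle W (o1 # [o0,n0] @ v1 # [v2,v3] @ v4 # [n1])" "shortest_cycle W (o0 # [n0] @ v1 # [v2,v3] @ v4 # [n1,o1])"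
    "shortest_cycle W (v1 # [v2,v3,v4,n1] @ o1 # [o0,n0])" "shortest_cycle W (v4 # [n1,o1] @ o0 # [n0,v1,v2,v3])"
    "shortest_cycle W (v1 # [v2,v3,v4,n1,o1] @ o0 # [n0])" "shortest_cycle W (v4 # [n1] @ o1 # [o0,n0,v1,v2,v3])"
    using sds shortest_cycle_swap[of W "[o0,n0,v1,v2,v3,v4,n1]" "[o1]"] shortest_cycle_swap[of W "[o0,n0]" "[v1,v2,v3,v4,n1,o1]"]
      shortest_cycle_swap[of W "[o0,n0,v1,v2,v3]" "[v4,n1,o1]"] by (auto simp: ds_def)
  have part: False
    if es: "shortest_cycle W (c # X @ v1 # [v2,v3] @ v4 # Z)" "set (c # X @ v1 # [v2,v3] @ v4 # Z) = set ds"
      "X \<noteq> []" "Z \<noteq> []" "length X \<noteq> 3" "length Z \<noteq> 3"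
      and p: "p = o2 \<and> q = o7 \<and> c = o1 \<or> p = o7 \<and> q = o2 \<and> c = o0"
      and r: "reach (T - {q}) p a1" "reach (T - {q}) p a4" for c X Z p q
  proof -
    let ?U = "{x. reach (T - {q}) p x}" and ?es = "c # X @ v1 # [v2,v3] @ v4 # Z"
    have pT: "p \<in> T - {q}" using o27 p by (auto simp: T_def)
    have U: "?U \<subseteq> T - {q}" using reach_in[OF _ pT] by blast
    have "tripod W ?es c X v1 [v2,v3] v4 Z ?U p a1 a4"
      unfolding tripod_def
    proof (intro conjI ballI impI)
      show "?U \<inter> set ?es = {}" using U TW es(2) by blast
      show "t = p \<or> t = a1 \<or> t = a4" if "t \<in> ?U" "y \<in> set ?es" "E t y" for t y
        using tedge[of t y] that U p es(2) by blast
      show "E p c" using Yo o27 p by blast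
    qed (use U TW es r aW in auto)
    then show False by (rule no_separated_tripod[OF _ conn_set_component[OF pT]]) (use es in simp_all)
  qed
  \<comment> \<open>the feet \<open>o1, v1, v4\<close> and \<open>o0, v1, v4\<close> leave arcs with 2, 2, 1 and 1, 2, 2 inner vertices\<close>
  have part2: False if "reach (T - {o7}) o2 a1" "reach (T - {o7}) o2 a4"
    by (rule part[OF sr(1) _ _ _ _ _ _ that]) (auto simp: ds_def)
  have part7: False if "reach (T - {o2}) o7 a1" "reach (T - {o2}) o7 a4"
    by (rule part[OF sr(2) _ _ _ _ _ _ that]) (auto simp: ds_def)
  have either: "reach (T - {o7}) o2 a \<or> reach (T - {o2}) o7 a" if a: "a \<in> T" for a
  proof -
    obtain R where R: "joins T R a o2" using conn_set_joins[OF cT a, of o2] o27 by (auto simp: T_def)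
    note R' = joinsD[OF R]
    show ?thesis
    proof (cases "o7 \<in> set R")
      case False
      have "reach (set R) a o2" using reach_along_ind_path[of R o2] R' last_in_set[of R] by auto
      then have "reach (T - {o7}) a o2" using R' False by (elim reach_mono) auto
      then show ?thesis using reach_sym by blast
    next
      case True
      obtain R1 R2 where s: "joins T (R1 @ [o7]) a o7" "o2 \<notin> set R1"
        using joins_mem[OF R True] o27 by blast
      have "reach (set (R1 @ [o7])) a o7" using reach_along_ind_path[of "R1 @ [o7]" o7] joinsD[OF s(1)] by auto
      moreover have "set (R1 @ [o7]) \<subseteq> T - {o2}" using joinsD[OF s(1)] s(2) o27 by auto
      ultimately show ?thesis using reach_mono reach_sym by blast
    qed
  qed
  have earI: "ear ds (R @ [p]) c d" if R: "joins T (R @ [p]) a p" "a \<noteq> p" "b \<notin> set R" "b \<noteq> p" "q \<notin> set R" "q \<noteq> p"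
      and sp: "\<And>t y. t \<in> T \<Longrightarrow> y \<in> set ds \<Longrightarrow> E t y \<longleftrightarrow> t = a \<and> y = c \<or> t = p \<and> y = d \<or> t = b \<and> y = c' \<or> t = q \<and> y = d'"
    for R p a b q c d c' d'
    unfolding ear_def
  proof (intro conjI ballI)
    note R' = joinsD[OF R(1)]
    show "ind_path (R @ [p])" "set (R @ [p]) \<inter> set ds = {}" using R' TW by blast+
    show "2 \<le> length (R @ [p])" using R' R(2) by (cases R) auto
    show "E x y \<longleftrightarrow> x = hd (R @ [p]) \<and> y = c \<or> x = last (R @ [p]) \<and> y = d" if "x \<in> set (R @ [p])" "y \<in> set ds" for x y
      using sp[of x y] that R R' by auto
  qed
  have Lset: "set Y \<subseteq> T" by (auto simp: T_def)
  have V: "ind_path [v1,v2,v3,v4]" "set [v1,v2,v3,v4] \<inter> T = {}" 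
    using iP ind_path_append[of "[n0]" "[v1,v2,v3,v4] @ [n1]"] ind_path_append[of "[v1,v2,v3,v4]" "[n1]"] TW unfolding P ds_def by auto
  have Ved: "E v t \<longleftrightarrow> t = a1 \<and> v = hd [v1,v2,v3,v4] \<or> t = a4 \<and> v = last [v1,v2,v3,v4]"
    if "t \<in> T" "v \<in> set [v1,v2,v3,v4]" for t v
  proof -
    have "v \<in> set ds" "v \<noteq> o1" "v \<noteq> o0" using that(2) PC by (auto simp: ds_def P)
    then show ?thesis using tedge[OF that(1), of v] symE[of v t] by auto
  qed
  have aT: "a1 \<in> T" "a4 \<in> T" by (auto simp: T_def)
  have an27: "a1 \<noteq> o2" "a1 \<noteq> o7" "a4 \<noteq> o2" "a4 \<noteq> o7" using aW o27 by auto
  have mixed: False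
    if L: "ind_path L" "L = q # M @ [p]" "set L = set Y" "length L = 6"
      and r: "reach (T - {q}) p a1" "\<not> reach (T - {p}) q a1" "reach (T - {p}) q a4" "\<not> reach (T - {q}) p a4"
      and pq: "p = o2 \<and> q = o7 \<and> c = o1 \<and> d = o0 \<or> p = o7 \<and> q = o2 \<and> c = o0 \<and> d = o1"
      and s: "shortest_cycle W (v1 # X1 @ c # Y1)" "shortest_cycle W (v4 # X2 @ d # Y2)"
        "set (v1 # X1 @ c # Y1) = set ds" "set (v4 # X2 @ d # Y2) = set ds" "length X1 + length Y1 = 6" "length X2 + length Y2 = 6"
        "X1 \<noteq> []" "Y1 \<noteq> []" "X2 \<noteq> []" "Y2 \<noteq> []" "length X1 \<noteq> 3" "length X2 \<noteq> 3" "even (length X1 + length X2)"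
    for L q M p c d X1 Y1 X2 Y2
  proof -
    have LT: "set L \<subseteq> T" "a1 \<notin> set L" "a4 \<notin> set L" using L(3) Lset aW by auto
    obtain R1 R4 where R: "joins T (R1 @ [p]) a1 p" "joins T (R4 @ [q]) a4 q"
      "set R1 \<inter> insert a4 (set L) = {}" "set R4 \<inter> insert a1 (set L) = {}"
      "ind_cycle ([v1,v2,v3,v4] @ R4 @ L @ rev R1)"
      using crossed_routes_hole[OF L(1,2) LT(1) aT LT(2,3) r V(1) _ V(2) Ved] by auto
    have pqL: "p \<in> set L" "q \<in> set L" using L(2) by auto
    have "ear ds (R1 @ [p]) v1 c"
      by (rule earI[OF R(1), of a4 q v1 c v4 d]) (use R(3) an27 o27 tedge pq pqL in auto)
    then have 1: "odd (length (R1 @ [p]) + length X1)"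
      using ear_parity[OF s(1,5) ear_cong] s(3,7,8,11) by metis
    have "ear ds (R4 @ [q]) v4 d"
      by (rule earI[OF R(2), of a1 p v4 d v1 c]) (use R(4) an27 o27 tedge pq pqL in auto)
    then have 2: "odd (length (R4 @ [q]) + length X2)"
      using ear_parity[OF s(2,6) ear_cong] s(4,9,10,12) by metis
    \<comment> \<open>both routes are ears; their arcs have the same parity, hence so do the routes\<close>
    have "even (length R1 + length R4)" using 1 2 s(13) by simp
    then show False using even_hole_length_8[OF R(5)] L(4) by simp
  qed
  have caseA: False if "reach (T - {o7}) o2 a1" "\<not> reach (T - {o2}) o7 a1" "reach (T - {o2}) o7 a4" "\<not> reach (T - {o7}) o2 a4"
    by (rule mixed[OF ind_path_rev[OF iY] _ _ _ that _ sr(3,4)]) (auto simp: Y ds_def)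
  have caseB: False if "reach (T - {o2}) o7 a1" "\<not> reach (T - {o7}) o2 a1" "reach (T - {o7}) o2 a4" "\<not> reach (T - {o2}) o7 a4"
    by (rule mixed[OF iY _ _ _ that _ sr(5,6)]) (auto simp: Y ds_def)
  show False using part2 part7 either[OF aT(1)] either[OF aT(2)] caseA caseB by blast
qed

text \<open>
  The ear replaces the arc \<open>X\<close> by \<open>n0, v, n4\<close> and thus gives a second shortest cycle. The third neighbour of
  \<open>v\<close> leads, by \<open>outer_touch\<close>, to a vertex outside \<open>D\<close> and away from that cycle. If \<open>X\<close> had no neighbour on
  the boundary, the only such vertex would be the middle of \<open>X\<close>, which is then isolated there.
\<close>

lemma arc_has_foot:
  assumes mb: "min_pocket W (c0 # X @ c4 # Y) D" and l: "length X = 3" "length Y = 3"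
    and er: "ear (c0 # X @ c4 # Y) [n0, v, n4] c0 c4" and PW: "{n0, v, n4} \<subseteq> W"
  shows "\<exists>n\<in>W - D - set (c0 # X @ c4 # Y). \<exists>x\<in>set X. E n x"
proof (rule ccontr)
  assume no: "\<not> ?thesis"
  let ?C = "c0 # X @ c4 # Y"
  note f = min_pocketD[OF mb]
  obtain x1 x2 x3 where X: "X = [x1,x2,x3]" using l(1) by (auto simp: length_Suc_conv eval_nat_numeral)
  have iC: "ind_cycle ?C" and dC: "distinct ?C" using shortest_cycle_induced[OF f(1)] f(1) by (auto simp: shortest_cycle_def vcycle_def)
  have PW': "set [n0,v,n4] \<subseteq> W" using PW by simp
  note n = ear_ends[OF mb er PW', simplified]
  have ip: "ind_path [n0,v,n4]" "distinct [n0,v,n4]" "set [n0,v,n4] \<inter> set ?C = {}"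
    using er ind_path_distinct unfolding ear_def by blast+
  have vD: "v \<in> D" using ear_mid[OF mb er PW', of v] ip(2) by auto
  define ds where "ds = c0 # [n0,v,n4] @ c4 # Y"
  have sds: "shortest_cycle W ds"
    unfolding ds_def by (rule shortest_cycle_replace_arc[OF f(1) er]) (use l PW in auto)
  have vds: "v \<in> set ds" by (simp add: ds_def)
  have sub: "probe W ?C D W ds" by (rule probe_self[OF mb sds vD vds])
  have Xds: "set ?C - set ds = set X" using dC ip unfolding ds_def by auto
  have foot: False if u: "u \<in> W - D - set ?C" "u \<notin> set ds" "\<And>c. c \<in> set ds \<Longrightarrow> E u c \<Longrightarrow> c \<notin> set ?C" for u
  proof -
    obtain c where c: "c \<in> set ?C" "E u c" using f(10)[OF u(1)] by blast
    then have "c \<in> set X" using u(3) Xds by blast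
    then show False using no u(1) c(2) by blast
  qed
  obtain a where a: "a \<in> W" "a \<notin> set ds" "E v a"
    using nb_off_shortest_cycle[OF sds vds probe_degree[OF sub vD]] by blast
  have "a \<notin> set ?C" using f(8)[OF vD] a(3) by blast
  have aD: "a \<in> D"
  proof (rule ccontr)
    assume "a \<notin> D"
    moreover have "c \<notin> set ?C" if "c \<in> set ds" "E a c" for c
      using shortest_cycle_unique_nb[OF sds a(1,2) that(1) vds that(2) sym[OF a(3)]] vD f(7) by blast
    ultimately show False using foot[of a] a \<open>a \<notin> set ?C\<close> by blast
  qed
  obtain b where b: "b \<in> W - closed_nb ds" "E a b"
    using nb_outside_closed_nb[OF sds a(1,2) vds sym[OF a(3)] probe_degree[OF sub aD]] by blast
  obtain u where u: "u \<in> W - closed_nb ds - D" "reach (W - closed_nb ds) b u" using outer_touch[OF sub b(1)] by blast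
  have feet_in: False if "w \<in> W - closed_nb ds" "w \<notin> D" "w \<notin> set ?C" for w
    using foot[of w] that unfolding closed_nb_def by blast
  have "u \<in> set ?C" using feet_in[of u] u(1) by blast
  then have "u \<in> set X" using u(1) Xds unfolding closed_nb_def by blast
  moreover have "x1 \<in> closed_nb ds" "x3 \<in> closed_nb ds"
  proof -
    have "E c0 x1" "E x3 c4" using iC ind_cycle_vcycle[OF iC] unfolding vcycle_def X by auto
    then show "x1 \<in> closed_nb ds" "x3 \<in> closed_nb ds" using sym unfolding closed_nb_def ds_def by auto
  qed
  ultimately have ux: "u = x2" using u(1) X by auto
  have "\<not> E x2 w" if w: "w \<in> W - closed_nb ds" for w
  proof
    assume e: "E x2 w"
    have "x2 \<in> set ?C" by (simp add: X)
    then have "w \<notin> D" using f(8) e sym by blast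
    then have "w \<in> set ?C" using feet_in[OF w] by blast
    then have "w \<in> set X" using w Xds unfolding closed_nb_def by blast
    then have "w = x2" using w X \<open>x1 \<in> closed_nb ds\<close> \<open>x3 \<in> closed_nb ds\<close> by auto
    then show False using e irr by blast
  qed
  then have "b = x2" using isolated_reach[OF reach_sym[OF u(2)]] ux by blast
  then show False using b(2) f(8)[OF aD, of x2] X by simp
qed

lemma pocket_tripod:
  assumes mb: "min_pocket W (c1 # X @ c2 # Y @ c3 # Z) D"
    and n: "\<And>n. n \<in> {n1, n2, n3} \<Longrightarrow> n \<in> W - D - set (c1 # X @ c2 # Y @ c3 # Z)"
    and e: "E n1 c1" "E n2 c2" "E n3 c3"
  shows "tripod W (c1 # X @ c2 # Y @ c3 # Z) c1 X c2 Y c3 Z (D \<union> {n1, n2, n3}) n1 n2 n3"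
    and "conn_set (D \<union> {n1, n2, n3})"
proof -
  note f = min_pocketD[OF mb]
  show "tripod W (c1 # X @ c2 # Y @ c3 # Z) c1 X c2 Y c3 Z (D \<union> {n1, n2, n3}) n1 n2 n3"
    unfolding tripod_def
  proof (intro conjI ballI impI)
    show "t = n1 \<or> t = n2 \<or> t = n3" if "t \<in> D \<union> {n1,n2,n3}" "y \<in> set (c1 # X @ c2 # Y @ c3 # Z)" "E t y" for t y
      using f(8) that by blast
    show "D \<union> {n1, n2, n3} \<subseteq> W" using f(2) n by blast
    show "(D \<union> {n1, n2, n3}) \<inter> set (c1 # X @ c2 # Y @ c3 # Z) = {}" using f(7) n by blast
  qed (use f e in auto)
  show "conn_set (D \<union> {n1, n2, n3})" by (rule conn_set_attach[OF f(3,4)]) (use f(9) n in blast)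
qed

text \<open>
  By \<open>arc_has_foot\<close>, both arcs contain feet \<open>x\<close> and \<open>y\<close> of boundary vertices \<open>ni\<close> and \<open>nk\<close>. The tripod at \<open>c0\<close>,
  \<open>x\<close>, \<open>y\<close> contains an exceptional ear; with six-vertex ears excluded, it is a second ear \<open>ni, w, nk\<close> with
  three vertices, between another pair of opposite vertices. Exchanging \<open>X\<close> for the first ear turns the
  second ear, prolonged along \<open>X\<close>, into an ear of the new cycle whose parity is wrong.
\<close>

lemma no_three_ear:
  assumes mb: "min_pocket W (c0 # X @ c4 # Y) D" and l: "length X = 3" "length Y = 3"
    and er: "ear (c0 # X @ c4 # Y) P c0 c4" and lP: "length P = 3" and PW: "set P \<subseteq> W"
  shows False
proof -
  let ?C = "c0 # X @ c4 # Y"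
  note f = min_pocketD[OF mb]
  obtain n0 v n4 where P: "P = [n0, v, n4]" using lP by (auto simp: length_Suc_conv eval_nat_numeral)
  have iC: "ind_cycle ?C" and dC: "distinct ?C" using shortest_cycle_induced[OF f(1)] f(1) by (auto simp: shortest_cycle_def vcycle_def)
  obtain x1 x2 x3 where X: "X = [x1,x2,x3]" using l(1) by (auto simp: length_Suc_conv eval_nat_numeral)
  obtain y1 y2 y3 where Y: "Y = [y1,y2,y3]" using l(2) by (auto simp: length_Suc_conv eval_nat_numeral)
  note n = ear_ends[OF mb er PW, unfolded P, simplified]
  have ip: "ind_path P" "distinct P" "set P \<inter> set ?C = {}"
    using er ind_path_distinct unfolding ear_def by blast+
  have vD: "v \<in> D" using ear_mid[OF mb er PW, of v] ip(2) P by auto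
  obtain ni x where ni: "ni \<in> W - D - set ?C" "x \<in> set X" "E ni x"
    using arc_has_foot[OF mb l, of n0 v n4] er PW P by auto
  have mb': "min_pocket W (c4 # Y @ c0 # X) D" using min_pocket_cong[OF mb shortest_cycle_rot[OF f(1)]] by auto
  have "ear (c4 # Y @ c0 # X) (rev P) c4 c0" using ear_rev[OF er] by (rule ear_cong) auto
  then obtain nk y where nk: "nk \<in> W - D - set ?C" "y \<in> set Y" "E nk y"
    using arc_has_foot[OF mb' l(2,1), of n4 v n0] PW P by auto
  obtain X1 X2 where xs: "X = X1 @ x # X2" using split_list[OF ni(2)] by blast
  obtain Y1 Y2 where ys: "Y = Y1 @ y # Y2" using split_list[OF nk(2)] by blast
  have C: "?C = c0 # X1 @ x # (X2 @ c4 # Y1) @ y # Y2" using xs ys by simp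
  have mb2: "min_pocket W (c0 # X1 @ x # (X2 @ c4 # Y1) @ y # Y2) D" using mb C by simp
  define T where "T = D \<union> {n0, ni, nk}"
  have L: "tripod W (c0 # X1 @ x # (X2 @ c4 # Y1) @ y # Y2) c0 X1 x (X2 @ c4 # Y1) y Y2 T n0 ni nk" and cT: "conn_set T"
  proof -
    have "m \<in> W - D - set ?C" if "m \<in> {n0, ni, nk}" for m
      using that ni(1) nk(1) ear_ends[OF mb er PW] P by auto
    note fe = this[unfolded C]
    show "tripod W (c0 # X1 @ x # (X2 @ c4 # Y1) @ y # Y2) c0 X1 x (X2 @ c4 # Y1) y Y2 T n0 ni nk" "conn_set T"
      unfolding T_def using pocket_tripod[OF mb2 fe n(1) ni(3) nk(3)] by blast+
  qed
  obtain L2 where L2: "tripod W L2 x (X2 @ c4 # Y1) y Y2 c0 X1 T ni nk n0" using tripod_rot[OF L] by blast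
  obtain L3 where L3: "tripod W L3 y Y2 c0 X1 x (X2 @ c4 # Y1) T nk n0 ni" using tripod_rot[OF L2] by blast
  have TW: "T \<subseteq> W" using L by (simp add: tripod_def)
  have len: "length X1 + length X2 = 2" "length Y1 + length Y2 = 2" using l xs ys by simp_all
  \<comment> \<open>the exceptional ear of the tripod joins \<open>ni\<close> and \<open>nk\<close>\<close>
  obtain R where R: "joins T R ni nk" "n0 \<notin> set R" "length X2 + length Y1 = 2" "length R = 3"
  proof -
    have 1: False if r: "joins T R n0 ni" "nk \<notin> set R" "exceptional R X1" for R
    proof -
      have "X1 = []" "length R = 6" using r(3) len by (auto simp: exceptional_def)
      moreover have "ear (c0 # X1 @ x # (X2 @ c4 # Y1) @ y # Y2) R c0 x" by (rule tripod_ear[OF L r(1,2)])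
      moreover have "set R \<subseteq> W" using joinsD[OF r(1)] TW by blast
      ultimately show False using no_six_ear[of W c0 x "(X2 @ c4 # Y1) @ y # Y2" D R] mb2 len by simp
    qed
    have 3: False if r: "joins T R nk n0" "ni \<notin> set R" "exceptional R Y2" for R
    proof -
      have "Y2 = []" "length R = 6" using r(3) len by (auto simp: exceptional_def)
      moreover have "ear L3 R y c0" by (rule tripod_ear[OF L3 r(1,2)])
      moreover have "set R \<subseteq> W" using joinsD[OF r(1)] TW by blast
      moreover have L3e: "L3 = y # Y2 @ c0 # X1 @ x # (X2 @ c4 # Y1)" and s3: "shortest_cycle W L3" using L3 unfolding tripod_def by blast+
      moreover have "min_pocket W L3 D" by (rule min_pocket_cong[OF mb2 s3]) (auto simp: L3e)
      ultimately show False using no_six_ear[of W y c0 "X1 @ x # (X2 @ c4 # Y1)" D R] len by simp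
    qed
    have "length (c0 # X1 @ x # (X2 @ c4 # Y1) @ y # Y2) = 8" using len by simp
    from tripod_exceptional_ear[OF L this cT] obtain R where "joins T R ni nk" "n0 \<notin> set R" "exceptional R (X2 @ c4 # Y1)" using 1 3 by blast
    then show thesis using that[of R] by (auto simp: exceptional_def)
  qed
  obtain n1' w n2' where R3: "R = [n1', w, n2']" using R(4) by (auto simp: length_Suc_conv eval_nat_numeral)
  have R': "R = [ni, w, nk]" using joinsD[OF R(1)] R3 by auto
  have iR: "ind_path [ni, w, nk]" using joinsD[OF R(1)] R' by auto
  then have Rd: "distinct [ni,w,nk]" using ind_path_distinct by blast
  have wD: "w \<in> D" using joinsD[OF R(1)] R(2) Rd R' unfolding T_def by auto
  have Rw: "E ni w" "E w nk" "\<not> E ni nk" using iR by auto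
  \<comment> \<open>the first ear takes the place of \<open>X\<close>\<close>
  define ds where "ds = c0 # [n0,v,n4] @ c4 # Y"
  have sds: "shortest_cycle W ds" using shortest_cycle_replace_arc[OF f(1) er] lP l PW P unfolding ds_def by auto
  have nn: "n0 \<notin> D" "n4 \<notin> D" "ni \<notin> D" "nk \<notin> D" using n ni nk by auto
  have fo: "E n0 z \<longleftrightarrow> z = c0" "E n4 z \<longleftrightarrow> z = c4" "E ni z \<longleftrightarrow> z = x" "E nk z \<longleftrightarrow> z = y" if "z \<in> set ?C" for z
    using boundary_foot_unique[OF mb _ _ _ _ that] n ni nk xs ys by auto
  have xy: "x \<in> set ?C" "y \<in> set ?C" "x \<noteq> c0" "x \<noteq> c4" "y \<noteq> c0" "y \<noteq> c4" "x \<notin> set Y" "y \<notin> set X" using dC ni(2) nk(2) by auto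
  have ne: "ni \<noteq> n0" "ni \<noteq> n4" "nk \<noteq> n0" "nk \<noteq> n4"
    using fo[of c0] fo[of c4] fo(3)[of x] fo(4)[of y] n(1,2) xy by auto
  have out: "ni \<notin> set ds" "nk \<notin> set ds" using ne nn vD ni nk unfolding ds_def by auto
  have yds: "y \<in> set ds" "c0 \<in> set ds" "c4 \<in> set ds" "v \<in> set ds" using nk(2) by (auto simp: ds_def)
  have nkds: "E nk z \<longleftrightarrow> z = y" if "z \<in> set ds" for z
    using shortest_cycle_unique_nb[OF sds _ out(2) that yds(1)] nk by blast
  have "w \<noteq> v" using nkds[OF yds(4)] Rw(2) sym nk(2) f(7) vD by auto
  then have wout: "w \<notin> set ds" using wD nn f(7) unfolding ds_def by auto
  have wds: "\<not> E w z" if "z \<in> set ds" for z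
    using shortest_cycle_nb_stable[OF sds _ wout _ out(2) that yds(1), of] wD f(2) nk Rw(2) by blast
  have Xout: "z \<notin> set ds" "z \<in> W" "z \<noteq> ni" "z \<noteq> nk" "z \<noteq> w" "z \<notin> D" if "z \<in> set X" for z
    using that dC ip(3) P ni nk f(6,7) wD unfolding ds_def by auto
  have cC: "E c0 x1" "E x1 x2" "E x2 x3" "E x3 c4" using ind_cycle_vcycle[OF iC] unfolding vcycle_def X by auto
  have xds: "E x1 z \<longleftrightarrow> z = c0" "E x3 z \<longleftrightarrow> z = c4" if "z \<in> set ds" for z
    using shortest_cycle_unique_nb[OF sds Xout(2,1) that yds(2), of x1] shortest_cycle_unique_nb[OF sds Xout(2,1) that yds(3), of x3] cC sym X by auto
  have nids: "\<not> E ni z" if "x = x1 \<or> x = x3" "z \<in> set ds" for z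
    using shortest_cycle_nb_stable[OF sds _ out(1) _ Xout(1), of x z c0] shortest_cycle_nb_stable[OF sds _ out(1) _ Xout(1), of x z c4] that yds ni Xout(2) cC sym
    by blast
  have nw: "\<not> E z w" "\<not> E w z" if "z \<in> set ?C" for z using f(8)[OF wD that] sym by blast+
  \<comment> \<open>\<open>x\<close> and \<open>y\<close> are opposite\<close>
  have lenX1: "length X1 = length Y1" using R(3) len by simp
  have XC: "z \<in> set ?C" if "z \<in> set X" for z using that by auto
  have "length X1 = 0 \<or> length X1 = 1 \<or> length X1 = 2" using len by arith
  then consider "X1 = []" "Y1 = []" | "length X1 = 1" "length Y1 = 1" | "length X1 = 2" "length Y1 = 2"
    using lenX1 by (metis length_0_conv)
  then show False
  proof cases
    case 1
    then have xx: "x = x1" "y = y1" using xs ys X Y by auto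
    have Q: "ear ds [x1, ni, w, nk] c0 y1"
      unfolding ear_def
    proof (intro conjI ballI)
      show "ind_path [x1, ni, w, nk]"
        using Rw Rd ni(3) xx sym[OF ni(3)] Xout[of x1] X nw(1)[of x1] fo(4)[of x1] symE[of x1 nk] xy(8) by auto
      show "set [x1, ni, w, nk] \<inter> set ds = {}" using out wout Xout(1)[of x1] X by auto
      show "E p z \<longleftrightarrow> p = hd [x1, ni, w, nk] \<and> z = c0 \<or> p = last [x1, ni, w, nk] \<and> z = y1"
        if "p \<in> set [x1, ni, w, nk]" "z \<in> set ds" for p z
        using that xds(1)[of z] nids[of z] wds[of z] nkds[of z] xx Rd Xout(3,4)[of x1] X by auto
    qed simp
    have "shortest_cycle W (c0 # [n0,v,n4,c4] @ y1 # [y2,y3])" using sds by (simp add: ds_def Y)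
    from ear_parity[OF this, of "[x1,ni,w,nk]"] show False using Q by (simp add: ds_def Y)
  next
    case 2
    then have xx: "x = x2" "y = y2" using xs ys X Y by (auto simp: length_Suc_conv)
    have niv: "\<not> E ni v"
    proof
      assume e: "E ni v"
      have "vcycle [v, n0, c0, x1, x2, ni]"
        using e ip P n(1) cC sym ni(3) xx dC X ne vD nn f(7) ni(1) unfolding vcycle_def by auto
      from girth[OF this] show False by simp
    qed
    have nn0: "\<not> E ni n0" "\<not> E ni n4"
      using shortest_cycle_nb_stable[OF f(1) _ _ _ _ xy(1), of ni n0 c0] shortest_cycle_nb_stable[OF f(1) _ _ _ _ xy(1), of ni n4 c4] ni n by auto
    have ni2: "\<not> E ni z" if "z \<in> set ds" for z
      using that niv nn0 fo(3)[of z] xy xx unfolding ds_def by auto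
    have x2C: "E x2 z \<longleftrightarrow> z = x1 \<or> z = x3" if "z \<in> set ?C" for z
    proof -
      have "ind_cycle ((x2 # x3 # c4 # Y @ [c0]) @ [x1])" using ind_cycle_swap[of "[c0,x1]" "x2 # x3 # c4 # Y"] ind_cycle_swap[of "[c0]" "x1 # x2 # x3 # c4 # Y"] ind_cycle_swap[of "[x1]" "x2 # x3 # c4 # Y @ [c0]"] iC X by simp
      then have "\<forall>z\<in>set (x3 # c4 # Y @ [c0, x1]). E x2 z \<longleftrightarrow> z = x3 \<or> z = x1" unfolding ind_cycle_def by simp
      then show ?thesis using that irr[of x2] X dC by auto
    qed
    have x2ds: "\<not> E x2 z" if z: "z \<in> set ds" for z
    proof -
      have "x2 \<in> set ?C" by (simp add: X)
      then have "\<not> E x2 n0" "\<not> E x2 n4" "\<not> E x2 v" 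
        using fo(1,2)[of x2] f(8)[OF vD, of x2] symE dC X by auto
      then show ?thesis using z x2C[of z] dC X unfolding ds_def by auto
    qed
    have Q: "ear ds [x1, x2, ni, w, nk] c0 y2"
      unfolding ear_def
    proof (intro conjI ballI)
      show "ind_path [x1, x2, ni, w, nk]"
        using Rw Rd ni(3) xx sym[OF ni(3)] Xout(3,4,5)[of x1] Xout(3,4,5)[of x2] X nw(1)[of x1] nw(1)[of x2] fo(4)[of x1] fo(4)[of x2] 
          symE[of x1 nk] symE[of x2 nk] symE[of x1 ni] fo(3)[of x1] xy(8) cC dC by auto
      show "set [x1, x2, ni, w, nk] \<inter> set ds = {}" using out wout Xout(1)[of x1] Xout(1)[of x2] X by auto
      show "E p z \<longleftrightarrow> p = hd [x1, x2, ni, w, nk] \<and> z = c0 \<or> p = last [x1, x2, ni, w, nk] \<and> z = y2"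
        if "p \<in> set [x1, x2, ni, w, nk]" "z \<in> set ds" for p z
        using that xds(1)[of z] ni2[of z] x2ds[of z] wds[of z] nkds[of z] xx Rd dC Xout(3,4,5)[of x1] Xout(3,4,5)[of x2] X by auto
    qed simp
    have "shortest_cycle W (c0 # [n0,v,n4,c4,y1] @ y2 # [y3])" using sds by (simp add: ds_def Y)
    from ear_parity[OF this, of "[x1,x2,ni,w,nk]"] show False using Q by (simp add: ds_def Y)
  next
    case 3
    then have xx: "x = x3" "y = y3" using xs ys X Y by (auto simp: length_Suc_conv eval_nat_numeral)
    have Q: "ear ds [x3, ni, w, nk] c4 y3"
      unfolding ear_def
    proof (intro conjI ballI)
      show "ind_path [x3, ni, w, nk]"
        using Rw Rd ni(3) xx sym[OF ni(3)] Xout[of x3] X nw(1)[of x3] fo(4)[of x3] symE[of x3 nk] xy(8) by auto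
      show "set [x3, ni, w, nk] \<inter> set ds = {}" using out wout Xout(1)[of x3] X by auto
      show "E p z \<longleftrightarrow> p = hd [x3, ni, w, nk] \<and> z = c4 \<or> p = last [x3, ni, w, nk] \<and> z = y3"
        if "p \<in> set [x3, ni, w, nk]" "z \<in> set ds" for p z
        using that xds(2)[of z] nids[of z] wds[of z] nkds[of z] xx Rd Xout(3,4)[of x3] X by auto
    qed simp
    have s: "shortest_cycle W (c4 # [y1,y2] @ y3 # [c0,n0,v,n4])" using sds shortest_cycle_swap[of W "[c0,n0,v,n4]" "[c4,y1,y2,y3]"] by (simp add: ds_def Y)
    have "ear (c4 # [y1,y2] @ y3 # [c0,n0,v,n4]) [x3,ni,w,nk] c4 y3" using Q by (rule ear_cong) (auto simp: ds_def Y)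
    from ear_parity[OF s _ this] show False by simp
  qed
qed

lemma no_exceptional_ear:
  assumes "min_pocket W (c # X @ d # Y) D" "length X + length Y = 6" "ear (c # X @ d # Y) P c d" "set P \<subseteq> W" "exceptional P X"
  shows False
  using assms(5) unfolding exceptional_def
proof
  assume "X = [] \<and> length P = 6"
  then show False using no_six_ear[of W c d Y D P] assms by simp
next
  assume "length X = 3 \<and> length P = 3"
  then show False using no_three_ear[OF assms(1) _ _ assms(3) _ assms(4)] assms(2) by simp
qed

section \<open>The pocket hangs on a short arc\<close>

text \<open>
  Any two attachments of the connected set \<open>D\<close> give an ear, so on an odd cycle they are adjacent.
\<close>

lemma odd_feet_adjacent:
  assumes mb: "min_pocket W (c # X @ d # Y) D" and o: "odd (length X + length Y)"
    and n: "n \<in> W - D - set (c # X @ d # Y)" "m \<in> W - D - set (c # X @ d # Y)" "E n c" "E m d" and XY: "X \<noteq> []" "Y \<noteq> []"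
  shows False
proof -
  let ?C = "c # X @ d # Y"
  note f = min_pocketD[OF mb]
  have "distinct ?C" using f(1) by (simp add: shortest_cycle_def vcycle_def)
  then have cd: "c \<noteq> d" by simp
  have fo: "E n y \<longleftrightarrow> y = c" "E m y \<longleftrightarrow> y = d" if "y \<in> set ?C" for y
    using boundary_foot_unique[OF mb _ _ _ n(3) that] boundary_foot_unique[OF mb _ _ _ n(4) that] n by auto
  have nm: "n \<noteq> m" using fo(1)[of d] n(4) cd by auto
  have "conn_set (D \<union> {n, m})" by (rule conn_set_attach[OF f(3,4)]) (use f(9) n in blast)
  then obtain P where P: "joins (D \<union> {n, m}) P n m" using conn_set_joins by blast
  note P' = joinsD[OF P]
  have PW: "set P \<subseteq> W" using P' f(2) n by blast
  have "ear ?C P c d"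
    unfolding ear_def
  proof (intro conjI ballI)
    show "2 \<le> length P" using P' nm by (cases P; cases "tl P") auto
    show "set P \<inter> set ?C = {}" using P' n f(7) by blast
    show "E p y \<longleftrightarrow> p = hd P \<and> y = c \<or> p = last P \<and> y = d" if "p \<in> set P" "y \<in> set ?C" for p y
    proof -
      have "p \<in> D \<or> p = n \<or> p = m" using that(1) P' by blast
      then show ?thesis
      proof (elim disjE)
        assume "p \<in> D"
        then have "\<not> E p y" "p \<noteq> n" "p \<noteq> m" using f(8)[OF _ that(2)] n by auto
        then show ?thesis using P' by simp
      qed (use fo[OF that(2)] nm P' in auto)
    qed
  qed (use P' in blast)
  then show False using ear_odd[OF f(1) o _ PW XY] by blast
qed

text \<open>
  The pocket with one boundary vertex for each foot is a tripod. On an odd cycle any two feet are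
  adjacent, and three such feet would form a triangle.
\<close>

lemma no_three_feet:
  assumes mb: "min_pocket W (c1 # X @ c2 # Y @ c3 # Z) D"
    and n: "\<And>n. n \<in> {n1, n2, n3} \<Longrightarrow> n \<in> W - D - set (c1 # X @ c2 # Y @ c3 # Z)"
    and e: "E n1 c1" "E n2 c2" "E n3 c3"
  shows False
proof -
  let ?C = "c1 # X @ c2 # Y @ c3 # Z"
  note f = min_pocketD[OF mb]
  have s1: "shortest_cycle W (c1 # X @ c2 # (Y @ c3 # Z))" using f(1) by simp
  have s2: "shortest_cycle W (c2 # Y @ c3 # (Z @ c1 # X))" using shortest_cycle_rot[OF s1] by simp
  have s3: "shortest_cycle W (c3 # Z @ c1 # (X @ c2 # Y))" using shortest_cycle_rot[OF s2] by simp
  have m2: "min_pocket W (c2 # Y @ c3 # (Z @ c1 # X)) D" by (rule min_pocket_cong[OF mb s2]) auto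
  have m3: "min_pocket W (c3 # Z @ c1 # (X @ c2 # Y)) D" by (rule min_pocket_cong[OF mb s3]) auto
  show False
  proof (cases "even (length ?C)")
    case True
    then have l8: "length ?C = 8" using shortest_cycle_length(2)[OF f(1)] by blast
    note L = pocket_tripod[OF mb n e]
    obtain L2 where L2: "tripod W L2 c2 Y c3 Z c1 X (D \<union> {n1, n2, n3}) n2 n3 n1" using tripod_rot[OF L(1)] by blast
    obtain L3 where L3: "tripod W L3 c3 Z c1 X c2 Y (D \<union> {n1, n2, n3}) n3 n1 n2" using tripod_rot[OF L2] by blast
    have TW: "D \<union> {n1, n2, n3} \<subseteq> W" using L(1) unfolding tripod_def by blast
    have l2: "L2 = c2 # Y @ c3 # (Z @ c1 # X)" using L2 unfolding tripod_def by simp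
    have l3: "L3 = c3 # Z @ c1 # (X @ c2 # Y)" using L3 unfolding tripod_def by simp
    have W: "set P \<subseteq> W" if "joins (D \<union> {n1, n2, n3}) P a b" for P a b using joinsD[OF that] TW by blast
    obtain P where "joins (D \<union> {n1, n2, n3}) P n1 n2 \<and> n3 \<notin> set P \<and> exceptional P X \<or>
       joins (D \<union> {n1, n2, n3}) P n2 n3 \<and> n1 \<notin> set P \<and> exceptional P Y \<or> joins (D \<union> {n1, n2, n3}) P n3 n1 \<and> n2 \<notin> set P \<and> exceptional P Z"
      using tripod_exceptional_ear[OF L(1) l8 L(2)] by blast
    then show False
    proof (elim disjE conjE)
      assume j: "joins (D \<union> {n1, n2, n3}) P n1 n2" "n3 \<notin> set P" "exceptional P X"
      show False by (rule no_exceptional_ear[of W c1 X c2 "Y @ c3 # Z" D P]) (use mb tripod_ear[OF L(1) j(1,2)] W[OF j(1)] j(3) l8 in auto)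
    next
      assume j: "joins (D \<union> {n1, n2, n3}) P n2 n3" "n1 \<notin> set P" "exceptional P Y"
      show False by (rule no_exceptional_ear[OF m2]) (use tripod_ear[OF L2 j(1,2)] W[OF j(1)] j(3) l8 l2 in auto)
    next
      assume j: "joins (D \<union> {n1, n2, n3}) P n3 n1" "n2 \<notin> set P" "exceptional P Z"
      show False by (rule no_exceptional_ear[OF m3]) (use tripod_ear[OF L3 j(1,2)] W[OF j(1)] j(3) l8 l3 in auto)
    qed
  next
    case False
    then have o: "odd (length X + length (Y @ c3 # Z))" "odd (length Y + length (Z @ c1 # X))" "odd (length Z + length (X @ c2 # Y))"
      by auto
    have n': "n1 \<in> W - D - set ?C" "n2 \<in> W - D - set ?C" "n3 \<in> W - D - set ?C" using n by blast+
    have "X = []" using odd_feet_adjacent[of W c1 X c2 "Y @ c3 # Z" D n1 n2] mb o(1) n' e by auto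
    moreover have "Y = []" using odd_feet_adjacent[OF m2 o(2), of n2 n3] n' e by auto
    moreover have "Z = []" using odd_feet_adjacent[OF m3 o(3), of n3 n1] n' e by auto
    ultimately show False using shortest_cycle_length(1)[OF f(1)] by simp
  qed
qed

text \<open>
  An arc of the cycle that carries all attachments of the pocket at its ends. The last condition is
  what remains of the parity of ears when the rest of the cycle is forgotten: if the ends differ, every
  induced cycle formed by \<open>Q\<close> and vertices off \<open>cs\<close> is odd.
\<close>

definition handle :: "'a set \<Rightarrow> 'a list \<Rightarrow> 'a set \<Rightarrow> 'a list \<Rightarrow> bool" where
  "handle W cs D Q \<longleftrightarrow> Q \<noteq> [] \<and> ind_path Q \<and> set Q \<subseteq> set cs \<and> length Q \<le> 5 \<and>
     (\<forall>n\<in>W - D - set cs. E n (hd Q) \<or> E n (last Q)) \<and>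
     (\<forall>P. 2 \<le> length Q \<longrightarrow> ind_cycle (Q @ P) \<longrightarrow> set P \<subseteq> W - set cs \<longrightarrow> odd (length Q + length P))"

text \<open>
  On a cycle of length \<open>8\<close> the shorter arc between the two feet has at most three inner vertices. On an
  odd cycle the feet are adjacent, so that this arc has none.
\<close>

lemma handle_two:
  assumes mb: "min_pocket W (c # X @ d # Y) D" and le: "length X \<le> length Y"
    and n: "n \<in> W - D - set (c # X @ d # Y)" "m \<in> W - D - set (c # X @ d # Y)" "E n c" "E m d"
  shows "handle W (c # X @ d # Y) D (c # X @ [d])"
proof -
  let ?C = "c # X @ d # Y" and ?Q = "c # X @ [d]"
  note f = min_pocketD[OF mb]
  have l: "8 \<le> length ?C" using shortest_cycle_length(1)[OF f(1)] .
  have Y: "Y \<noteq> []" using l le by auto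
  have iC: "ind_cycle (?Q @ Y)" using shortest_cycle_induced[OF f(1)] by simp
  have iQ: "ind_path ?Q" using ind_cycle_append[of ?Q Y] iC Y by blast
  have feet: "e = c \<or> e = d" if k: "k \<in> W - D - set ?C" "e \<in> set ?C" "E k e" for k e
  proof (rule ccontr)
    assume "\<not> ?thesis"
    then have "e \<in> set X \<or> e \<in> set Y" using k(2) by auto
    then show False
    proof
      assume "e \<in> set X"
      then obtain X1 X2 where X: "X = X1 @ e # X2" using split_list by metis
      have m': "min_pocket W (c # X1 @ e # X2 @ d # Y) D" using mb X by simp
      show False by (rule no_three_feet[OF m', of n k m]) (use n k X in auto)
    next
      assume "e \<in> set Y"
      then obtain Y1 Y2 where Y: "Y = Y1 @ e # Y2" using split_list by metis
      have m': "min_pocket W (c # X @ d # Y1 @ e # Y2) D" using mb Y by simp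
      show False by (rule no_three_feet[OF m', of n m k]) (use n k Y in auto)
    qed
  qed
  have odd_X: "X = []" if "odd (length ?C)"
    using odd_feet_adjacent[OF mb _ n _ Y] that by auto
  have len: "length ?Q \<le> 5"
  proof (cases "even (length ?C)")
    case True
    then have "length ?C = 8" using shortest_cycle_length(2)[OF f(1)] by blast
    then show ?thesis using le by simp
  qed (use odd_X in simp)
  \<comment> \<open>an even cycle has length \<open>8\<close>, and then \<open>P\<close> is an ear with the wrong parity\<close>
  have par: "odd (length ?Q + length P)" if P: "ind_cycle (?Q @ P)" "set P \<subseteq> W - set ?C" for P
  proof
    assume ev: "even (length ?Q + length P)"
    have g: "length ?Q + length P = 8" using even_hole_length_8[OF P(1)] ev by simp
    have "P \<noteq> []" using g len by auto
    then have ic: "ind_path P" "\<And>x y. x \<in> set ?Q \<Longrightarrow> y \<in> set P \<Longrightarrow> E x y \<longleftrightarrow> x = d \<and> y = hd P \<or> x = c \<and> y = last P"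
      using P(1) ind_cycle_append[of ?Q P] by auto
    have "ear ?C (rev P) c d"
      unfolding ear_def
    proof (intro conjI ballI)
      show "ind_path (rev P)" using ic(1) by (rule ind_path_rev)
      show "2 \<le> length (rev P)" using g len by simp
      show "set (rev P) \<inter> set ?C = {}" using P(2) by auto
      show "E p y \<longleftrightarrow> p = hd (rev P) \<and> y = c \<or> p = last (rev P) \<and> y = d" if "p \<in> set (rev P)" "y \<in> set ?C" for p y
      proof (cases "y = c \<or> y = d")
        case True
        then have "E y p \<longleftrightarrow> y = d \<and> p = hd P \<or> y = c \<and> p = last P" using ic(2)[of y p] that by auto
        then show ?thesis using symE[of p y] \<open>P \<noteq> []\<close> by (auto simp: hd_rev last_rev)
      next
        case False
        have "\<not> E p y"
        proof
          assume "E p y"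
          moreover from this have "p \<notin> D" using f(8) that(2) by blast
          ultimately show False using feet[of p y] False that P(2) by auto
        qed
        then show ?thesis using False by simp
      qed
    qed
    note er = this
    have PW: "set (rev P) \<subseteq> W" using P(2) by auto
    show False
    proof (cases "even (length ?C)")
      case True
      then have l8: "length X + length Y = 6" using shortest_cycle_length(2)[OF f(1)] by simp
      have "even (length (rev P) + length X)" using ev by auto
      then have "exceptional (rev P) X" using ear_parity[OF f(1) l8 er] Y unfolding exceptional_def by auto
      then show False using no_exceptional_ear[OF mb l8 er PW] by blast
    next
      case False
      have "set (?Q @ P) \<subseteq> W" using P(2) f(6) by auto
      then have "length ?C \<le> 8" using shortest_cycle_le[OF f(1) ind_cycle_vcycle[OF P(1)]] g by simp
      then show False using l False by (metis even_numeral le_antisym)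
    qed
  qed
  have ft: "E k (hd ?Q) \<or> E k (last ?Q)" if k: "k \<in> W - D - set ?C" for k
  proof -
    obtain e where "e \<in> set ?C" "E k e" using f(10)[OF k] by blast
    then show ?thesis using feet[OF k] by auto
  qed
  show ?thesis unfolding handle_def using iQ len par ft by auto
qed

lemma handle_exists:
  assumes mb: "min_pocket W cs D" shows "\<exists>Q. handle W cs D Q"
proof -
  note f = min_pocketD[OF mb]
  show ?thesis
  proof (cases "\<exists>n m c d. n \<in> W - D - set cs \<and> m \<in> W - D - set cs \<and> c \<in> set cs \<and> d \<in> set cs \<and> E n c \<and> E m d \<and> c \<noteq> d")
    case True
    then obtain n m c d where n: "n \<in> W - D - set cs" "m \<in> W - D - set cs" "c \<in> set cs" "d \<in> set cs" "E n c" "E m d" "c \<noteq> d"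
      by blast
    obtain X Y where s: "shortest_cycle W (c # X @ d # Y)" "set (c # X @ d # Y) = set cs"
      using shortest_cycle_split[OF f(1) n(3,4,7)] by metis
    have hc: "handle W ds D Q \<Longrightarrow> set ds = set cs \<Longrightarrow> handle W cs D Q" for ds Q by (simp add: handle_def)
    show ?thesis
    proof (cases "length X \<le> length Y")
      case True
      have "handle W (c # X @ d # Y) D (c # X @ [d])"
        by (rule handle_two[OF min_pocket_cong[OF mb s] True, of n m]) (use n s(2) in simp_all)
      then show ?thesis using hc s(2) by blast
    next
      case False
      have s': "shortest_cycle W (d # Y @ c # X)" "set (d # Y @ c # X) = set cs" using shortest_cycle_rot[OF s(1)] s(2) by auto
      have "handle W (d # Y @ c # X) D (d # Y @ [c])"
        by (rule handle_two[OF min_pocket_cong[OF mb s'], of m n]) (use n s' False in simp_all)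
      then show ?thesis using hc s'(2) by blast
    qed
  next
    case False
    have "set cs \<noteq> {}" using f(1) by (auto simp: shortest_cycle_def vcycle_def)
    then obtain c where c: "c \<in> set cs" "\<forall>n\<in>W - D - set cs. E n c"
      using False f(10) by (metis ex_in_conv)
    then have "handle W cs D [c]" unfolding handle_def by auto
    then show ?thesis by blast
  qed
qed

section \<open>A shortest cycle through the pocket and its handle\<close>

lemma boundary_stable:
  assumes "min_pocket W cs D" "n \<in> W - D - set cs" "m \<in> W - D - set cs"
  shows "\<not> E n m"
proof -
  note f = min_pocketD[OF assms(1)]
  obtain c d where "c \<in> set cs" "d \<in> set cs" "E n c" "E m d" using f(10) assms(2,3) by blast
  then show ?thesis using shortest_cycle_nb_stable[OF f(1)] assms(2,3) by blast
qed

text \<open>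
  Two boundary neighbours with the same foot close a \<open>4\<close>-cycle. With different feet they form, with \<open>v\<close>
  and the handle, an induced cycle with at most \<open>8\<close> vertices that contains the handle; it is odd, which
  contradicts the girth.
\<close>

lemma boundary_nb_unique:
  assumes mb: "min_pocket W cs D" and Q: "handle W cs D Q" and v: "v \<in> D"
    and n: "n \<in> W - D - set cs" "m \<in> W - D - set cs" "E v n" "E v m"
  shows "n = m"
proof (rule ccontr)
  assume nm: "n \<noteq> m"
  note f = min_pocketD[OF mb]
  have Qn: "Q \<noteq> []" "ind_path Q" "set Q \<subseteq> set cs" "length Q \<le> 5" using Q unfolding handle_def by blast+
  have QE: "E n (hd Q) \<or> E n (last Q)" "E m (hd Q) \<or> E m (last Q)" using Q n(1,2) unfolding handle_def by blast+
  have hl: "hd Q \<in> set Q" "last Q \<in> set Q" using Qn by auto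
  have same: False if "c \<in> set Q" "E n c" "E m c" for c
  proof -
    have "c \<in> set cs" using that(1) Qn by blast
    then have "c \<noteq> n" "c \<noteq> m" "c \<noteq> v" "v \<noteq> n" "v \<noteq> m" using n f(7) v by auto
    then have "vcycle [v, n, c, m]" using n that nm sym[OF that(3)] sym[OF n(4)] unfolding vcycle_def by auto
    from girth[OF this] show False by simp
  qed
  \<comment> \<open>the cycle \<open>Q @ [m, v, n]\<close> is odd and has at most \<open>8\<close> vertices\<close>
  have diff: False if nm: "n \<in> W - D - set cs" "m \<in> W - D - set cs" "E v n" "E v m" "E n (hd Q)" "E m (last Q)" "hd Q \<noteq> last Q" "n \<noteq> m" for n m
  proof -
    have hlc: "hd Q \<in> set cs" "last Q \<in> set cs" using hl Qn(3) by blast+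
    have fo: "E n y \<longleftrightarrow> y = hd Q" "E m y \<longleftrightarrow> y = last Q" if "y \<in> set Q" for y
      using boundary_foot_unique[OF mb _ _ _ nm(5), of y] boundary_foot_unique[OF mb _ _ _ nm(6), of y] nm(1,2) hlc Qn(3) that by blast+
    have "2 \<le> length Q" using nm(7) Qn by (cases Q; cases "tl Q") auto
    have nmE: "\<not> E m n" using boundary_stable[OF mb] nm by blast
    have vQ: "\<not> E v y" "y \<noteq> v" "y \<noteq> n" "y \<noteq> m" if "y \<in> set Q" for y using f(7,8) v that Qn nm by blast+
    have "ind_cycle (Q @ [m, v, n])"
    proof (rule ind_cycle_appendI)
      show "set Q \<inter> set [m, v, n] = {}" by (auto dest: vQ(2-4))
      show "ind_path [m, v, n]" using nm v nmE sym[OF nm(4)] by auto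
      show "E x y \<longleftrightarrow> x = last Q \<and> y = hd [m, v, n] \<or> x = hd Q \<and> y = last [m, v, n]" if "x \<in> set Q" "y \<in> set [m, v, n]" for x y
        using that fo[OF that(1)] vQ[OF that(1)] symE[of x y] nm v by auto
    qed (use Qn \<open>2 \<le> length Q\<close> in auto)
    moreover have "set [m, v, n] \<subseteq> W - set cs" using nm f(2,7) v by auto
    ultimately have "odd (length Q + length [m, v, n])" using Q \<open>2 \<le> length Q\<close> unfolding handle_def by blast
    moreover have "8 \<le> length (Q @ [m, v, n])" using girth[OF ind_cycle_vcycle] \<open>ind_cycle (Q @ [m, v, n])\<close> by blast
    then have "length Q = 5" using Qn by simp
    ultimately show False by simp
  qed
  consider "E n (hd Q)" "E m (hd Q)" | "E n (last Q)" "E m (last Q)" | "E n (hd Q)" "E m (last Q)" | "E n (last Q)" "E m (hd Q)"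
    using QE by blast
  then show False
    using same[OF hl(1)] same[OF hl(2)] diff[of n m] diff[of m n] n nm by cases metis+
qed

text \<open>
  By \<open>boundary_nb_unique\<close> each vertex of the pocket has two neighbours in the pocket, so there are cycles.
  A cycle that avoids \<open>D\<close> would lie on the path \<open>Q\<close>, because boundary vertices have only their foot as
  a neighbour outside \<open>D\<close>.
\<close>

lemma probe_exists:
  assumes mb: "min_pocket W cs D" and Q: "handle W cs D Q" and W': "W' = W - (set cs - set Q)"
  shows "\<exists>ds. probe W cs D W' ds"
proof -
  note f = min_pocketD[OF mb]
  have Qn: "Q \<noteq> []" "ind_path Q" "set Q \<subseteq> set cs" using Q unfolding handle_def by blast+
  have DW: "D \<subseteq> W'" using f(2,7) W' by blast
  have two: "\<exists>a\<in>D. \<exists>b\<in>D. a \<noteq> b \<and> E v a \<and> E v b" if v: "v \<in> D" for v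
  proof -
    let ?S = "{u\<in>W. E v u}"
    have S: "3 \<le> card ?S" using mb v unfolding min_pocket_def pocket_def by blast
    obtain n0 where n0: "\<forall>u\<in>?S. u \<in> W - D - set cs \<longrightarrow> u = n0"
      using boundary_nb_unique[OF mb Q v] by (cases "\<exists>u\<in>?S. u \<in> W - D - set cs") blast+
    have inD: "u \<in> D" if "u \<in> ?S" "u \<noteq> n0" for u using n0 that f(8)[OF v] by blast
    obtain a where a: "a \<in> ?S" "a \<noteq> n0" using third_element[OF S, of n0 n0] by blast
    obtain b where b: "b \<in> ?S" "b \<noteq> n0" "b \<noteq> a" using third_element[OF S, of n0 a] by blast
    show ?thesis using a b inD by blast
  qed
  have "finite D" using f(2,5) finite_subset by blast
  then obtain es where es: "vcycle es" "set es \<subseteq> D" using vcycle_exists[OF _ f(4)] two by blast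
  then obtain ds where ds: "shortest_cycle W' ds" using shortest_cycle_exists[of es W'] DW by blast
  have c: "vcycle ds" "set ds \<subseteq> W'" using ds by (auto simp: shortest_cycle_def)
  have "set ds \<inter> D \<noteq> {}"
  proof
    assume no: "set ds \<inter> D = {}"
    have "x \<in> set Q" if x: "x \<in> set ds" for x
    proof (rule ccontr)
      assume "x \<notin> set Q"
      then have xN: "x \<in> W - D - set cs" using x no c(2) W' by blast
      obtain a b where ab: "a \<in> set ds" "b \<in> set ds" "a \<noteq> b" "E x a" "E x b" using vcycle_two_nb[OF c(1) x] by blast
      have "a \<in> set cs" "b \<in> set cs" using ab boundary_stable[OF mb xN] no c(2) W' by blast+
      then show False using boundary_foot_unique[OF mb _ _ _ ab(4) \<open>b \<in> set cs\<close>] ab xN by blast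
    qed
    then show False using ind_path_acyclic[OF Qn(2) c(1)] by blast
  qed
  moreover have "\<forall>u\<in>W. \<forall>v\<in>D. E u v \<longrightarrow> u \<in> W'" using f(8) sym W' by blast
  ultimately show ?thesis using mb DW ds W' unfolding probe_def by blast
qed

text \<open>
  The inner vertices of \<open>Q\<close> have degree two in \<open>G[W']\<close>, so a cycle through one of them contains all of
  \<open>Q\<close>. If the cycle does contain \<open>Q\<close>, everything else that is outside \<open>D\<close> is on the cycle or next to it,
  against \<open>outer_touch\<close>. Otherwise it meets \<open>Q\<close> at most in its ends.
\<close>

lemma handle_remnant:
  assumes mb: "min_pocket W cs D" and Q: "handle W cs D Q" and W': "W' = W - (set cs - set Q)" and sub: "probe W cs D W' ds"
  shows "\<exists>A M B. Q = A @ M @ B \<and> M \<noteq> [] \<and> set M \<inter> set ds = {} \<and> set A \<subseteq> set ds \<and> set B \<subseteq> set ds \<and> length A \<le> 1 \<and> length B \<le> 1"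
proof -
  note f = min_pocketD[OF mb]
  have Qn: "Q \<noteq> []" "ind_path Q" "set Q \<subseteq> set cs" and QE: "\<And>n. n \<in> W - D - set cs \<Longrightarrow> E n (hd Q) \<or> E n (last Q)"
    using Q unfolding handle_def by blast+
  have sds: "shortest_cycle W' ds" "set ds \<subseteq> W'" "vcycle ds" using sub by (auto simp: probe_def shortest_cycle_def)
  have Qd: "distinct Q" using Qn ind_path_distinct by blast
  have notall: "\<not> set Q \<subseteq> set ds"
  proof
    assume all: "set Q \<subseteq> set ds"
    obtain d where d: "d \<in> D" "d \<in> set ds" using sub unfolding probe_def by blast
    obtain a where a: "a \<in> W'" "a \<notin> set ds" "E d a" using nb_off_shortest_cycle[OF sds(1) d(2) probe_degree[OF sub d(1)]] by blast
    have "hd Q \<in> set Q" "last Q \<in> set Q" using Qn by auto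
    then have hl: "hd Q \<in> set ds" "last Q \<in> set ds" "hd Q \<notin> D" "last Q \<notin> D" using all Qn f(7) by blast+
    have foot: False if "u \<in> W' - D - set ds" "u \<notin> closed_nb ds" for u
    proof -
      have "u \<in> W - D - set cs" using that(1) W' all by blast
      then show False using QE[of u] hl that(2) unfolding closed_nb_def by blast
    qed
    have aD: "a \<in> D"
    proof (rule ccontr)
      assume "a \<notin> D"
      then have "a \<in> W - D - set cs" using a W' all by blast
      then have "E a (hd Q) \<or> E a (last Q)" by (rule QE)
      then show False using shortest_cycle_unique_nb[OF sds(1) a(1,2) hl(1) d(2) _ sym[OF a(3)]] shortest_cycle_unique_nb[OF sds(1) a(1,2) hl(2) d(2) _ sym[OF a(3)]]
         hl(3,4) d(1) by blast
    qed
    obtain b where b: "b \<in> W' - closed_nb ds" using nb_outside_closed_nb[OF sds(1) a(1,2) d(2) sym[OF a(3)] probe_degree[OF sub aD]] by blast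
    obtain u where "u \<in> W' - closed_nb ds - D" using outer_touch[OF sub b] by blast
    then show False using foot[of u] unfolding closed_nb_def by blast
  qed
  \<comment> \<open>a cycle through an inner vertex \<open>p\<close> of \<open>Q\<close> continues on both sides of it\<close>
  have int: "last (q # Q1) \<in> set ds \<and> y \<in> set ds" if s: "Q = (q # Q1) @ p # y # V" "p \<in> set ds" for q Q1 p y V
  proof -
    have pq: "p \<noteq> hd Q" "p \<noteq> last Q" "p \<in> set cs" using s Qd Qn(3) by auto
    have "a = last (q # Q1) \<or> a = y" if a: "a \<in> set ds" "E p a" for a
    proof -
      have "a \<notin> D" using f(8) pq a(2) sym by blast
      moreover have "a \<in> set Q \<or> a \<in> W - D - set cs" using a(1) sds(2) W' calculation by blast
      moreover have "a \<notin> W - D - set cs"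
      proof
        assume aN: "a \<in> W - D - set cs"
        then obtain h where h: "h = hd Q \<or> h = last Q" "E a h" using QE by blast
        then have "h \<in> set cs" using Qn by auto
        then have "E a p \<longleftrightarrow> p = h" using boundary_foot_unique[OF mb _ _ _ h(2) pq(3)] aN by blast
        then show False using sym[OF a(2)] h(1) pq by blast
      qed
      ultimately have "a \<in> set Q" by blast
      then have aQ: "a \<in> set ((q # Q1) @ p # y # V)" using s by simp
      have ip: "ind_path ((q # Q1) @ p # y # V)" using Qn s by simp
      then have e1: "\<forall>x\<in>set (q # Q1). \<forall>z\<in>set (p # y # V). E x z \<longleftrightarrow> x = last (q # Q1) \<and> z = p" and "ind_path (p # y # V)"
        unfolding ind_path_append[of "q # Q1"] by simp_all
      then have e2: "\<forall>z\<in>set (y # V). E p z \<longleftrightarrow> z = y" by simp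
      consider "a \<in> set (q # Q1)" | "a = p" | "a \<in> set (y # V)" using aQ by auto
      then show ?thesis
      proof cases
        case 1
        then show ?thesis using e1 sym[OF a(2)] by auto
      next
        case 2
        then show ?thesis using a irr by blast
      next
        case 3
        then show ?thesis using e2 a(2) by blast
      qed
    qed
    then show ?thesis using vcycle_two_nb[OF sds(3) s(2)] by metis
  qed
  have right: "set V \<subseteq> set ds" if "Q = (q # Q1) @ p # V" "p \<in> set ds" for q Q1 p V
    using that
  proof (induction V arbitrary: Q1 p)
    case (Cons y V)
    have "y \<in> set ds" using int[of q Q1 p y V] Cons.prems by blast
    then show ?case using Cons.IH[of "Q1 @ [p]" y] Cons.prems(1) by simp
  qed simp
  have left: "set U \<subseteq> set ds" if "Q = U @ p # y # V" "p \<in> set ds" for U p y V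
    using that
  proof (induction U arbitrary: p y V rule: rev_induct)
    case (snoc z U)
    have "z \<in> set ds"
    proof (cases "U @ [z]")
      case (Cons q Q1)
      then have "last (q # Q1) \<in> set ds" using int[of q Q1 p y V] snoc.prems by simp
      then show ?thesis using Cons by (metis last_snoc)
    qed simp
    then show ?case using snoc.IH[of z p "y # V"] snoc.prems(1) by simp
  qed simp
  have interior: "p \<notin> set ds" if s: "Q = (q # Q1) @ p # y # V" for q Q1 p y V
  proof
    assume p: "p \<in> set ds"
    have "set (y # V) \<subseteq> set ds" by (rule right[OF s p])
    moreover have "set (q # Q1) \<subseteq> set ds" by (rule left[OF s p])
    ultimately show False using notall s p by auto
  qed
  obtain h R where hR: "Q = h # R" using Qn by (cases Q) auto
  show ?thesis
  proof (cases R rule: rev_cases)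
    case Nil
    then show ?thesis using notall hR by (intro exI[of _ "[]"] exI[of _ Q]) auto
  next
    case (snoc M l)
    have QM: "Q = h # M @ [l]" using hR snoc by simp
    have Mint: "set M \<inter> set ds = {}"
    proof (rule ccontr)
      assume "\<not> ?thesis"
      then obtain p where p: "p \<in> set M" "p \<in> set ds" by blast
      obtain M1 M2 where M: "M = M1 @ p # M2" using split_list[OF p(1)] by blast
      show False
        by (cases M2) (use interior[of h M1 p l "[]"] interior[of h M1 p] QM M p(2) in auto)
    qed
    have hl: "\<not> (h \<in> set ds \<and> l \<in> set ds \<and> M = [])" using notall QM by auto
    consider "h \<in> set ds" "l \<in> set ds" | "h \<in> set ds" "l \<notin> set ds" | "h \<notin> set ds" "l \<in> set ds" | "h \<notin> set ds" "l \<notin> set ds" by blast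
    then show ?thesis
    proof cases
      case 1
      then show ?thesis using QM Mint hl by (intro exI[of _ "[h]"] exI[of _ M] exI[of _ "[l]"]) auto
    next
      case 2
      then show ?thesis using QM Mint by (intro exI[of _ "[h]"] exI[of _ "M @ [l]"] exI[of _ "[]"]) auto
    next
      case 3
      then show ?thesis using QM Mint by (intro exI[of _ "[]"] exI[of _ "h # M"] exI[of _ "[l]"]) auto
    next
      case 4
      then show ?thesis using QM Mint by (intro exI[of _ "[]"] exI[of _ "h # M @ [l]"] exI[of _ "[]"]) auto
    qed
  qed
qed

text \<open>
  The attachments are \<open>r\<close> at position \<open>0\<close>, given by \<open>y0\<close>, and the third neighbours of the vertices in
  positions \<open>2\<close> and \<open>5\<close>. These positions are in \<open>D\<close>, since by the second hypothesis the vertices of \<open>ds\<close>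
  outside \<open>D\<close> are \<open>y0\<close> or adjacent to it. The vertex \<open>r\<close> is the attachment of \<open>S\<close>, or, if \<open>S\<close> is not
  adjacent to \<open>ds\<close> at all, a third neighbour of \<open>y0\<close> as well.
\<close>

lemma one_terminal:
  assumes an: "anchor W cs D W' ds S" and nD: "\<And>z. z \<in> set ds \<Longrightarrow> z \<notin> D \<Longrightarrow> z = y0 \<or> E z y0"
    and y0: "y0 \<in> set ds" and r: "(r \<in> S \<and> E r y0) \<or> spoke W' ds S y0 r"
    and S: "\<And>t y. t \<in> S \<Longrightarrow> y \<in> set ds \<Longrightarrow> E t y \<Longrightarrow> t = r"
  shows False
proof -
  have sds: "shortest_cycle W' ds" using an by (auto simp: anchor_def probe_def)
  obtain A0 B0 where A0: "ds = A0 @ y0 # B0" using split_list[OF y0] by blast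
  define es where "es = y0 # B0 @ A0"
  have ses: "shortest_cycle W' es" "set es = set ds" using shortest_cycle_swap[of W' A0 "y0 # B0"] sds A0 by (auto simp: es_def)
  have l: "8 \<le> length es" using shortest_cycle_length(1)[OF ses(1)] .
  obtain p1 p2 p3 p4 p5 Z where p: "B0 @ A0 = p1 # p2 # p3 # p4 # p5 # Z" "2 \<le> length Z"
  proof -
    have l7: "7 \<le> length (B0 @ A0)" using l by (simp add: es_def)
    define L where "L = B0 @ A0"
    have "Suc (Suc (Suc (Suc (Suc 2)))) \<le> length L" using l7 by (simp add: L_def)
    then obtain p1 p2 p3 p4 p5 Z where "L = p1 # p2 # p3 # p4 # p5 # Z" "2 \<le> length Z"
      unfolding Suc_le_length_iff by blast
    then show thesis using that[of p1 p2 p3 p4 p5 Z] by (simp add: L_def)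
  qed
  have es: "es = y0 # [p1] @ p2 # [p3, p4] @ p5 # Z" using p by (simp add: es_def)
  have s2: "shortest_cycle W' (p2 # [p3,p4,p5] @ Z @ [y0,p1])" using shortest_cycle_swap[of W' "[y0,p1]" "p2 # [p3,p4,p5] @ Z"] ses es by simp
  have an': "anchor W cs D W' es S" by (rule anchor_cong[OF an ses])
  have Zn: "Z \<noteq> []" using p by auto
  have dis: "distinct es" using ses by (simp add: shortest_cycle_def vcycle_def)
  have pD: "p2 \<in> D" "p5 \<in> D"
  proof -
    have "\<not> E y0 p2" using shortest_cycle_nonadj[of W' y0 "[p1]" p2 "[p3,p4] @ p5 # Z"] ses es by simp
    moreover have "\<not> E y0 p5" using shortest_cycle_nonadj[of W' y0 "[p1] @ p2 # [p3,p4]" p5 Z] ses es Zn by simp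
    moreover have "p2 \<in> set ds" "p5 \<in> set ds" "p2 \<noteq> y0" "p5 \<noteq> y0" using ses(2) es dis by auto
    ultimately show "p2 \<in> D" "p5 \<in> D" using nD sym by blast+
  qed
  have pe: "y0 \<in> set es" "p2 \<in> set es" "p5 \<in> set es" using es by auto
  obtain a2 where a2: "spoke W' es S p2 a2" using anchor_spoke[OF an' pD(1) pe(2)] by blast
  obtain a5 where a5: "spoke W' es S p5 a5" using anchor_spoke[OF an' pD(2) pe(3)] by blast
  have closed_nb: "closed_nb es = closed_nb ds" using closed_nb_cong ses(2) by blast
  have r': "(r \<in> S \<and> E r y0) \<or> spoke W' es S y0 r" using r ses(2) closed_nb unfolding spoke_def by simp
  define K where "K = {a2, a5} \<union> (if r \<in> S then {} else {r})"
  define T where "T = (W' - closed_nb es) \<union> S \<union> K"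
  have cT: "conn_set T" unfolding T_def by (rule anchor_conn_set[OF an']) (use a2 a5 r' in \<open>auto simp: K_def\<close>)
  have S': "S \<subseteq> W' - set es" using an' unfolding anchor_def by blast
  have K': "K \<subseteq> W' - set es" using a2 a5 r' unfolding K_def spoke_def by auto
  have "tripod W' es y0 [p1] p2 [p3, p4] p5 Z T r a2 a5"
    unfolding tripod_def
  proof (intro conjI ballI impI)
    show "es = y0 # [p1] @ p2 # [p3, p4] @ p5 # Z" by (rule es)
    show "T \<subseteq> W'" "T \<inter> set es = {}" using S' K' unfolding T_def closed_nb_def by auto
    show "r \<in> T" "a2 \<in> T" "a5 \<in> T" unfolding T_def K_def by auto
    show "E r y0" "E a2 p2" "E a5 p5" using r' a2 a5 unfolding spoke_def by blast+
    show "t = r \<or> t = a2 \<or> t = a5" if "t \<in> T" "y \<in> set es" "E t y" for t y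
      using S[of t y] that ses(2) unfolding T_def K_def closed_nb_def by (auto split: if_splits)
  qed (rule ses(1))
  then show False
  proof (rule no_separated_tripod[OF _ cT])
    show "length [p1] \<noteq> 3 \<and> length [p3, p4] \<noteq> 3 \<and> length Z \<noteq> 3" if "even (length es)"
      using that by (auto simp: es)
  qed (use Zn in auto)
qed

text \<open>
  The path \<open>M\<close> is an ear of \<open>ds\<close>. It is so short that, by the girth, \<open>yl\<close> and \<open>yr\<close> are distinct and not
  adjacent, and therefore \<open>ds\<close> has length \<open>8\<close>. Comparing parities and lengths leaves arcs with
  three vertices each for \<open>length M = 4\<close>, and with two and four vertices for \<open>length M = 5\<close>. A vertex \<open>x\<close> in
  the middle of a longest arc is in \<open>D\<close>, and its third neighbour is the third attachment of a tripod. The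
  only exceptional ear allowed by the positions has three vertices and joins the ends of \<open>M\<close>; it would
  close a cycle of length \<open>5\<close> with \<open>M\<close>.
\<close>

lemma two_terminals:
  assumes an: "anchor W cs D W' ds S" and M: "ind_path M" "set M = S" "2 \<le> length M" "length M \<le> 5"
    and nD: "\<And>z. z \<in> set ds \<Longrightarrow> z \<notin> D \<Longrightarrow> z = yl \<or> E z yl \<or> z = yr \<or> E z yr"
    and y: "yl \<in> set ds" "yr \<in> set ds" "E (hd M) yl" "E (last M) yr"
    and S: "\<And>t y. t \<in> S \<Longrightarrow> y \<in> set ds \<Longrightarrow> E t y \<Longrightarrow> t = hd M \<or> t = last M"
    and par: "\<And>Y. set Y \<subseteq> set ds - {yl, yr} \<Longrightarrow> ind_cycle (M @ yr # Y @ [yl]) \<Longrightarrow> odd (length M + length Y)"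
  shows False
proof -
  have sds: "shortest_cycle W' ds" using an by (auto simp: anchor_def probe_def)
  have S': "S \<subseteq> W' - set ds" using an unfolding anchor_def by blast
  have dM: "distinct M" "successively E M" "M \<noteq> []" using M ind_path_distinct ind_path_successively by auto
  have hl: "hd M \<in> S" "last M \<in> S" using M dM(3) by auto
  have hlne: "hd M \<noteq> last M" using dM M(3) by (cases M) auto
  have dsW: "set ds \<subseteq> W'" using sds by (simp add: shortest_cycle_def)
  have yM: "yl \<notin> set M" "yr \<notin> set M" using y S' M by auto
  have ne: "yl \<noteq> yr"
  proof
    assume "yl = yr"
    then have "vcycle (yl # M)" using dM yM y M(3) sym by (intro vcycle_Cons) auto
    from girth[OF this] show False using M(4) by simp
  qed
  have nadj: "\<not> E yl yr"
  proof
    assume e: "E yl yr"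
    have "vcycle (yr # (yl # M))"
      by (rule vcycle_Cons) (use dM M(3) yM y ne sym[OF e] sym[OF y(3)] in \<open>auto simp: successively_Cons\<close>)
    from girth[OF this] show False using M(4) by simp
  qed
  have edge: "E t z \<longleftrightarrow> t = hd M \<and> z = yl \<or> t = last M \<and> z = yr" if t: "t \<in> S" "z \<in> set ds" for t z
  proof -
    have u: "z = w" if "w \<in> set ds" "E t w" "E t z" for w
      using shortest_cycle_unique_nb[OF sds _ _ t(2) that(1,3,2)] t(1) S' by blast
    show ?thesis using S[OF t] u y by metis
  qed
  have ear0: "ear ds M yl yr"
    unfolding ear_def using M S' edge by auto
  obtain X Y where s: "shortest_cycle W' (yl # X @ yr # Y)" "set (yl # X @ yr # Y) = set ds"
    using shortest_cycle_split[OF sds y(1,2) ne] by metis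
  note s' = shortest_cycle_rot[OF s(1)]
  have cyc0: "vcycle (yl # X @ yr # Y)" using s(1) by (simp add: shortest_cycle_def)
  have X: "X \<noteq> []" using cyc0 nadj unfolding vcycle_def by (auto simp: successively_Cons)
  have Y: "Y \<noteq> []" using cyc0 nadj sym unfolding vcycle_def by auto
  have ear1: "ear (yl # X @ yr # Y) M yl yr" using ear0 s(2) by (metis ear_cong)
  have ear2: "ear (yr # Y @ yl # X) (rev M) yr yl" using ear_rev[OF ear1] by (rule ear_cong) auto
  have MW: "set M \<subseteq> W'" using M S' by blast
  have eXY: "even (length X + length Y)" using ear_odd[OF s(1) _ ear1 MW X Y] by blast
  then have l8: "length X + length Y = 6" using shortest_cycle_length(2)[OF s(1)] by simp
  have h1: "ind_cycle (yl # X @ yr # rev M)" by (rule ear_hole[OF shortest_cycle_induced[OF s(1)] Y ear1])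
  have h2: "ind_cycle (yr # Y @ yl # M)" using ear_hole[OF shortest_cycle_induced[OF s'] X ear2] by simp
  have "ind_cycle (M @ yr # Y @ [yl])" using ind_cycle_swap[of "yr # Y @ [yl]" M] h2 by simp
  moreover have "distinct (yl # X @ yr # Y)" using cyc0 by (simp add: vcycle_def)
  then have "set Y \<subseteq> set ds - {yl, yr}" using s(2) by auto
  ultimately have oY: "odd (length M + length Y)" using par by blast
  \<comment> \<open>the two arcs have the same parity\<close>
  have oX: "odd (length M + length X)" using oY eXY by auto
  have "6 \<le> length M + length X" "6 \<le> length M + length Y" using girth[OF ind_cycle_vcycle[OF h1]] girth[OF ind_cycle_vcycle[OF h2]] by auto
  moreover have "length M + length X \<noteq> 6" "length M + length Y \<noteq> 6" using oX oY by (metis even_numeral)+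
  ultimately have gX: "7 \<le> length M + length X" "7 \<le> length M + length Y" by linarith+
  \<comment> \<open>\<open>x\<close> is neither adjacent nor opposite to the two feet of \<open>M\<close>\<close>
  have fin: False if L: "shortest_cycle W' (c1 # X @ c2 # Y1 @ x # Y2)" "set (c1 # X @ c2 # Y1 @ x # Y2) = set ds"
    "X \<noteq> []" "Y1 \<noteq> []" "Y2 \<noteq> []" "length Y1 \<noteq> 3" "length Y2 \<noteq> 3" "length X = 3 \<Longrightarrow> length M = 4"
    "length (c1 # X @ c2 # Y1 @ x # Y2) = 8"
    and c: "(c1 = yl \<and> c2 = yr \<and> n1 = hd M \<and> n2 = last M) \<or> (c1 = yr \<and> c2 = yl \<and> n1 = last M \<and> n2 = hd M)"
    for c1 X c2 Y1 x Y2 n1 n2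
  proof -
    let ?es = "c1 # X @ c2 # Y1 @ x # Y2"
    have an': "anchor W cs D W' ?es S" by (rule anchor_cong[OF an L(1,2)])
    have "\<not> E c1 x" using shortest_cycle_nonadj[of W' c1 "X @ c2 # Y1" x Y2] L by simp
    moreover have "\<not> E c2 x" using shortest_cycle_nonadj[of W' c2 Y1 x "Y2 @ c1 # X"] shortest_cycle_swap[of W' "c1 # X" "c2 # Y1 @ x # Y2"] L by simp
    moreover have "distinct ?es" using L(1) by (simp add: shortest_cycle_def vcycle_def)
    moreover have "x \<in> set ds" using L(2) by auto
    ultimately have xD: "x \<in> D" using nD[of x] c sym by auto
    obtain a where a: "spoke W' ?es S x a" using anchor_spoke[OF an' xD] by auto
    define T where "T = (W' - closed_nb ?es) \<union> S \<union> {a}"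
    have cT: "conn_set T" unfolding T_def by (rule anchor_conn_set[OF an']) (use a in auto)
    have TW: "T \<subseteq> W'" "T \<inter> set ?es = {}" using S' L(2) a unfolding T_def closed_nb_def spoke_def by auto
    have n12: "n1 \<in> S" "n2 \<in> S" "E n1 c1" "E n2 c2" using c hl y by auto
    have L': "tripod W' ?es c1 X c2 Y1 x Y2 T n1 n2 a"
      unfolding tripod_def
    proof (intro conjI ballI impI)
      show "E a x" using a by (simp add: spoke_def)
      show "t = n1 \<or> t = n2 \<or> t = a" if t: "t \<in> T" "z \<in> set ?es" "E t z" for t z
      proof -
        have "t \<in> S \<or> t = a" using t unfolding T_def closed_nb_def by blast
        then show ?thesis using S[of t z] t L(2) c by auto
      qed
    qed (use L TW n12 in \<open>auto simp: T_def\<close>)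
    obtain P where P: "joins T P n1 n2" "length X = 3" "length P = 3"
      using tripod_exceptional_ear[OF L' L(9) cT] L(3-7) unfolding exceptional_def by auto
    note P' = joinsD[OF P(1)]
    obtain b1 z b2 where "P = [b1, z, b2]" using P(3) by (auto simp: length_Suc_conv eval_nat_numeral)
    then have "P = [n1, z, n2]" using P' by auto
    then have z: "E n1 z" "E z n2" using P' by auto
    have M4: "length M = 4" using L(8) P(2) by blast
    then obtain m1 m2 m3 m4 where M4: "M = [m1,m2,m3,m4]" by (auto simp: length_Suc_conv eval_nat_numeral)
    have zz: "E z m1" "E z m4" using z c sym M4 by auto
    have "z \<notin> set M"
    proof
      assume "z \<in> set M"
      then show False using zz M(1) irr sym M4 by auto
    qed
    then have "vcycle (z # M)" by (intro vcycle_Cons) (use dM zz sym M4 in auto)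
    from girth[OF this] show False using M4 by simp
  qed
  have "length M = 4 \<and> length X = 3 \<and> length Y = 3 \<or> length M = 5 \<and> length X = 2 \<and> length Y = 4 \<or> length M = 5 \<and> length X = 4 \<and> length Y = 2"
  proof -
    have "length M = 4 \<or> length M = 5" using gX l8 M(4) by arith
    then show ?thesis
    proof
      assume "length M = 4"
      then show ?thesis using gX l8 by arith
    next
      assume m5: "length M = 5"
      have "length X \<noteq> 3" using oX m5 by auto
      then show ?thesis using gX l8 m5 by arith
    qed
  qed
  then show False
  proof (elim disjE conjE)
    assume l: "length M = 4" "length X = 3" "length Y = 3"
    obtain q1 q2 q3 where q: "Y = [q1,q2,q3]" using l(3) by (auto simp: length_Suc_conv eval_nat_numeral)
    show False by (rule fin[of yl X yr "[q1]" q2 "[q3]" "hd M" "last M"]) (use s X l q in auto)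
  next
    assume l: "length M = 5" "length X = 2" "length Y = 4"
    obtain q1 q2 q3 q4 where q: "Y = [q1,q2,q3,q4]" using l(3) by (auto simp: length_Suc_conv eval_nat_numeral)
    show False by (rule fin[of yl X yr "[q1]" q2 "[q3,q4]" "hd M" "last M"]) (use s X l q in auto)
  next
    assume l: "length M = 5" "length X = 4" "length Y = 2"
    obtain q1 q2 q3 q4 where q: "X = [q1,q2,q3,q4]" using l(2) by (auto simp: length_Suc_conv eval_nat_numeral)
    show False by (rule fin[of yr Y yl "[q1]" q2 "[q3,q4]" "last M" "hd M"]) (use s s' Y l q in auto)
  qed
qed

text \<open>
  Let \<open>M\<close> be the part of the handle off the cycle \<open>ds\<close>. Then \<open>ends\<close> says that only the ends of \<open>M\<close> are attached
  to \<open>ds\<close>, and \<open>nonD\<close> that the vertices of \<open>ds\<close> outside \<open>D\<close> are the attachments of these ends or next to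
  them. The cases are two attached ends, one, and none.
\<close>

lemma no_min_pocket:
  assumes mb: "min_pocket W cs D" shows False
proof -
  note f = min_pocketD[OF mb]
  obtain Q where Q: "handle W cs D Q" using handle_exists[OF mb] by blast
  have Qn: "Q \<noteq> []" "ind_path Q" "set Q \<subseteq> set cs" "length Q \<le> 5"
    and QE: "\<And>n. n \<in> W - D - set cs \<Longrightarrow> E n (hd Q) \<or> E n (last Q)"
    and Qodd: "\<And>P. 2 \<le> length Q \<Longrightarrow> ind_cycle (Q @ P) \<Longrightarrow> set P \<subseteq> W - set cs \<Longrightarrow> odd (length Q + length P)"
    using Q unfolding handle_def by blast+
  define W' where "W' = W - (set cs - set Q)"
  obtain ds where sub: "probe W cs D W' ds" using probe_exists[OF mb Q W'_def] by blast
  have sds: "shortest_cycle W' ds" "set ds \<subseteq> W'" "set ds \<inter> D \<noteq> {}" using sub by (auto simp: probe_def shortest_cycle_def)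
  obtain A M B where AMB: "Q = A @ M @ B" "M \<noteq> []" "set M \<inter> set ds = {}" "set A \<subseteq> set ds" "set B \<subseteq> set ds"
    "length A \<le> 1" "length B \<le> 1"
    using handle_remnant[OF mb Q W'_def sub] by blast
  have Ac: "A = [] \<or> (\<exists>a. A = [a])" and Bc: "B = [] \<or> (\<exists>b. B = [b])"
    using AMB(6,7) by (cases A; cases B; simp)+
  have ipM: "ind_path M" using Qn(2) AMB(1) by (simp add: ind_path_append)
  have SM: "set Q - set ds = set M" using AMB by auto
  have hQ: "hd Q \<in> set Q" "last Q \<in> set Q" using Qn(1) by auto
  have hM: "hd M \<in> set M" "last M \<in> set M" using AMB(2) by auto
  have DQ: "\<not> E d k" if "d \<in> D" "k \<in> set Q" for d k using f(8) that Qn(3) by blast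
  have N: "u \<in> W - D - set cs" if "u \<in> W'" "u \<notin> D" "u \<notin> set Q" for u using that unfolding W'_def by blast
  have foot: "E u k \<longleftrightarrow> k = h" if "u \<in> W'" "u \<notin> D" "u \<notin> set Q" "E u h" "h \<in> set Q" "k \<in> set Q" for u h k
    using boundary_foot_unique[OF mb _ _ _ that(4)] N[OF that(1-3)] that(5,6) Qn(3) by blast
  have an: "anchor W cs D W' ds (set M)"
    unfolding SM[symmetric]
  proof (rule anchorI[OF sub])
    show "set Q \<subseteq> W'" using Qn(3) f(6) unfolding W'_def by blast
    show "set Q \<inter> D = {}" using Qn(3) f(7) by blast
    show "\<exists>c\<in>set Q. E u c" if "u \<in> W' - D - set Q" for u using QE[OF N] that hQ by blast
    show "conn_set (set Q - set ds)" unfolding SM using conn_set_ind_path_set[OF ipM] .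
    show "set Q - set ds \<noteq> {}" unfolding SM using AMB(2) by simp
  qed (rule DQ)
  have MQ: "set M \<subseteq> set Q" using AMB(1) by auto
  have MW: "set M \<subseteq> W' - set ds" using an unfolding anchor_def by blast
  have hdA: "A = [] \<Longrightarrow> hd Q = hd M" and ltB: "B = [] \<Longrightarrow> last Q = last M" using AMB(1,2) by auto
  have hdin: "hd Q \<in> set M \<Longrightarrow> A = []" "last Q \<in> set M \<Longrightarrow> B = []"
    using Ac Bc AMB(1,3,4,5) by auto
  have ipA: "E a t \<longleftrightarrow> t = hd M" if "A = [a]" "t \<in> set M" for a t
    using Qn(2) AMB(1,2) that by simp
  have ipB: "E t b \<longleftrightarrow> t = last M" if "B = [b]" "t \<in> set M" for b t
    using Qn(2) AMB(1,2) that by (simp add: ind_path_append)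
  have Qds: "z \<in> set A \<or> z \<in> set B" if "z \<in> set Q" "z \<in> set ds" for z using that AMB(1,3) by auto
  have ends: "t = hd M \<or> t = last M" if t: "t \<in> set M" "y \<in> set ds" "E t y" for t y
  proof -
    have yD: "y \<notin> D" using DQ[of y t] sym[OF t(3)] t(1) MQ by blast
    show ?thesis
    proof (cases "y \<in> set Q")
      case True
      then have "A = [y] \<or> B = [y]" using Qds[OF True t(2)] Ac Bc by auto
      then show ?thesis using ipA[of y t] ipB[of y t] t(1,3) sym[OF t(3)] by blast
    next
      case False
      have yW: "y \<in> W'" using t(2) sds(2) by blast
      have "t = hd Q \<or> t = last Q"
        using QE[OF N[OF yW yD False]] foot[OF yW yD False] hQ sym[OF t(3)] t(1) MQ by blast
      then show ?thesis using hdin hdA ltB t(1) by auto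
    qed
  qed
  have nonD: "\<exists>t\<in>{hd M, last M}. \<exists>y\<in>set ds. E t y \<and> (z = y \<or> E z y)" if z: "z \<in> set ds" "z \<notin> D" for z
  proof (cases "z \<in> set Q")
    case True
    then have "A = [z] \<or> B = [z]" using Qds[OF True z(1)] Ac Bc by auto
    then have "E (hd M) z \<or> E (last M) z" using ipA[of z "hd M"] ipB[of z "last M"] hM sym by blast
    then show ?thesis using z(1) by blast
  next
    case False
    have zW: "z \<in> W'" using z(1) sds(2) by blast
    have "E z (hd Q) \<or> E z (last Q)" by (rule QE[OF N[OF zW z(2) False]])
    then show ?thesis
    proof
      assume e: "E z (hd Q)"
      show ?thesis
      proof (cases A)
        case Nil
        then have "E (hd M) z" using hdA sym[OF e] by simp
        then show ?thesis using z(1) by blast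
      next
        case (Cons a A')
        then have "A = [a]" "a = hd Q" using Ac AMB(1) by auto
        moreover from this have "E (hd M) a" using ipA[of a "hd M"] hM sym by blast
        ultimately show ?thesis using e AMB(4) by auto
      qed
    next
      assume e: "E z (last Q)"
      show ?thesis
      proof (cases "B = []")
        case True
        then have "E (last M) z" using ltB sym[OF e] by simp
        then show ?thesis using z(1) by blast
      next
        case False
        then obtain b where "B = [b]" "b = last Q" using Bc AMB(1) by auto
        moreover from this have "E (last M) b" using ipB[of b "last M"] hM by blast
        ultimately show ?thesis using e AMB(5) by auto
      qed
    qed
  qed
  have uniq: "y = y'" if "t \<in> set M" "y \<in> set ds" "y' \<in> set ds" "E t y" "E t y'" for t y y'
    using shortest_cycle_unique_nb[OF sds(1) _ _ that(2-5)] that(1) MW by blast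
  consider yl yr where "yl \<in> set ds" "yr \<in> set ds" "E (hd M) yl" "E (last M) yr" "hd M \<noteq> last M"
    | r y0 where "r \<in> {hd M, last M}" "y0 \<in> set ds" "E r y0" "\<And>t y. t \<in> {hd M, last M} \<Longrightarrow> y \<in> set ds \<Longrightarrow> E t y \<Longrightarrow> t = r"
    | "\<And>t y. t \<in> {hd M, last M} \<Longrightarrow> y \<in> set ds \<Longrightarrow> \<not> E t y"
    by blast
  then show False
  proof cases
    case 1
    have lM: "2 \<le> length M" using 1(5) AMB(2) by (cases M; cases "tl M") auto
    have lQ: "2 \<le> length Q" using lM AMB(1) by simp
    show False
    proof (rule two_terminals[OF an ipM refl lM _ _ 1(1-4) ends])
      show "length M \<le> 5" using Qn(4) AMB(1) by simp
      show "z = yl \<or> E z yl \<or> z = yr \<or> E z yr" if "z \<in> set ds" "z \<notin> D" for z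
        using nonD[OF that] uniq[OF hM(1) 1(1) _ 1(3)] uniq[OF hM(2) 1(2) _ 1(4)] by blast
      fix Y assume Y: "set Y \<subseteq> set ds - {yl, yr}" and ic: "ind_cycle (M @ yr # Y @ [yl])"
      have "distinct (M @ yr # Y @ [yl])" using ind_cycle_vcycle[OF ic] by (simp add: vcycle_def)
      then have ne: "yl \<noteq> yr" by auto
      have A': "A = [] \<or> A = [yl]"
      proof -
        have "a = yl" if a: "A = [a]" for a
          using uniq[OF hM(1) 1(1) _ 1(3), of a] ipA[OF a hM(1)] sym[of a "hd M"] AMB(4) a by auto
        then show ?thesis using Ac by blast
      qed
      have B': "B = [] \<or> B = [yr]"
      proof -
        have "b = yr" if b: "B = [b]" for b
          using uniq[OF hM(2) 1(2) _ 1(4), of b] ipB[OF b hM(2)] AMB(5) b by auto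
        then show ?thesis using Bc by blast
      qed
      have out: "z \<in> W - set cs" if "z \<in> set ds" "z \<notin> set Q" for z using that sds(2) unfolding W'_def by blast
      have YW: "set Y \<subseteq> W - set cs"
      proof
        fix z assume z: "z \<in> set Y"
        then have "z \<in> set ds" "z \<noteq> yl" "z \<noteq> yr" using Y by auto
        moreover from this have "z \<notin> set Q" using Qds[of z] A' B' by auto
        ultimately show "z \<in> W - set cs" using out by blast
      qed
      have ylW: "yl \<in> W - set cs" if a: "A = []"
      proof -
        have "yl \<notin> set Q" using Qds[OF _ 1(1)] a B' ne by auto
        then show ?thesis by (rule out[OF 1(1)])
      qed
      have yrW: "yr \<in> W - set cs" if b: "B = []"
      proof -
        have "yr \<notin> set Q" using Qds[OF _ 1(2)] b A' ne by auto
        then show ?thesis by (rule out[OF 1(2)])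
      qed
      \<comment> \<open>the cycle contains the whole handle: the ends of \<open>Q\<close> missing in \<open>M\<close> are \<open>yl\<close> and \<open>yr\<close>\<close>
      have "\<exists>P. ind_cycle (Q @ P) \<and> set P \<subseteq> W - set cs \<and> length Q + length P = length M + length Y + 2"
      proof -
        consider "A = []" "B = []" | "A = [yl]" "B = []" | "A = []" "B = [yr]" | "A = [yl]" "B = [yr]" using A' B' by blast
        then show ?thesis
        proof cases
          case a: 1
          then show ?thesis using ic YW ylW yrW AMB(1) by (intro exI[of _ "yr # Y @ [yl]"]) auto
        next
          case a: 2
          have "ind_cycle ((yl # M) @ (yr # Y))" using ind_cycle_swap[of "M @ yr # Y" "[yl]"] ic by simp
          then show ?thesis using a YW yrW AMB(1) by (intro exI[of _ "yr # Y"]) auto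
        next
          case a: 3
          then show ?thesis using ic YW ylW AMB(1) by (intro exI[of _ "Y @ [yl]"]) auto
        next
          case a: 4
          have "ind_cycle ((yl # M) @ (yr # Y))" using ind_cycle_swap[of "M @ yr # Y" "[yl]"] ic by simp
          then show ?thesis using a YW AMB(1) by (intro exI[of _ Y]) auto
        qed
      qed
      then obtain P where "ind_cycle (Q @ P)" "set P \<subseteq> W - set cs" "length Q + length P = length M + length Y + 2" by blast
      then have "odd (length M + length Y + 2)" using Qodd[OF lQ] by metis
      then show "odd (length M + length Y)" by simp
    qed
  next
    case 2
    have rM: "r \<in> set M" using 2(1) hM by blast
    show False
    proof (rule one_terminal[OF an _ 2(2)])
      show "z = y0 \<or> E z y0" if "z \<in> set ds" "z \<notin> D" for z
        using nonD[OF that] 2(4) uniq[OF rM 2(2) _ 2(3)] by blast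
      show "r \<in> set M \<and> E r y0 \<or> spoke W' ds (set M) y0 r" using rM 2(3) by blast
      show "t = r" if "t \<in> set M" "y \<in> set ds" "E t y" for t y using ends[OF that] 2(4) that by blast
    qed
  next
    case 3
    obtain y0 where y0: "y0 \<in> set ds" "y0 \<in> D" using sds(3) by blast
    obtain r where r: "spoke W' ds (set M) y0 r" using anchor_spoke[OF an y0(2,1)] by blast
    show False
    proof (rule one_terminal[OF an _ y0(1)])
      show "z = y0 \<or> E z y0" if "z \<in> set ds" "z \<notin> D" for z using nonD[OF that] 3 by blast
      show "r \<in> set M \<and> E r y0 \<or> spoke W' ds (set M) y0 r" using r by blast
      show "t = r" if "t \<in> set M" "y \<in> set ds" "E t y" for t y using ends[OF that] 3 that by blast
    qed
  qed
qed

section \<open>Vertices of degree at most two and colouring\<close>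

text \<open>
  If all degrees are at least three, the vertices outside the closed neighbourhood of a shortest cycle
  form a pocket.
\<close>

lemma degree_le_two:
  assumes "finite W" "W \<noteq> {}"
  shows "\<exists>v\<in>W. card {u\<in>W. E v u} \<le> 2"
proof (rule ccontr)
  assume "\<not> ?thesis"
  then have deg: "3 \<le> card {u\<in>W. E v u}" if "v \<in> W" for v using that by (auto simp: not_le Suc_le_eq numeral_eq_Suc)
  have "\<exists>a\<in>W. \<exists>b\<in>W. a \<noteq> b \<and> E v a \<and> E v b" if v: "v \<in> W" for v
  proof -
    obtain a where "a \<in> {u\<in>W. E v u}" using third_element[OF deg[OF v], of v v] by blast
    moreover obtain b where "b \<in> {u\<in>W. E v u}" "b \<noteq> a" using third_element[OF deg[OF v], of a a] by blast
    ultimately show ?thesis by blast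
  qed
  then obtain es where "vcycle es" "set es \<subseteq> W" using vcycle_exists[OF assms] by blast
  then obtain cs where cs: "shortest_cycle W cs" using shortest_cycle_exists by blast
  have csW: "set cs \<subseteq> W" "cs \<noteq> []" using cs by (auto simp: shortest_cycle_def vcycle_def)
  then have c: "hd cs \<in> set cs" "hd cs \<in> W" by auto
  obtain a where a: "a \<in> W" "a \<notin> set cs" "E (hd cs) a" using nb_off_shortest_cycle[OF cs c(1) deg[OF c(2)]] by blast
  obtain b where b: "b \<in> W - closed_nb cs" using nb_outside_closed_nb[OF cs a(1,2) c(1) sym[OF a(3)] deg[OF a(1)]] by blast
  have "pocket W cs (W - closed_nb cs)" unfolding pocket_def using assms(1) cs b deg by blast
  then show False using min_pocket_exists no_min_pocket by blast
qed

lemma three_colouring: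
  assumes "finite W"
  shows "\<exists>c :: 'a \<Rightarrow> nat. (\<forall>v\<in>W. c v \<in> {1..3}) \<and> (\<forall>u\<in>W. \<forall>v\<in>W. E u v \<longrightarrow> c u \<noteq> c v)"
  using assms
proof (induction W rule: finite_psubset_induct)
  case (psubset W)
  show ?case
  proof (cases "W = {}")
    case False
    then obtain v where v: "v \<in> W" "card {u\<in>W. E v u} \<le> 2" using degree_le_two[OF psubset.hyps] by blast
    obtain c :: "'a \<Rightarrow> nat" where c: "\<forall>u\<in>W - {v}. c u \<in> {1..3}" "\<forall>u\<in>W - {v}. \<forall>w\<in>W - {v}. E u w \<longrightarrow> c u \<noteq> c w"
      using psubset.IH[of "W - {v}"] v(1) by blast
    have "card (c ` {u\<in>W. E v u}) \<le> 2" using card_image_le[of "{u\<in>W. E v u}" c] psubset.hyps v(2) by simp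
    then have "\<not> {1..3} \<subseteq> c ` {u\<in>W. E v u}"
      using card_mono[of "c ` {u\<in>W. E v u}" "{1..3}"] psubset.hyps by auto
    then obtain k where k: "k \<in> {1..3}" "k \<notin> c ` {u\<in>W. E v u}" by blast
    have "\<forall>u\<in>W. (c(v := k)) u \<in> {1..3}" using c(1) k(1) by auto
    moreover have "(c(v := k)) u \<noteq> (c(v := k)) w" if "u \<in> W" "w \<in> W" "E u w" for u w
    proof -
      have "u \<noteq> w" using that(3) irr by blast
      moreover have "c u \<noteq> k" if "w = v" using k(2) \<open>u \<in> W\<close> \<open>E u w\<close> that sym by blast
      moreover have "c w \<noteq> k" if "u = v" using k(2) \<open>w \<in> W\<close> \<open>E u w\<close> that by blast
      ultimately show ?thesis using c(2) that by auto
    qed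
    ultimately show ?thesis by blast
  qed simp
qed

end

section \<open>From vertex lists to arc walks\<close>

lemma walk_of_vwalk_arcs:
  "ws \<noteq> [] \<Longrightarrow> pcas (hd ws) (vwalk_arcs ws) (last ws) \<and> pawalk_verts (hd ws) (vwalk_arcs ws) = ws"
  by (induction ws rule: vwalk_arcs.induct) auto

lemma length_vwalk_arcs: "length (vwalk_arcs ws) = length ws - 1"
  by (induction ws rule: vwalk_arcs.induct) auto

lemma vwalk_arcs_successively: "successively R ws \<Longrightarrow> (u, v) \<in> set (vwalk_arcs ws) \<Longrightarrow> R u v"
  by (induction ws rule: vwalk_arcs.induct) auto

lemma fst_vwalk_arcs: "ws \<noteq> [] \<Longrightarrow> fst ` set (vwalk_arcs (ws @ [w])) = set ws"
  by (induction ws rule: vwalk_arcs.induct) (auto simp: image_iff)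

context pair_graph
begin

sublocale sgraph "\<lambda>u v. (u, v) \<in> parcs G"
proof
  show "(y, x) \<in> parcs G" if "(x, y) \<in> parcs G" for x y
    using that pair_sym_arcs by (auto simp: symmetric_def dest: symD)
  show "(x, x) \<notin> parcs G" for x using pair_no_loops by fastforce
qed

lemma graph_cycle_of_vcycle:
  assumes "vcycle cs"
  shows "graph_cycle G (vwalk_arcs (cs @ [hd cs]))" "length (vwalk_arcs (cs @ [hd cs])) = length cs"
proof -
  let ?p = "vwalk_arcs (cs @ [hd cs])"
  have cs: "3 \<le> length cs" "cs \<noteq> []" "distinct cs" "successively (\<lambda>u v. (u, v) \<in> parcs G) cs"
    "(last cs, hd cs) \<in> parcs G"
    using assms unfolding vcycle_def by auto
  show l: "length ?p = length cs" by (simp add: length_vwalk_arcs)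
  have "successively (\<lambda>u v. (u, v) \<in> parcs G) (cs @ [hd cs])" using cs by (simp add: successively_append_iff)
  then have sub: "set ?p \<subseteq> parcs G" using vwalk_arcs_successively by fastforce
  have w: "pcas (hd cs) ?p (hd cs)" "pawalk_verts (hd cs) ?p = cs @ [hd cs]"
    using walk_of_vwalk_arcs[of "cs @ [hd cs]"] cs(2) by auto
  have "hd cs \<in> pverts G" using arc_snd_in_verts[OF cs(5)] by simp
  then have "awalk (hd cs) ?p (hd cs)" using sub w(1) by (simp add: awalk_def)
  moreover have "distinct (tl (cs @ [hd cs]))" using cs(2,3) by (cases cs) auto
  ultimately have "cycle ?p" using w(2) l cs(1) unfolding cycle_def by force
  then show "graph_cycle G ?p" using l cs(1) by (simp add: graph_cycle_def)
qed

lemma ind_path_chordless: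
  "ind_path P \<Longrightarrow> u \<in> set P \<Longrightarrow> v \<in> set P \<Longrightarrow> (u, v) \<in> parcs G \<Longrightarrow>
    (u, v) \<in> set (vwalk_arcs P) \<or> (v, u) \<in> set (vwalk_arcs P)"
proof (induction P)
  case (Cons x P)
  show ?case
  proof (cases "u = x \<or> v = x")
    case True
    then show ?thesis using Cons.prems irr[of x] sym[of u v] by (cases P) auto
  next
    case False
    then show ?thesis using Cons by (cases P) auto
  qed
qed simp

lemma hole_of_ind_cycle:
  assumes "ind_cycle cs"
  shows "hole G (vwalk_arcs (cs @ [hd cs]))"
  unfolding hole_iff_chordless
proof (intro conjI ballI impI)
  let ?p = "vwalk_arcs (cs @ [hd cs])"
  note c = graph_cycle_of_vcycle[OF ind_cycle_vcycle[OF assms]]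
  show "graph_cycle G ?p" "4 \<le> length ?p" using c assms by (auto simp: ind_cycle_def)
  obtain x Q where cs: "cs = x # Q" and Q: "Q \<noteq> []" "ind_path Q" "x \<notin> set Q"
    "\<forall>y\<in>set Q. (x, y) \<in> parcs G \<longleftrightarrow> y = hd Q \<or> y = last Q"
  proof (cases cs)
    case (Cons x Q)
    then have "Q \<noteq> []" using assms by (auto simp: ind_cycle_def)
    then show thesis using assms that[of x Q] Cons by (simp add: ind_cycle_def)
  qed (use assms in \<open>simp add: ind_cycle_def\<close>)
  have p: "?p = (x, hd Q) # vwalk_arcs Q @ [(last Q, x)]"
    using Q(1) by (simp add: cs vwalk_arcs_append)
  fix u v assume "u \<in> fst ` set ?p" "v \<in> fst ` set ?p" and uv: "(u, v) \<in> parcs G"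
  then have "u \<in> set cs" "v \<in> set cs" using fst_vwalk_arcs[of cs "hd cs"] cs by auto
  then consider "u = x" "v \<in> set Q" | "v = x" "u \<in> set Q" | "u \<in> set Q" "v \<in> set Q"
    using cs uv irr[of x] by auto
  then show "(u, v) \<in> set ?p \<or> (v, u) \<in> set ?p"
  proof cases
    case 1
    then show ?thesis using Q(4) uv p by auto
  next
    case 2
    then show ?thesis using Q(4) sym[OF uv] p by auto
  next
    case 3
    then show ?thesis using ind_path_chordless[OF Q(2) _ _ uv] p by auto
  qed
qed

end

theorem theorem1p3:
  fixes G :: "'a pair_pre_digraph"
  assumes "G \<in> family_H 4"
  shows "colorable 3 G"
proof -
  have G: "pair_graph G" "girth G = enat 8" "\<not> (\<exists>p. even_hole G p \<and> 10 \<le> length p)"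
    using assms by (auto simp: family_H_def)
  interpret pair_graph G by (rule G(1))
  interpret girth8 "\<lambda>u v. (u, v) \<in> parcs G"
  proof
    show "8 \<le> length cs" if "vcycle cs" for cs
      using G(2) graph_cycle_of_vcycle[OF that] unfolding girth_eq_iff by fastforce
    show "length cs < 10" if "ind_cycle cs" "even (length cs)" for cs
      using G(3) hole_of_ind_cycle[OF that(1)] graph_cycle_of_vcycle(2)[OF ind_cycle_vcycle[OF that(1)]] that(2)
      unfolding even_hole_def by fastforce
  qed
  obtain c :: "'a \<Rightarrow> nat" where c: "\<forall>v\<in>pverts G. c v \<in> {1..3}"
    "\<forall>u\<in>pverts G. \<forall>v\<in>pverts G. (u, v) \<in> parcs G \<longrightarrow> c u \<noteq> c v"
    using three_colouring[OF pair_finite_verts] by blast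
  have "\<forall>(u, v)\<in>parcs G. c u \<noteq> c v" using c(2) arc_fst_in_verts arc_snd_in_verts by fastforce
  then show ?thesis using c(1) unfolding colorable_def by blast
qed

end
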